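(* Let $k\ge1$, $K=3k+4$. For all integers $0\le a,b\le k$, \begin{align*} \tilde\chi^K_{a,b}(q)&=\sum_{\substack{\lambda_1,\dots,\lambda_k\ge0\\ \mu_1,\dots,\mu_k\ge0}}\frac{q^{\sum_{i=a+1}^k\lambda_i+\sum_{i=b+1}^k\mu_i}}{(q;q)_{\lambda_1}}\prod_{i=1}^kq^{\lambda_i^2-\lambda_i\mu_i+\mu_i^2}\binom{\lambda_i}{\lambda_{i+1}}_q\binom{\lambda_i-\lambda_{i+1}+\mu_{i+1}+\delta_{b,i}}{\mu_i}_q\\ &\quad-\chi(ab>0)\sum_{\substack{\lambda_1,\dots,\lambda_k\ge0\\ \mu_1,\dots,\mu_k\ge0}}\frac{q^{1+\sum_{i=a}^k\lambda_i+\sum_{i=b}^k\mu_i}}{(q;q)_{\lambda_1}}\prod_{i=1}^kq^{\lambda_i^2-\lambda_i\mu_i+\mu_i^2}\binom{\lambda_i}{\lambda_{i+1}}_q\binom{\lambda_i-\lambda_{i+1}+\mu_{i+1}+\delta_{b-1,i}}{\mu_i}_q, \end{align*} and moreover \[\tilde\chi^K_{k,k}(q)=\sum_{\substack{\lambda_1,\dots,\lambda_k\ge0\\ \mu_1,\dots,\mu_k\ge0}}\frac{1}{(q;q)_{\lambda_1}}\prod_{i=1}^kq^{\lambda_i^2-\lambda_i\mu_i+\mu_i^2}\binom{\lambda_i}{\lambda_{i+1}}_q\binom{\lambda_i-\lambda_{i+1}+\mu_{i+1}}{\mu_i}_q,\] where in all sums $\lambda_{k+1}:=0$ and $\mu_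{k+1}:=\lambda_k$.
   Context: $(a;q)_n=\prod_{j=0}^{n-1}(1-aq^j)$, $(a;q)_\infty=\prod_{j\ge0}(1-aq^j)$; $\binom{n}{m}_q=\frac{(q;q)_n}{(q;q)_m(q;q)_{n-m}}$ for $0\le m\le n$ and $0$ otherwise. $\delta_{i,j}$ is the Kronecker delta, $\chi(\cdot)$ the indicator function. $\theta(z;q)=(z;q)_\infty(q/z;q)_\infty$, $\theta(z_1,\dots,z_n;q)=\prod\theta(z_i;q)$. For integers $a,b\ge0$ with $a+b\le K-3$, \[\tilde\chi^K_{a,b}(q):=\frac{(q^K;q^K)_\infty^2}{(q;q)_\infty^2}\,\theta\big(q^{a+1},q^{b+1},q^{a+b+2};q^K\big).\] *)

theory Defs
  imports "HOL-Analysis.Analysis"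
begin

definition qpoch :: "complex \<Rightarrow> complex \<Rightarrow> nat \<Rightarrow> complex" where
  "qpoch a q n = (\<Prod>j<n. 1 - a * q ^ j)"

definition qpoch_inf :: "complex \<Rightarrow> complex \<Rightarrow> complex" where
  "qpoch_inf a q = (\<Prod>j. 1 - a * q ^ j)"

definition qbinom :: "complex \<Rightarrow> int \<Rightarrow> int \<Rightarrow> complex" where
  "qbinom q n m = (if 0 \<le> m \<and> m \<le> n
     then qpoch q q (nat n) / (qpoch q q (nat m) * qpoch q q (nat (n - m))) else 0)"

definition qtheta :: "complex \<Rightarrow> complex \<Rightarrow> complex" where
  "qtheta z p = qpoch_inf z p * qpoch_inf (p / z) p"

definition chi_tilde :: "nat \<Rightarrow> nat \<Rightarrow> nat \<Rightarrow> complex \<Rightarrow> complex" where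
  "chi_tilde K a b q = (qpoch_inf (q ^ K) (q ^ K))\<^sup>2 / (qpoch_inf q q)\<^sup>2
     * qtheta (q ^ (a + 1)) (q ^ K) * qtheta (q ^ (b + 1)) (q ^ K)
     * qtheta (q ^ (a + b + 2)) (q ^ K)"

definition lam_ext :: "nat \<Rightarrow> (nat \<Rightarrow> nat) \<Rightarrow> nat \<Rightarrow> int" where
  "lam_ext k l i = (if i = k + 1 then 0 else int (l i))"

definition mu_ext :: "nat \<Rightarrow> (nat \<Rightarrow> nat) \<Rightarrow> (nat \<Rightarrow> nat) \<Rightarrow> nat \<Rightarrow> int" where
  "mu_ext k l m i = (if i = k + 1 then int (l k) else int (m i))"

definition summand :: "complex \<Rightarrow> nat \<Rightarrow> (nat \<Rightarrow> int) \<Rightarrow> (nat \<Rightarrow> nat) \<Rightarrow> (nat \<Rightarrow> nat) \<Rightarrow> complex" where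
  "summand q k d l m = (1 / qpoch q q (l 1)) *
     (\<Prod>i\<in>{1..k}. q ^ nat (int (l i)^2 - int (l i) * int (m i) + int (m i)^2)
        * qbinom q (lam_ext k l i) (lam_ext k l (i + 1))
        * qbinom q (lam_ext k l i - lam_ext k l (i + 1) + mu_ext k l m (i + 1) + d i) (int (m i)))"

definition idx :: "nat \<Rightarrow> ((nat \<Rightarrow> nat) \<times> (nat \<Rightarrow> nat)) set" where
  "idx k = (PiE {1..k} (\<lambda>_. UNIV)) \<times> (PiE {1..k} (\<lambda>_. UNIV))"

end

theory Submission
  imports Defs
begin

text \<open>
  Write \<open>(n) = 1 / (q;q)\<^sub>n\<close>, read as \<open>0\<close> for \<open>n < 0\<close>. The idea is to compute in two ways the nested finite sum which
  starts from \<open>(\<lambda>\<^sub>k) (\<mu>\<^sub>k) (\<lambda>\<^sub>k + \<mu>\<^sub>k + 1)\<close> and repeatedly applies the A2 Bailey step: multiply by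
  \<open>q\<close> to the power \<open>\<lambda>\<^sub>i\<^sup>2 - \<lambda>\<^sub>i \<mu>\<^sub>i + \<mu>\<^sub>i\<^sup>2\<close> (plus \<open>\<lambda>\<^sub>i\<close> if \<open>i > a\<close>, plus \<open>\<mu>\<^sub>i\<close> if \<open>i > b\<close>) and by
  \<open>(L - \<lambda>\<^sub>i) (M - \<mu>\<^sub>i)\<close>, and sum over \<open>\<lambda>\<^sub>i, \<mu>\<^sub>i\<close>.

  On one side, carrying out the \<open>\<mu>\<close>-sums with a Durfee-type transformation turns the nested sum into the
  \<open>q\<close>-binomial multisum of the theorem. On the other side, the kernel
  \<open>(q;q)\<close>\<open>\<^bsub>x+y\<^esub>\<close> times the product of all \<open>(x + k\<^sub>i) (y - k\<^sub>i)\<close> is reproduced by the Bailey step up to a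
  power of \<open>q\<close> that is quadratic in \<open>k\<close>; the starting function is a signed sum of such kernels over the
  root lattice of A2. The linear exponents \<open>\<lambda>\<^sub>i\<close> and \<open>\<mu>\<^sub>i\<close> correspond to three shifted versions of the
  kernel. Antisymmetry under permutations of \<open>k\<close> permits passing from one version to the next; the last passage
  produces the correction term, the sum for \<open>(a - 1, b - 1)\<close>. When \<open>L, M\<close> tend to infinity, only the
  signed lattice sum remains, and the A2 Macdonald identity, obtained from three Jacobi triple products, evaluates it.
\<close>

section \<open>q-factorials and q-Vandermonde sums\<close>

text \<open>The modulus \<open>3 * k + 4\<close> arises because the seed carries \<open>q\<close> to
  the power \<open>4 * qexp x y\<close> and each of the \<open>k\<close> steps adds
  \<open>3 * qexp x y\<close>. The shifts in the three kernels are forced: completing the exponent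
  of a step with linear part p1 lambda + p2 mu requires the offset p1 + p2 in the second argument
  and k1 + k2 + k3 = 2 p1 + p2. The obstacle is that the kernels are not proportional to one
  another. They are related only after antisymmetrising, so a change of kernel is an identity
  between lattice sums, not between their terms. The last change leaves a factor 1 - q^(L+z); its
  second half carries q^L, which the next step absorbs by raising its own linear exponent, and so
  the correction is again a chain of the same kind. The linear part is dropped in the order lambda +
  mu, lambda, 0, hence \<open>a \<le> b\<close> in the chains; the other case follows by exchanging
  lambda and mu. A kernel tends to (q;q)_inf^(-5) and the Macdonald identity returns two powers,
  while the multisum side collects three factors 1/(q;q)_inf, so the same power cancels.\<close>

locale qser =
  fixes q :: complex
  assumes q_nonzero: "q \<noteq> 0" and norm_q_less_1: "norm q < 1"
begin

lemma powi_neq_1: "n \<noteq> 0 \<Longrightarrow> q powi n \<noteq> 1"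
proof -
  have pos: "q ^ m \<noteq> 1" if "m > 0" for m :: nat
    using norm_q_less_1 that by (metis norm_one norm_power norm_ge_zero order_less_irrefl power_Suc_less_one
        power_less_one_iff zero_less_iff_neq_zero)
  assume "n \<noteq> 0"
  then show ?thesis
    using pos[of "nat \<bar>n\<bar>"] by (auto simp: power_int_def power_inverse)
qed

text \<open>Total on the integers, with value 1 for negative \<open>n\<close>, so that dividing by
  it is always legitimate.\<close>

definition qfac :: "int \<Rightarrow> complex" where
  "qfac n = qpoch q q (nat n)"

text \<open>Extension by 0 encodes the support of every sum, so ranges may be enlarged freely;
  \<open>rqfac_pred\<close> then holds on all integers because 1 - q^0 = 0.\<close>

definition rqfac :: "int \<Rightarrow> complex" where
  "rqfac n = (if n < 0 then 0 else 1 / qfac n)"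

lemma powi_add: "q powi (m + n) = q powi m * q powi n"
  using q_nonzero by (rule power_int_add[OF disjI1])

lemma qfac_rec: "n \<ge> 1 \<Longrightarrow> qfac n = (1 - q powi n) * qfac (n - 1)"
proof -
  assume "n \<ge> 1"
  then obtain m where m: "n = int (Suc m)"
    by (metis Suc_pred nat_int_comparison(2) int_nat_eq less_le_trans not_le of_nat_0_less_iff
        zero_less_one zero_less_imp_eq_int)
  show ?thesis unfolding m
    by (simp add: qfac_def qpoch_def nat_add_distrib power_int_add q_nonzero mult.commute)
qed

lemma qfac_0 [simp]: "qfac 0 = 1"
  by (simp add: qfac_def qpoch_def)

lemma qfac_nonzero [simp]: "qfac n \<noteq> 0"
proof -
  have "q * q ^ j \<noteq> 1" for j
    using powi_neq_1[of "int (Suc j)"] by (simp del: of_nat_Suc)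
  then show ?thesis
    by (simp add: qfac_def qpoch_def)
qed

lemma rqfac_neg [simp]: "n < 0 \<Longrightarrow> rqfac n = 0"
  by (simp add: rqfac_def)

lemma rqfac_0 [simp]: "rqfac 0 = 1"
  by (simp add: rqfac_def)

lemma rqfac_qfac: "n \<ge> 0 \<Longrightarrow> rqfac n * qfac n = 1"
  by (simp add: rqfac_def)

lemma rqfac_pred: "rqfac (n - 1) = (1 - q powi n) * rqfac n"
proof (cases "n \<ge> 1")
  case True
  then show ?thesis
    using qfac_rec[of n] powi_neq_1[of n] by (simp add: rqfac_def)
next
  case False
  then show ?thesis
    by (cases "n = 0") auto
qed

lemma rqfac_eq_succ: "rqfac n = (1 - q powi (n + 1)) * rqfac (n + 1)"
  using rqfac_pred[of "n + 1"] by simp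

section \<open>Re-indexing sums over integer intervals\<close>

lemma sum_shift_int: "(\<Sum>s=lo..hi. f (s + c)) = (\<Sum>s=lo + c..hi + (c::int). f s)"
  by (rule sum.reindex_bij_witness[of _ "\<lambda>s. s - c" "\<lambda>s. s + c"]) auto

lemma sum_uminus_int: "(\<Sum>s=lo..hi. f (- s)) = (\<Sum>s=- hi..- (lo::int). f s)"
  by (rule sum.reindex_bij_witness[of _ "\<lambda>s. - s" "\<lambda>s. - s"]) auto

lemma sum_int_superset:
  assumes "lo' \<le> lo" "hi \<le> hi'" "\<And>s. s < lo \<Longrightarrow> f s = 0" "\<And>s. s > hi \<Longrightarrow> f s = 0"
  shows "(\<Sum>s=lo'..hi'. f s) = (\<Sum>s=lo..(hi::int). f s :: complex)"
  by (rule sum.mono_neutral_right) (use assms in force)+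

text \<open>Symmetric form of the q-Chu-Vandermonde sum, by induction on \<open>M\<close>: splitting
  1 - q^(M+1) as (1 - q^(M+1-s)) + q^(M+1-s) (1 - q^s) lowers \<open>M\<close> in one half and,
  after a shift of \<open>s\<close>, turns (N, r) into (N - 1, r + 1) in the other. This is why
  \<open>N\<close> and \<open>r\<close> are arbitrary integers.\<close>

lemma vandermonde_nat:
  "(\<Sum>s=0..int M. q powi (s * (s + r)) * rqfac s * rqfac (s + r) * rqfac (int M - s) * rqfac (N - s))
    = qfac (int M + N + r) * rqfac (int M) * rqfac N * rqfac (int M + r) * rqfac (N + r)"
proof (induction M arbitrary: N r)
  case 0
  show ?case
    by (cases "N \<ge> 0 \<and> r \<ge> 0") (auto simp: rqfac_def not_le)
next
  case (Suc M)
  define m where "m = int M"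
  have mS: "int (Suc M) = m + 1" by (simp add: m_def)
  let ?t = "\<lambda>M N r s. q powi (s * (s + r)) * rqfac s * rqfac (s + r) * rqfac (M - s) * rqfac (N - s)"
  have split: "(1 - q powi (m + 1)) * ?t (m + 1) N r s
      = ?t m N r s + q powi (m + 1 + r) * ?t m (N - 1) (r + 1) (s - 1)" for s
  proof -
    have 1: "1 - q powi (m + 1) = (1 - q powi (m + 1 - s)) + q powi (m + 1 - s) * (1 - q powi s)"
      by (simp add: algebra_simps flip: powi_add)
    have 2: "(1 - q powi (m + 1 - s)) * rqfac (m + 1 - s) = rqfac (m - s)"
      using rqfac_pred[of "m + 1 - s"] by simp
    have 3: "(1 - q powi s) * rqfac s = rqfac (s - 1)"
      by (simp add: rqfac_pred)
    have 4: "q powi (m + 1 - s) * q powi (s * (s + r)) = q powi (m + 1 + r) * q powi ((s - 1) * (s - 1 + (r + 1)))"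
      unfolding powi_add[symmetric] by (rule arg_cong[where f="\<lambda>n. q powi n"]) (simp add: algebra_simps)
    have "(1 - q powi (m + 1)) * ?t (m + 1) N r s
      = q powi (s * (s + r)) * rqfac s * rqfac (s + r) * ((1 - q powi (m + 1 - s)) * rqfac (m + 1 - s)) * rqfac (N - s)
       + (q powi (m + 1 - s) * q powi (s * (s + r))) * ((1 - q powi s) * rqfac s) * rqfac (s + r) * rqfac (m + 1 - s) * rqfac (N - s)"
      unfolding 1 by (simp add: algebra_simps)
    also have "\<dots> = ?t m N r s + q powi (m + 1 + r) * ?t m (N - 1) (r + 1) (s - 1)"
      unfolding 2 3 4 by (simp add: algebra_simps)
    finally show ?thesis .
  qed
  have sh: "(\<Sum>s=0..m+1. ?t m (N - 1) (r + 1) (s - 1)) = (\<Sum>s=0..m. ?t m (N - 1) (r + 1) s)"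
    using sum_shift_int[of "?t m (N - 1) (r + 1)" "-1" 0 "m + 1"]
      sum_int_superset[of "-1" 0 m m "?t m (N - 1) (r + 1)"] by simp
  have e: "(\<Sum>s=0..m+1. ?t m N r s) = (\<Sum>s=0..m. ?t m N r s)"
    by (rule sum_int_superset) auto
  have "(1 - q powi (m + 1)) * (\<Sum>s=0..m+1. ?t (m + 1) N r s)
      = (\<Sum>s=0..m. ?t m N r s) + q powi (m + 1 + r) * (\<Sum>s=0..m. ?t m (N - 1) (r + 1) s)"
    unfolding sum_distrib_left split sum.distrib e by (simp only: sum_distrib_left[symmetric] sh)
  also have "\<dots> = qfac (m + N + r) * rqfac m * rqfac N * rqfac (m + r) * rqfac (N + r)
     + q powi (m + 1 + r) * (qfac (m + N + r) * rqfac m * rqfac (N - 1) * rqfac (m + 1 + r) * rqfac (N + r))"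
    using Suc.IH[of r N] Suc.IH[of "r + 1" "N - 1"] by (simp add: m_def algebra_simps)
  also have "\<dots> = qfac (m + N + r) * rqfac m * rqfac N * rqfac (m + 1 + r) * rqfac (N + r) *
       ((1 - q powi (m + 1 + r)) + q powi (m + 1 + r) * (1 - q powi N))"
    unfolding rqfac_pred[of N] rqfac_eq_succ[of "m + r"] by (simp add: algebra_simps)
  also have "(1 - q powi (m + 1 + r)) + q powi (m + 1 + r) * (1 - q powi N) = 1 - q powi (m + 1 + N + r)"
    by (simp add: algebra_simps flip: powi_add)
  also have "qfac (m + N + r) * rqfac m * rqfac N * rqfac (m + 1 + r) * rqfac (N + r) * (1 - q powi (m + 1 + N + r))
     = rqfac m * (qfac (m + 1 + N + r) * rqfac N * rqfac (m + 1 + r) * rqfac (N + r))"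
  \<comment> \<open>The recursion of \<open>qfac\<close> needs a positive index; for negative
    \<open>N + r\<close> the common factor \<open>rqfac (N + r)\<close> kills both sides.\<close>
  proof (cases "N + r \<ge> 0")
    case True
    then have "qfac (m + 1 + N + r) = (1 - q powi (m + 1 + N + r)) * qfac (m + N + r)"
      using qfac_rec[of "m + 1 + N + r"] by (simp add: m_def algebra_simps)
    then show ?thesis by simp
  qed auto
  also have "rqfac m = (1 - q powi (m + 1)) * rqfac (m + 1)"
    by (rule rqfac_eq_succ)
  finally have "(1 - q powi (m + 1)) * (\<Sum>s=0..m+1. ?t (m + 1) N r s) =
      (1 - q powi (m + 1)) * (qfac (m + 1 + N + r) * rqfac (m + 1) * rqfac N * rqfac (m + 1 + r) * rqfac (N + r))"
    by (simp add: algebra_simps)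
  moreover have "1 - q powi (m + 1) \<noteq> 0"
    using powi_neq_1[of "m + 1"] by (simp add: m_def)
  ultimately show ?case unfolding mS by simp
qed

text \<open>The two bounds say that the window contains the interval from -x to M, outside of which
  every summand vanishes.\<close>

lemma vandermonde:
  assumes "lo \<le> - x" "M \<le> hi"
  shows "(\<Sum>s=lo..hi. q powi ((s + x) * (s + y)) * rqfac (s + x) * rqfac (s + y) * rqfac (M - s) * rqfac (N - s))
    = qfac (M + N + x + y) * rqfac (M + x) * rqfac (M + y) * rqfac (N + x) * rqfac (N + y)"
proof (cases "M + x \<ge> 0")
  case True
  let ?f = "\<lambda>s. q powi (s * (s + (y - x))) * rqfac s * rqfac (s + (y - x)) * rqfac ((M + x) - s) * rqfac ((N + x) - s)"
  have "(\<Sum>s=lo..hi. q powi ((s + x) * (s + y)) * rqfac (s + x) * rqfac (s + y) * rqfac (M - s) * rqfac (N - s))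
      = (\<Sum>s=lo..hi. ?f (s + x))" by (simp add: algebra_simps)
  also have "\<dots> = (\<Sum>s=lo + x..hi + x. ?f s)" by (rule sum_shift_int)
  also have "\<dots> = (\<Sum>s=0..M + x. ?f s)"
    by (rule sum_int_superset) (use assms in auto)
  also have "\<dots> = qfac (M + N + x + y) * rqfac (M + x) * rqfac (M + y) * rqfac (N + x) * rqfac (N + y)"
    using vandermonde_nat[of "y - x" "nat (M + x)" "N + x"] True by (simp add: algebra_simps)
  finally show ?thesis .
next
  case False
  have "rqfac (s + x) * rqfac (M - s) = 0" for s
    using False by (cases "s + x < 0") auto
  then have "q powi ((s + x) * (s + y)) * rqfac (s + x) * rqfac (s + y) * rqfac (M - s) * rqfac (N - s) = 0" for s
    by auto
  then have "(\<Sum>s=lo..hi. q powi ((s + x) * (s + y)) * rqfac (s + x) * rqfac (s + y) * rqfac (M - s) * rqfac (N - s)) = 0"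
    by (rule sum.neutral[OF ballI])
  then show ?thesis using False by simp
qed

text \<open>The case N = infinity of the previous sum, obtained algebraically: the same recursion
  works with the factor of \<open>N\<close> deleted, so no convergence is involved.\<close>

lemma vandermonde_lim_nat:
  "(\<Sum>s=0..int M. q powi (s * (s + r)) * rqfac s * rqfac (s + r) * rqfac (int M - s))
    = rqfac (int M) * rqfac (int M + r)"
proof (induction M arbitrary: r)
  case 0
  show ?case by simp
next
  case (Suc M)
  define m where "m = int M"
  have mS: "int (Suc M) = m + 1" by (simp add: m_def)
  let ?t = "\<lambda>M r s. q powi (s * (s + r)) * rqfac s * rqfac (s + r) * rqfac (M - s)"
  have split: "(1 - q powi (m + 1)) * ?t (m + 1) r s
      = ?t m r s + q powi (m + 1 + r) * ?t m (r + 1) (s - 1)" for s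
  proof -
    have 1: "1 - q powi (m + 1) = (1 - q powi (m + 1 - s)) + q powi (m + 1 - s) * (1 - q powi s)"
      by (simp add: algebra_simps flip: powi_add)
    have 2: "(1 - q powi (m + 1 - s)) * rqfac (m + 1 - s) = rqfac (m - s)"
      using rqfac_pred[of "m + 1 - s"] by simp
    have 3: "(1 - q powi s) * rqfac s = rqfac (s - 1)"
      by (simp add: rqfac_pred)
    have 4: "q powi (m + 1 - s) * q powi (s * (s + r)) = q powi (m + 1 + r) * q powi ((s - 1) * (s - 1 + (r + 1)))"
      unfolding powi_add[symmetric] by (rule arg_cong[where f="\<lambda>n. q powi n"]) (simp add: algebra_simps)
    have "(1 - q powi (m + 1)) * ?t (m + 1) r s
      = q powi (s * (s + r)) * rqfac s * rqfac (s + r) * ((1 - q powi (m + 1 - s)) * rqfac (m + 1 - s))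
       + (q powi (m + 1 - s) * q powi (s * (s + r))) * ((1 - q powi s) * rqfac s) * rqfac (s + r) * rqfac (m + 1 - s)"
      unfolding 1 by (simp add: algebra_simps)
    also have "\<dots> = ?t m r s + q powi (m + 1 + r) * ?t m (r + 1) (s - 1)"
      unfolding 2 3 4 by (simp add: algebra_simps)
    finally show ?thesis .
  qed
  have sh: "(\<Sum>s=0..m+1. ?t m (r + 1) (s - 1)) = (\<Sum>s=0..m. ?t m (r + 1) s)"
    using sum_shift_int[of "?t m (r + 1)" "-1" 0 "m + 1"]
      sum_int_superset[of "-1" 0 m m "?t m (r + 1)"] by simp
  have e: "(\<Sum>s=0..m+1. ?t m r s) = (\<Sum>s=0..m. ?t m r s)"
    by (rule sum_int_superset) auto
  have "(1 - q powi (m + 1)) * (\<Sum>s=0..m+1. ?t (m + 1) r s)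
      = (\<Sum>s=0..m. ?t m r s) + q powi (m + 1 + r) * (\<Sum>s=0..m. ?t m (r + 1) s)"
    unfolding sum_distrib_left split sum.distrib e by (simp only: sum_distrib_left[symmetric] sh)
  also have "\<dots> = rqfac m * rqfac (m + r) + q powi (m + 1 + r) * (rqfac m * rqfac (m + r + 1))"
    using Suc.IH[of r] Suc.IH[of "r + 1"] by (simp add: m_def algebra_simps)
  also have "\<dots> = rqfac m * rqfac (m + r + 1)"
    unfolding rqfac_eq_succ[of "m + r"] by (simp add: algebra_simps)
  also have "rqfac m = (1 - q powi (m + 1)) * rqfac (m + 1)"
    by (rule rqfac_eq_succ)
  finally have "(1 - q powi (m + 1)) * (\<Sum>s=0..m+1. ?t (m + 1) r s) =
      (1 - q powi (m + 1)) * (rqfac (m + 1) * rqfac (m + 1 + r))"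
    by (simp add: algebra_simps)
  moreover have "1 - q powi (m + 1) \<noteq> 0"
    using powi_neq_1[of "m + 1"] by (simp add: m_def)
  ultimately show ?case unfolding mS by simp
qed

lemma vandermonde_lim:
  assumes "lo \<le> - x" "M \<le> hi"
  shows "(\<Sum>s=lo..hi. q powi ((s + x) * (s + y)) * rqfac (s + x) * rqfac (s + y) * rqfac (M - s))
    = rqfac (M + x) * rqfac (M + y)"
proof (cases "M + x \<ge> 0")
  case True
  let ?f = "\<lambda>s. q powi (s * (s + (y - x))) * rqfac s * rqfac (s + (y - x)) * rqfac ((M + x) - s)"
  have "(\<Sum>s=lo..hi. q powi ((s + x) * (s + y)) * rqfac (s + x) * rqfac (s + y) * rqfac (M - s))
      = (\<Sum>s=lo..hi. ?f (s + x))" by (simp add: algebra_simps)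
  also have "\<dots> = (\<Sum>s=lo + x..hi + x. ?f s)" by (rule sum_shift_int)
  also have "\<dots> = (\<Sum>s=0..M + x. ?f s)"
    by (rule sum_int_superset) (use assms in auto)
  also have "\<dots> = rqfac (M + x) * rqfac (M + y)"
    using vandermonde_lim_nat[of "y - x" "nat (M + x)"] True by (simp add: algebra_simps)
  finally show ?thesis .
next
  case False
  have "rqfac (s + x) * rqfac (M - s) = 0" for s
    using False by (cases "s + x < 0") auto
  then have "q powi ((s + x) * (s + y)) * rqfac (s + x) * rqfac (s + y) * rqfac (M - s) = 0" for s
    by auto
  then have "(\<Sum>s=lo..hi. q powi ((s + x) * (s + y)) * rqfac (s + x) * rqfac (s + y) * rqfac (M - s)) = 0"
    by (rule sum.neutral[OF ballI])
  then show ?thesis using False by simp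
qed

lemma vandermonde_lim_reflect:
  assumes "lo \<le> - M" "x \<le> hi"
  shows "(\<Sum>c=lo..hi. q powi ((x - c) * (y - c)) * rqfac (x - c) * rqfac (y - c) * rqfac (c + M))
    = rqfac (M + x) * rqfac (M + y)"
  using vandermonde_lim[of "-hi" x M "-lo" y] assms
    sum_uminus_int[of "\<lambda>s. q powi ((s + x) * (s + y)) * rqfac (s + x) * rqfac (s + y) * rqfac (M - s)" lo hi]
  by (simp add: algebra_simps)

text \<open>Both forms expand one factor \<open>rqfac\<close> by \<open>vandermonde_lim\<close>, after which the sum over \<open>r\<close> is again a Vandermonde sum.\<close>

lemma durfee_transform:
  assumes "lo \<le> - A" "L \<le> hi"
  shows "rqfac (A + B - h) * (\<Sum>r=lo..hi. q powi (r * r + h * r) * rqfac (L - r) * rqfac (r + A) * rqfac (r + B))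
    = rqfac (L + B) * (\<Sum>c=lo..hi. q powi (c * c + h * c) * rqfac (c + A) * rqfac (B - h - c) * rqfac (L - c))"
proof -
  have "rqfac (A + B - h) * (\<Sum>r=lo..hi. q powi (r * r + h * r) * rqfac (L - r) * rqfac (r + A) * rqfac (r + B))
     = (\<Sum>r=lo..hi. q powi (r * r + h * r) * rqfac (L - r) * rqfac (r + B) * (rqfac (A + r) * rqfac (A + (B - h))))"
    by (simp add: sum_distrib_left algebra_simps)
  also have "\<dots> = (\<Sum>r=lo..hi. q powi (r * r + h * r) * rqfac (L - r) * rqfac (r + B) *
      (\<Sum>c=lo..hi. q powi ((r - c) * ((B - h) - c)) * rqfac (r - c) * rqfac ((B - h) - c) * rqfac (c + A)))"
    by (rule sum.cong[OF refl]) (subst vandermonde_lim_reflect, use assms in auto)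
  also have "\<dots> = (\<Sum>c=lo..hi. \<Sum>r=lo..hi. (q powi (r * r + h * r) * q powi ((r - c) * ((B - h) - c))) * rqfac (L - r) * rqfac (r + B) *
      rqfac (r - c) * rqfac ((B - h) - c) * rqfac (c + A))"
    unfolding sum_distrib_left by (subst sum.swap) (simp add: algebra_simps)
  also have "\<dots> = (\<Sum>c=lo..hi. q powi (c * c + h * c) * rqfac ((B - h) - c) * rqfac (c + A) *
     (\<Sum>r=lo..hi. q powi ((r + (- c)) * (r + B)) * rqfac (r + (- c)) * rqfac (r + B) * rqfac (L - r)))"
  proof (rule sum.cong[OF refl])
    fix c
    \<comment> \<open>The quadratic exponents combine so that \<open>r\<close> enters only through
      (r - c)(r + B), the exponent of a Vandermonde sum in \<open>r\<close>.\<close>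
    have "q powi (r * r + h * r) * q powi ((r - c) * ((B - h) - c))
       = q powi (c * c + h * c) * q powi ((r + (- c)) * (r + B))" for r
      unfolding powi_add[symmetric] by (rule arg_cong[where f="\<lambda>n. q powi n"]) (simp add: algebra_simps)
    then show "(\<Sum>r=lo..hi. (q powi (r * r + h * r) * q powi ((r - c) * ((B - h) - c))) * rqfac (L - r) * rqfac (r + B) *
      rqfac (r - c) * rqfac ((B - h) - c) * rqfac (c + A)) = q powi (c * c + h * c) * rqfac ((B - h) - c) * rqfac (c + A) *
     (\<Sum>r=lo..hi. q powi ((r + (- c)) * (r + B)) * rqfac (r + (- c)) * rqfac (r + B) * rqfac (L - r))"
      by (simp add: sum_distrib_left algebra_simps)
  qed
  also have "\<dots> = (\<Sum>c=lo..hi. q powi (c * c + h * c) * rqfac ((B - h) - c) * rqfac (c + A) * (rqfac (L + (- c)) * rqfac (L + B)))"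
    by (rule sum.cong[OF refl]) (subst vandermonde_lim, use assms in auto)
  also have "\<dots> = rqfac (L + B) * (\<Sum>c=lo..hi. q powi (c * c + h * c) * rqfac (c + A) * rqfac (B - h - c) * rqfac (L - c))"
    by (simp add: sum_distrib_left algebra_simps)
  finally show ?thesis .
qed

lemma durfee_transform':
  assumes "lo \<le> - A" "L \<le> hi" "lo' \<le> - A" "B - h \<le> hi'"
  shows "rqfac (A + B - h) * (\<Sum>r=lo..hi. q powi (r * r + h * r) * rqfac (L - r) * rqfac (r + A) * rqfac (r + B))
    = rqfac (L + A) * (\<Sum>c=lo'..hi'. q powi (c * c + h * c) * rqfac (c + A) * rqfac (B - h - c) * rqfac (L + c + h))"
proof -
  have "rqfac (A + B - h) * (\<Sum>r=lo..hi. q powi (r * r + h * r) * rqfac (L - r) * rqfac (r + A) * rqfac (r + B))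
     = (\<Sum>r=lo..hi. q powi (r * r + h * r) * rqfac (L - r) * rqfac (r + A) * (rqfac ((B - h) + A) * rqfac ((B - h) + (r + h))))"
    by (simp add: sum_distrib_left algebra_simps)
  also have "\<dots> = (\<Sum>r=lo..hi. q powi (r * r + h * r) * rqfac (L - r) * rqfac (r + A) *
      (\<Sum>c=lo'..hi'. q powi ((c + A) * (c + (r + h))) * rqfac (c + A) * rqfac (c + (r + h)) * rqfac ((B - h) - c)))"
    by (rule sum.cong[OF refl]) (subst vandermonde_lim, use assms in auto)
  also have "\<dots> = (\<Sum>c=lo'..hi'. \<Sum>r=lo..hi. (q powi (r * r + h * r) * q powi ((c + A) * (c + (r + h)))) * rqfac (L - r) * rqfac (r + A) *
      rqfac (c + A) * rqfac (c + (r + h)) * rqfac ((B - h) - c))"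
    unfolding sum_distrib_left by (subst sum.swap) (simp add: algebra_simps)
  also have "\<dots> = (\<Sum>c=lo'..hi'. q powi (c * c + h * c) * rqfac ((B - h) - c) * rqfac (c + A) *
     (\<Sum>r=lo..hi. q powi ((r + A) * (r + (c + h))) * rqfac (r + A) * rqfac (r + (c + h)) * rqfac (L - r)))"
  proof (rule sum.cong[OF refl])
    fix c
    have "q powi (r * r + h * r) * q powi ((c + A) * (c + (r + h)))
       = q powi (c * c + h * c) * q powi ((r + A) * (r + (c + h)))" for r
      unfolding powi_add[symmetric] by (rule arg_cong[where f="\<lambda>n. q powi n"]) (simp add: algebra_simps)
    then show "(\<Sum>r=lo..hi. (q powi (r * r + h * r) * q powi ((c + A) * (c + (r + h)))) * rqfac (L - r) * rqfac (r + A) *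
      rqfac (c + A) * rqfac (c + (r + h)) * rqfac ((B - h) - c)) = q powi (c * c + h * c) * rqfac ((B - h) - c) * rqfac (c + A) *
     (\<Sum>r=lo..hi. q powi ((r + A) * (r + (c + h))) * rqfac (r + A) * rqfac (r + (c + h)) * rqfac (L - r))"
      by (simp add: sum_distrib_left algebra_simps)
  qed
  also have "\<dots> = (\<Sum>c=lo'..hi'. q powi (c * c + h * c) * rqfac ((B - h) - c) * rqfac (c + A) * (rqfac (L + A) * rqfac (L + (c + h))))"
    by (rule sum.cong[OF refl]) (subst vandermonde_lim, use assms in auto)
  also have "\<dots> = rqfac (L + A) * (\<Sum>c=lo'..hi'. q powi (c * c + h * c) * rqfac (c + A) * rqfac (B - h - c) * rqfac (L + c + h))"
    by (simp add: sum_distrib_left algebra_simps)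
  finally show ?thesis .
qed

end

section \<open>The A2 Bailey step\<close>

context qser
begin

definition bker :: "int \<Rightarrow> int \<Rightarrow> int \<Rightarrow> int \<Rightarrow> int \<Rightarrow> complex" where
  "bker x y k1 k2 k3 = qfac (x + y) * (rqfac (x + k1) * rqfac (x + k2) * rqfac (x + k3)
     * (rqfac (y - k1) * rqfac (y - k2) * rqfac (y - k3)))"

lemma powi_cong: "m = n \<Longrightarrow> q powi m = q powi n"
  by simp

lemma sum_reverse3:
  "(\<Sum>a\<in>A. \<Sum>b\<in>B. \<Sum>c\<in>C. f a b c) = (\<Sum>c\<in>C. \<Sum>b\<in>B. \<Sum>a\<in>A. (f a b c :: complex))"
proof -
  have "(\<Sum>a\<in>A. \<Sum>b\<in>B. \<Sum>c\<in>C. f a b c) = (\<Sum>b\<in>B. \<Sum>a\<in>A. \<Sum>c\<in>C. f a b c)"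
    by (rule sum.swap)
  also have "\<dots> = (\<Sum>b\<in>B. \<Sum>c\<in>C. \<Sum>a\<in>A. f a b c)"
    by (intro sum.cong refl sum.swap)
  also have "\<dots> = (\<Sum>c\<in>C. \<Sum>b\<in>B. \<Sum>a\<in>A. f a b c)"
    by (rule sum.swap)
  finally show ?thesis .
qed

text \<open>\<open>vandermonde\<close> read backwards removes (q;q)_(r1+r2), the only factor of the
  kernel that couples its two arguments. The price is a broken symmetry: \<open>k3\<close> is
  singled out.\<close>

lemma bker_expand:
  assumes "r1 + k1 \<le> hi"
  shows "bker r1 r2 k1 k2 k3 = rqfac (r1 + k3) * rqfac (r2 - k3) *
    (\<Sum>j=0..hi. q powi (j * (j + (k2 - k1))) * rqfac j * rqfac (j + (k2 - k1)) * rqfac (r1 + k1 - j) * rqfac (r2 - k2 - j))"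
proof -
  have "(\<Sum>j=0..hi. q powi (j * (j + (k2 - k1))) * rqfac j * rqfac (j + (k2 - k1)) * rqfac (r1 + k1 - j) * rqfac (r2 - k2 - j))
     = qfac (r1 + r2) * rqfac (r1 + k1) * rqfac (r1 + k2) * rqfac (r2 - k2) * rqfac (r2 - k1)"
    using vandermonde[of 0 0 "r1 + k1" hi "k2 - k1" "r2 - k2"] assms by (simp add: algebra_simps)
  then show ?thesis by (simp add: bker_def)
qed

text \<open>Expanding the kernel decouples \<open>r1\<close> from \<open>r2\<close> except for \<open>q\<close> to the power \<open>- r1 * r2\<close>; the remaining sums can then be evaluated one at a time.\<close>

lemma bailey_A2_box:
  fixes k1 k2 k3 L1 L2 B :: int
  defines "s \<equiv> k1 + k2 + k3"
  assumes B: "B \<ge> \<bar>L1\<bar> + \<bar>L2\<bar> + \<bar>k1\<bar> + \<bar>k2\<bar> + \<bar>k3\<bar>"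
  shows "(\<Sum>r1=-B..B. \<Sum>r2=-B..B. q powi (r1 * r1 - r1 * r2 + r2 * r2 + s * (r1 - r2)) * bker r1 r2 k1 k2 k3
      * rqfac (L1 - r1) * rqfac (L2 - r2)) = q powi (- (k1 * k2 + k1 * k3 + k2 * k3)) * bker L1 L2 k1 k2 k3"
    (is "?S = _")
proof -
  define w where "w j = q powi (j * (j + (k2 - k1))) * rqfac j * rqfac (j + (k2 - k1))" for j
  define I where "I = {-B..B}"
  have "?S = (\<Sum>r1\<in>I. \<Sum>r2\<in>I. \<Sum>j=0..3*B. w j * (q powi (r2 * r2 - s * r2) * rqfac (L2 - r2) * rqfac (r2 - k3)) *
     (rqfac (r2 - k2 - j) * (q powi (r1 * r1 + (s - r2) * r1) * rqfac (L1 - r1) * rqfac (r1 + (k1 - j)) * rqfac (r1 + k3))))"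
    unfolding I_def
  proof (intro sum.cong refl)
    fix r1 r2 assume r: "r1 \<in> {-B..B}" "r2 \<in> {-B..B}"
    have p: "q powi (r1 * r1 - r1 * r2 + r2 * r2 + s * (r1 - r2)) = q powi (r2 * r2 - s * r2) * q powi (r1 * r1 + (s - r2) * r1)"
      unfolding powi_add[symmetric] by (rule powi_cong) (simp add: algebra_simps)
    have h: "r1 + k1 \<le> 3 * B" using r B by auto
    show "q powi (r1 * r1 - r1 * r2 + r2 * r2 + s * (r1 - r2)) * bker r1 r2 k1 k2 k3 * rqfac (L1 - r1) * rqfac (L2 - r2)
      = (\<Sum>j=0..3*B. w j * (q powi (r2 * r2 - s * r2) * rqfac (L2 - r2) * rqfac (r2 - k3)) *
     (rqfac (r2 - k2 - j) * (q powi (r1 * r1 + (s - r2) * r1) * rqfac (L1 - r1) * rqfac (r1 + (k1 - j)) * rqfac (r1 + k3))))"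
      unfolding bker_expand[OF h] p sum_distrib_left sum_distrib_right w_def
      by (intro sum.cong refl) (simp add: add_diff_eq mult_ac)
  qed
  also have "\<dots> = (\<Sum>j=0..3*B. \<Sum>r2\<in>I. \<Sum>r1\<in>I. w j * (q powi (r2 * r2 - s * r2) * rqfac (L2 - r2) * rqfac (r2 - k3)) *
     (rqfac (r2 - k2 - j) * (q powi (r1 * r1 + (s - r2) * r1) * rqfac (L1 - r1) * rqfac (r1 + (k1 - j)) * rqfac (r1 + k3))))"
    by (rule sum_reverse3)
  also have "\<dots> = (\<Sum>j=0..3*B. \<Sum>r2\<in>I. \<Sum>c\<in>I. w j * (q powi (r2 * r2 - s * r2) * rqfac (L2 - r2) * rqfac (r2 - k3)) *
      (rqfac (L1 + k3) * (q powi (c * c + (s - r2) * c) * rqfac (c + (k1 - j)) * rqfac (k3 - (s - r2) - c) * rqfac (L1 - c))))"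
  proof (rule sum.cong[OF refl], rule sum.cong[OF refl])
    fix j r2 assume j: "j \<in> {0..3*B}"
    \<comment> \<open>This fixes the linear term of the step: only with
      \<open>s = k1 + k2 + k3\<close> is \<open>rqfac (r2 - k2 - j)\<close> the prefactor that the
      Durfee transformation with A = k1 - j, B = k3, h = s - r2 requires.\<close>
    have e: "r2 - k2 - j = (k1 - j) + k3 - (s - r2)" by (simp add: s_def)
    show "(\<Sum>r1\<in>I. w j * (q powi (r2 * r2 - s * r2) * rqfac (L2 - r2) * rqfac (r2 - k3)) *
     (rqfac (r2 - k2 - j) * (q powi (r1 * r1 + (s - r2) * r1) * rqfac (L1 - r1) * rqfac (r1 + (k1 - j)) * rqfac (r1 + k3))))
      = (\<Sum>c\<in>I. w j * (q powi (r2 * r2 - s * r2) * rqfac (L2 - r2) * rqfac (r2 - k3)) *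
      (rqfac (L1 + k3) * (q powi (c * c + (s - r2) * c) * rqfac (c + (k1 - j)) * rqfac (k3 - (s - r2) - c) * rqfac (L1 - c))))"
      unfolding sum_distrib_left[symmetric] I_def e
      by (subst durfee_transform) (use j B in auto)
  qed
  also have "\<dots> = (\<Sum>j=0..3*B. \<Sum>c\<in>I. (rqfac (L1 + k3) * (w j * rqfac (c + k1 - j)) * (q powi (c * c + s * c) * rqfac (L1 - c))) *
      (\<Sum>r2\<in>I. q powi (r2 * r2 - s * r2 - c * r2) * rqfac (r2 - k3) * rqfac (r2 - (k1 + k2 + c)) * rqfac (L2 - r2)))"
  proof (rule sum.cong[OF refl], subst sum.swap, rule sum.cong[OF refl])
    fix j c assume "j \<in> {0..3*B}"
    show "(\<Sum>r2\<in>I. w j * (q powi (r2 * r2 - s * r2) * rqfac (L2 - r2) * rqfac (r2 - k3)) *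
      (rqfac (L1 + k3) * (q powi (c * c + (s - r2) * c) * rqfac (c + (k1 - j)) * rqfac (k3 - (s - r2) - c) * rqfac (L1 - c))))
     = (rqfac (L1 + k3) * (w j * rqfac (c + k1 - j)) * (q powi (c * c + s * c) * rqfac (L1 - c))) *
      (\<Sum>r2\<in>I. q powi (r2 * r2 - s * r2 - c * r2) * rqfac (r2 - k3) * rqfac (r2 - (k1 + k2 + c)) * rqfac (L2 - r2))"
      unfolding sum_distrib_left
    proof (intro sum.cong refl)
      fix r2
      have p: "q powi (r2 * r2 - s * r2) * q powi (c * c + (s - r2) * c) = q powi (c * c + s * c) * q powi (r2 * r2 - s * r2 - c * r2)"
        unfolding powi_add[symmetric] by (rule powi_cong) (simp add: algebra_simps)
      have e: "k3 - (s - r2) - c = r2 - (k1 + k2 + c)" by (simp add: s_def)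
      have "w j * (q powi (r2 * r2 - s * r2) * rqfac (L2 - r2) * rqfac (r2 - k3)) *
          (rqfac (L1 + k3) * (q powi (c * c + (s - r2) * c) * rqfac (c + (k1 - j)) * rqfac (k3 - (s - r2) - c) * rqfac (L1 - c)))
        = (q powi (r2 * r2 - s * r2) * q powi (c * c + (s - r2) * c)) * (w j * rqfac (L2 - r2) * rqfac (r2 - k3) * rqfac (L1 + k3) *
          rqfac (c + k1 - j) * rqfac (r2 - (k1 + k2 + c)) * rqfac (L1 - c))"
        unfolding e by (simp add: add_diff_eq mult_ac)
      then show "w j * (q powi (r2 * r2 - s * r2) * rqfac (L2 - r2) * rqfac (r2 - k3)) *
          (rqfac (L1 + k3) * (q powi (c * c + (s - r2) * c) * rqfac (c + (k1 - j)) * rqfac (k3 - (s - r2) - c) * rqfac (L1 - c)))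
        = rqfac (L1 + k3) * (w j * rqfac (c + k1 - j)) * (q powi (c * c + s * c) * rqfac (L1 - c)) *
         (q powi (r2 * r2 - s * r2 - c * r2) * rqfac (r2 - k3) * rqfac (r2 - (k1 + k2 + c)) * rqfac (L2 - r2))"
        unfolding p by (simp add: mult_ac)
    qed
  qed
  also have "\<dots> = (\<Sum>j=0..3*B. \<Sum>c\<in>I. (rqfac (L1 + k3) * (w j * rqfac (c + k1 - j)) * (q powi (c * c + s * c) * rqfac (L1 - c))) *
      (q powi (- (k3 * (k1 + k2 + c))) * (rqfac (L2 - k3) * rqfac (L2 - (k1 + k2 + c)))))"
  proof (intro sum.cong refl arg_cong2[where f="(*)"])
    fix c
    \<comment> \<open>Completing the product (r2 - k3)(r2 - k1 - k2 - c) makes the sum over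
      \<open>r2\<close> a limiting Vandermonde sum.\<close>
    have p: "q powi (r2 * r2 - s * r2 - c * r2) = q powi (- (k3 * (k1 + k2 + c))) * q powi ((r2 + (- k3)) * (r2 + (- (k1 + k2 + c))))" for r2
      unfolding powi_add[symmetric] by (rule powi_cong) (simp add: algebra_simps s_def)
    have "(\<Sum>r2\<in>I. q powi (r2 * r2 - s * r2 - c * r2) * rqfac (r2 - k3) * rqfac (r2 - (k1 + k2 + c)) * rqfac (L2 - r2))
      = q powi (- (k3 * (k1 + k2 + c))) * (\<Sum>r2\<in>I. q powi ((r2 + (- k3)) * (r2 + (- (k1 + k2 + c)))) * rqfac (r2 + (-k3)) * rqfac (r2 + (- (k1 + k2 + c))) * rqfac (L2 - r2))"
      unfolding p sum_distrib_left by (simp add: mult.assoc del: minus_add_distrib)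
    also have "(\<Sum>r2\<in>I. q powi ((r2 + (- k3)) * (r2 + (- (k1 + k2 + c)))) * rqfac (r2 + (-k3)) * rqfac (r2 + (- (k1 + k2 + c))) * rqfac (L2 - r2))
      = rqfac (L2 + (- k3)) * rqfac (L2 + (- (k1 + k2 + c)))"
      unfolding I_def by (rule vandermonde_lim) (use B in auto)
    finally show "(\<Sum>r2\<in>I. q powi (r2 * r2 - s * r2 - c * r2) * rqfac (r2 - k3) * rqfac (r2 - (k1 + k2 + c)) * rqfac (L2 - r2))
      = q powi (- (k3 * (k1 + k2 + c))) * (rqfac (L2 - k3) * rqfac (L2 - (k1 + k2 + c)))" by (simp del: minus_add_distrib)
  qed
  also have "\<dots> = (\<Sum>c\<in>I. (rqfac (L1 + k3) * rqfac (L2 - k3) * ((q powi (c * c + s * c) * q powi (- (k3 * (k1 + k2 + c)))) * rqfac (L1 - c) * rqfac (L2 - (k1 + k2 + c)))) *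
      (\<Sum>j=0..3*B. w j * rqfac (c + k1 - j)))"
    by (subst sum.swap) (simp add: sum_distrib_left sum_distrib_right mult_ac)
  \<comment> \<open>With \<open>r1\<close> and \<open>r2\<close> gone, the auxiliary index
    \<open>j\<close> from the expansion of the kernel can be summed out.\<close>
  also have "\<dots> = (\<Sum>c\<in>I. (rqfac (L1 + k3) * rqfac (L2 - k3) * ((q powi (c * c + s * c) * q powi (- (k3 * (k1 + k2 + c)))) * rqfac (L1 - c) * rqfac (L2 - (k1 + k2 + c)))) *
      (rqfac (c + k1) * rqfac (c + k2)))"
  proof (intro sum.cong refl arg_cong2[where f="(*)"])
    fix c assume "c \<in> I"
    then have "c + k1 \<le> 3 * B" using B by (auto simp: I_def)
    then show "(\<Sum>j=0..3*B. w j * rqfac (c + k1 - j)) = rqfac (c + k1) * rqfac (c + k2)"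
      using vandermonde_lim[of 0 0 "c + k1" "3 * B" "k2 - k1"] by (simp add: w_def)
  qed
  also have "\<dots> = (rqfac (L1 + k3) * rqfac (L2 - k3) * q powi (- (k1 * k2 + k1 * k3 + k2 * k3))) *
      (\<Sum>c\<in>I. q powi ((c + k1) * (c + k2)) * rqfac (c + k1) * rqfac (c + k2) * rqfac (L1 - c) * rqfac (L2 - k1 - k2 - c))"
    unfolding sum_distrib_left
  proof (intro sum.cong refl)
    fix c
    have p: "q powi (c * c + s * c) * q powi (- (k3 * (k1 + k2 + c))) = q powi (- (k1 * k2 + k1 * k3 + k2 * k3)) * q powi ((c + k1) * (c + k2))"
      unfolding powi_add[symmetric] by (rule powi_cong) (simp add: algebra_simps s_def)
    have e: "L2 - (k1 + k2 + c) = L2 - k1 - k2 - c" by simp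
    show "(rqfac (L1 + k3) * rqfac (L2 - k3) * ((q powi (c * c + s * c) * q powi (- (k3 * (k1 + k2 + c)))) * rqfac (L1 - c) * rqfac (L2 - (k1 + k2 + c)))) *
      (rqfac (c + k1) * rqfac (c + k2)) = (rqfac (L1 + k3) * rqfac (L2 - k3) * q powi (- (k1 * k2 + k1 * k3 + k2 * k3))) *
      (q powi ((c + k1) * (c + k2)) * rqfac (c + k1) * rqfac (c + k2) * rqfac (L1 - c) * rqfac (L2 - k1 - k2 - c))"
      unfolding p e by (simp add: mult_ac)
  qed
  \<comment> \<open>This full Vandermonde sum brings back (q;q)_(L1+L2), and with it the kernel in
    its symmetric form.\<close>
  also have "(\<Sum>c\<in>I. q powi ((c + k1) * (c + k2)) * rqfac (c + k1) * rqfac (c + k2) * rqfac (L1 - c) * rqfac (L2 - k1 - k2 - c))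
     = qfac (L1 + (L2 - k1 - k2) + k1 + k2) * rqfac (L1 + k1) * rqfac (L1 + k2) * rqfac ((L2 - k1 - k2) + k1) * rqfac ((L2 - k1 - k2) + k2)"
    unfolding I_def by (rule vandermonde) (use B in auto)
  finally show ?thesis by (simp add: bker_def mult_ac)
qed

lemma sum_le_nat_int: "(\<Sum>r\<le>L. f (int r)) = (\<Sum>r=0..int L. f r)"
  by (rule sum.reindex_bij_witness[of _ nat int]) auto

definition bstep :: "int \<Rightarrow> int \<Rightarrow> (nat \<Rightarrow> nat \<Rightarrow> complex) \<Rightarrow> nat \<Rightarrow> nat \<Rightarrow> complex" where
  "bstep p1 p2 f L M = (\<Sum>r\<le>L. \<Sum>s\<le>M. q powi (int r * int r - int r * int s + int s * int s + p1 * int r + p2 * int s)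
     * f r s * rqfac (int L - int r) * rqfac (int M - int s))"

lemma bker_eq_0: "x + k1 < 0 \<or> x + k2 < 0 \<or> x + k3 < 0 \<or> y - k1 < 0 \<or> y - k2 < 0 \<or> y - k3 < 0 \<Longrightarrow> bker x y k1 k2 k3 = 0"
  by (auto simp: bker_def)

text \<open>With r2 = s + w, the linear terms p1 r + p2 s become a constant plus (k1 + k2 + k3)(r1 -
  r2) exactly under the two equations assumed for \<open>w\<close> and the k's. The vanishing
  hypotheses cut the symmetric box down to the quadrant over which \<open>bstep\<close>
  sums.\<close>

lemma bstep_bker:
  fixes k1 k2 k3 p1 p2 w :: int
  assumes w: "w = p1 + p2" and s: "k1 + k2 + k3 = 2 * p1 + p2"
    and vanish1: "\<And>r1 r2. r1 < 0 \<Longrightarrow> bker r1 r2 k1 k2 k3 = 0"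
    and vanish2: "\<And>r1 r2. r2 < w \<Longrightarrow> bker r1 r2 k1 k2 k3 = 0"
  shows "bstep p1 p2 (\<lambda>r s. bker (int r) (int s + w) k1 k2 k3) L M
    = q powi (w * w - p2 * w - (k1 * k2 + k1 * k3 + k2 * k3)) * bker (int L) (int M + w) k1 k2 k3"
proof -
  define B where "B = \<bar>int L\<bar> + \<bar>int M + w\<bar> + \<bar>k1\<bar> + \<bar>k2\<bar> + \<bar>k3\<bar> + \<bar>w\<bar>"
  let ?s = "k1 + k2 + k3"
  define g where "g r1 r2 = q powi (r1 * r1 - r1 * r2 + r2 * r2 + ?s * (r1 - r2)) * bker r1 r2 k1 k2 k3
      * rqfac (int L - r1) * rqfac (int M + w - r2)" for r1 r2
  have "q powi (w * w - p2 * w) * (\<Sum>r1=-B..B. \<Sum>r2=-B..B. g r1 r2)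
     = q powi (w * w - p2 * w) * (q powi (- (k1 * k2 + k1 * k3 + k2 * k3)) * bker (int L) (int M + w) k1 k2 k3)"
    unfolding g_def by (subst bailey_A2_box) (auto simp: B_def)
  also have "\<dots> = q powi (w * w - p2 * w - (k1 * k2 + k1 * k3 + k2 * k3)) * bker (int L) (int M + w) k1 k2 k3"
    unfolding mult.assoc[symmetric] powi_add[symmetric] by (simp add: algebra_simps)
  also have "(\<Sum>r1=-B..B. \<Sum>r2=-B..B. g r1 r2) = (\<Sum>r1=0..int L. \<Sum>r2=w..int M + w. g r1 r2)"
  proof -
    have "(\<Sum>r1=-B..B. \<Sum>r2=-B..B. g r1 r2) = (\<Sum>r1=0..int L. \<Sum>r2=-B..B. g r1 r2)"
      by (rule sum_int_superset) (auto simp: B_def g_def vanish1)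
    also have "\<dots> = (\<Sum>r1=0..int L. \<Sum>r2=w..int M + w. g r1 r2)"
      by (intro sum.cong refl sum_int_superset) (auto simp: B_def g_def vanish2)
    finally show ?thesis .
  qed
  also have "\<dots> = (\<Sum>r\<le>L. \<Sum>s\<le>M. g (int r) (int s + w))"
  proof -
    have "(\<Sum>r2=w..int M + w. g r1 r2) = (\<Sum>s\<le>M. g r1 (int s + w))" for r1
      using sum_shift_int[of "g r1" w 0 "int M"] sum_le_nat_int[of "\<lambda>s. g r1 (s + w)" M] by simp
    then show ?thesis
      using sum_le_nat_int[of "\<lambda>r. \<Sum>s\<le>M. g r (int s + w)" L] by simp
  qed
  also have "q powi (w * w - p2 * w) * \<dots> = bstep p1 p2 (\<lambda>r s. bker (int r) (int s + w) k1 k2 k3) L M"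
    unfolding bstep_def sum_distrib_left
  proof (intro sum.cong refl)
    fix r s
    have p: "q powi (w * w - p2 * w) * q powi (int r * int r - int r * (int s + w) + (int s + w) * (int s + w) + ?s * (int r - (int s + w)))
       = q powi (int r * int r - int r * int s + int s * int s + p1 * int r + p2 * int s)"
      unfolding powi_add[symmetric] s by (rule powi_cong) (simp add: algebra_simps w)
    show "q powi (w * w - p2 * w) * g (int r) (int s + w) = q powi (int r * int r - int r * int s + int s * int s + p1 * int r + p2 * int s) *
           bker (int r) (int s + w) k1 k2 k3 * rqfac (int L - int r) * rqfac (int M - int s)"
      unfolding g_def p[symmetric] by simp
  qed
  finally show ?thesis .
qed

end

section \<open>A seed Bailey pair\<close>

text \<open>For \<open>x + y + z = 0\<close>, \<open>chi3 (x - y)\<close> is the sign of the permutation that \<open>(x, y, z)\<close> induces modulo 3,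
  and \<open>0\<close> if two of the residues coincide; \<open>qexp\<close> is an exact quotient whenever this sign is nonzero.\<close>

definition chi3 :: "int \<Rightarrow> complex" where
  "chi3 d = (if d mod 3 = 1 then 1 else if d mod 3 = 2 then -1 else 0)"

definition qform :: "int \<Rightarrow> int \<Rightarrow> int" where
  "qform x y = x * x + x * y + y * y"

definition qexp :: "int \<Rightarrow> int \<Rightarrow> int" where
  "qexp x y = (qform x y - 1) div 3"

lemma chi3_minus: "chi3 (- d) = - chi3 d"
proof -
  have "d mod 3 = 0 \<or> d mod 3 = 1 \<or> d mod 3 = 2" by presburger
  moreover have "d mod 3 = 0 \<Longrightarrow> (- d) mod 3 = 0" "d mod 3 = 1 \<Longrightarrow> (- d) mod 3 = 2" "d mod 3 = 2 \<Longrightarrow> (- d) mod 3 = 1"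
    by presburger+
  ultimately show ?thesis by (auto simp: chi3_def)
qed

lemma chi3_add_mult3: "chi3 (d + 3 * e) = chi3 d"
  by (simp add: chi3_def)

lemma chi3_swap: "chi3 (y - x) = - chi3 (x - y)"
  using chi3_minus[of "x - y"] by simp

lemma chi3_swap23: "chi3 (x - (- x - y)) = - chi3 (x - y)"
  using chi3_add_mult3[of "- (x - y)" x] chi3_minus[of "x - y"] by (simp add: algebra_simps)

lemma chi3_rotate: "chi3 (y - (- x - y)) = chi3 (x - y)"
  using chi3_swap23[of y x] chi3_swap[of y x] by (simp add: algebra_simps)

lemma qform_swap: "qform y x = qform x y"
  and qform_swap23: "qform x (- x - y) = qform x y"
  and qform_rotate: "qform y (- x - y) = qform x y"
  by (simp_all add: qform_def algebra_simps)

lemma qexp_swap: "qexp y x = qexp x y"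
  and qexp_swap23: "qexp x (- x - y) = qexp x y"
  and qexp_rotate: "qexp y (- x - y) = qexp x y"
  by (simp_all add: qexp_def qform_swap qform_swap23 qform_rotate)

text \<open>The translation (2, -1, -1) of (x, y, z) changes x - y by 3 and the exponent by a linear
  term: this is the quasi-periodicity of the A2 theta function in its first variable.\<close>

lemma qexp_shift: "qexp (x + 2) (y - 1) = qexp x y + x + 1"
proof -
  have "qform (x + 2) (y - 1) - 1 = (qform x y - 1) + 3 * (x + 1)"
    by (simp add: qform_def algebra_simps)
  then show ?thesis by (simp add: qexp_def)
qed

lemma qform_eq_qexp: "chi3 (x - y) \<noteq> 0 \<Longrightarrow> qform x y = 3 * qexp x y + 1"
proof -
  assume "chi3 (x - y) \<noteq> 0"
  then have "(x - y) mod 3 = 1 \<or> (x - y) mod 3 = 2"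
    by (auto simp: chi3_def split: if_splits)
  then have "(x - y)\<^sup>2 mod 3 = 1"
    by (auto simp: power_mod[of "x - y" 3, symmetric])
  moreover have "qform x y = (x - y)\<^sup>2 + 3 * (x * y)"
    by (simp add: qform_def power2_eq_square algebra_simps)
  ultimately have "qform x y mod 3 = 1" by simp
  then show ?thesis by (simp add: qexp_def) presburger
qed

lemma summable_on_finite_support:
  fixes f :: "'a \<Rightarrow> complex"
  assumes "finite A" "\<And>x. x \<notin> A \<Longrightarrow> f x = 0"
  shows "f summable_on UNIV"
  using summable_on_finite[OF assms(1), of f] summable_on_cong_neutral[of UNIV A f f] assms(2) by auto

section \<open>Permutations and translations of the lattice x + y + z = 0\<close>

lemma bij_swap12: "bij (\<lambda>(x, y). (y, x) :: int \<times> int)"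
  and bij_swap23: "bij (\<lambda>(x, y). (x, - x - y) :: int \<times> int)"
  and bij_rotate: "bij (\<lambda>(x, y). (y, - x - y) :: int \<times> int)"
  and bij_shift: "bij (\<lambda>(x, y). (x + 2, y - 1) :: int \<times> int)"
     apply (rule bij_betw_byWitness[where f'="\<lambda>(x, y). (y, x)"]; force)
    apply (rule bij_betw_byWitness[where f'="\<lambda>(x, y). (x, - x - y)"]; force)
   apply (rule bij_betw_byWitness[where f'="\<lambda>(x, y). (- x - y, x)"]; force)
  apply (rule bij_betw_byWitness[where f'="\<lambda>(x, y). (x - 2, y + 1)"]; force)
  done

lemma has_sum_diff_complex:
  fixes f g :: "'a \<Rightarrow> complex"
  assumes "(f has_sum a) A" "(g has_sum b) A"
  shows "((\<lambda>x. f x - g x) has_sum (a - b)) A"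
  using has_sum_add[OF assms(1) has_sum_cmult_right[OF assms(2), of "-1"]] by simp

lemma has_sum_bij_UNIV: "bij h \<Longrightarrow> ((\<lambda>x. f (h x)) has_sum s) UNIV \<longleftrightarrow> (f has_sum s) UNIV"
  by (rule has_sum_reindex_bij_betw)

context qser
begin

definition qbin :: "nat \<Rightarrow> int \<Rightarrow> complex" where
  "qbin n j = qfac (int n) * rqfac j * rqfac (int n - j)"

text \<open>The coefficients of the polynomial \<open>(z;q)\<^sub>n\<close>.\<close>

definition ecoef :: "nat \<Rightarrow> int \<Rightarrow> complex" where
  "ecoef n j = (-1) powi j * q powi (j * (j - 1) div 2) * qbin n j"

lemma tri_pred: "j * (j - 1) div 2 = (j - 1) + (j - 1) * (j - 1 - 1) div (2::int)"
proof -
  have "j * (j - 1) = (j - 1) * (j - 1 - 1) + 2 * (j - 1)" by (simp add: algebra_simps)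
  then show ?thesis by simp
qed

lemma qfac_Suc: "qfac (int (Suc n)) = (1 - q powi (int n + 1)) * qfac (int n)"
  using qfac_rec[of "int (Suc n)"] by (simp add: add.commute)

lemma esign_pred: "(-1::complex) powi j = - ((-1) powi (j - 1))"
  using power_int_add[of "-1::complex" "j - 1" 1] by simp

text \<open>Coefficient form of (1 - z) (qz;q)_n = (1 - q^n z) (z;q)_n.\<close>

lemma ecoef_shift: "(1 - q powi j) * ecoef n j = (q ^ n - q powi (j - 1)) * ecoef n (j - 1)"
proof -
  have "(1 - q powi j) * ecoef n j = (-1) powi j * q powi (j * (j - 1) div 2) * qfac (int n) * rqfac (int n - j) * ((1 - q powi j) * rqfac j)"
    by (simp add: ecoef_def qbin_def)
  also have "(1 - q powi j) * rqfac j = rqfac (j - 1)"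
    by (simp add: rqfac_pred)
  also have "rqfac (int n - j) = (1 - q powi (int n - (j - 1))) * rqfac (int n - (j - 1))"
    using rqfac_eq_succ[of "int n - j"] by (simp add: algebra_simps)
  also have "(-1) powi j * q powi (j * (j - 1) div 2) * qfac (int n) * ((1 - q powi (int n - (j - 1))) * rqfac (int n - (j - 1))) * rqfac (j - 1)
    = (q powi (j - 1) * q powi (int n - (j - 1)) - q powi (j - 1)) * ecoef n (j - 1)"
    unfolding tri_pred[of j] powi_add esign_pred[of j] by (simp add: ecoef_def qbin_def algebra_simps)
  also have "q powi (j - 1) * q powi (int n - (j - 1)) = q ^ n"
    by (simp flip: powi_add)
  finally show ?thesis .
qed

text \<open>Coefficient form of (z;q)_(n+1) = (1 - q^n z) (z;q)_n.\<close>

lemma ecoef_Suc: "ecoef (Suc n) j = ecoef n j - q ^ n * ecoef n (j - 1)"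
proof -
  have "1 - q powi (int n + 1) = (1 - q powi (int n + 1 - j)) + q powi (int n + 1 - j) * (1 - q powi j)"
    by (simp add: algebra_simps flip: powi_add)
  then have "ecoef (Suc n) j = (-1) powi j * q powi (j * (j - 1) div 2) * qfac (int n) *
     (rqfac j * ((1 - q powi (int n + 1 - j)) * rqfac (int n + 1 - j)) + q powi (int n + 1 - j) * ((1 - q powi j) * rqfac j) * rqfac (int n + 1 - j))"
    unfolding ecoef_def qbin_def qfac_Suc by (simp add: algebra_simps)
  also have "(1 - q powi j) * rqfac j = rqfac (j - 1)"
    by (simp add: rqfac_pred)
  also have "(1 - q powi (int n + 1 - j)) * rqfac (int n + 1 - j) = rqfac (int n - j)"
    using rqfac_pred[of "int n + 1 - j"] by simp
  also have "(-1) powi j * q powi (j * (j - 1) div 2) * qfac (int n) * (rqfac j * rqfac (int n - j) + q powi (int n + 1 - j) * rqfac (j - 1) * rqfac (int n + 1 - j))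
    = ecoef n j + (q powi (j * (j - 1) div 2) * q powi (int n + 1 - j)) * ((-1) powi j * qfac (int n) * rqfac (j - 1) * rqfac (int n + 1 - j))"
    by (simp add: ecoef_def qbin_def algebra_simps)
  also have "q powi (j * (j - 1) div 2) * q powi (int n + 1 - j) = q ^ n * q powi ((j - 1) * (j - 1 - 1) div 2)"
    unfolding tri_pred[of j] power_int_of_nat[symmetric] powi_add[symmetric] by (rule powi_cong) simp
  finally show ?thesis
    unfolding esign_pred[of j] by (simp add: ecoef_def qbin_def algebra_simps)
qed

lemma ecoef_eq_0: "j < 0 \<or> j > int n \<Longrightarrow> ecoef n j = 0"
  by (auto simp: ecoef_def qbin_def)

text \<open>\<open>seed_sum n m1 m2 m3\<close> is a constant term of the product of all \<open>(z\<^sub>i;q)\<^sub>n z\<^sub>i\<close>\<open>\<^bsup>m\<^esup>\<close> with an antisymmetric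
  A2 theta function. It is evaluated by its antisymmetry in \<open>m1, m2, m3\<close> and the relation \<open>seed_shift\<close>
  coming from \<open>z\<^sub>1 \<mapsto> q z\<^sub>1\<close>.\<close>

definition seed_term :: "nat \<Rightarrow> int \<Rightarrow> int \<Rightarrow> int \<Rightarrow> int \<times> int \<Rightarrow> complex" where
  "seed_term n m1 m2 m3 = (\<lambda>(x, y). chi3 (x - y) * q powi qexp x y *
     (ecoef n (x - m1) * ecoef n (y - m2) * ecoef n (- x - y - m3)))"

definition seed_sum :: "nat \<Rightarrow> int \<Rightarrow> int \<Rightarrow> int \<Rightarrow> complex" where
  "seed_sum n m1 m2 m3 = infsum (seed_term n m1 m2 m3) UNIV"

lemma seed_has_sum: "(seed_term n m1 m2 m3 has_sum seed_sum n m1 m2 m3) UNIV"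
proof -
  have "seed_term n m1 m2 m3 summable_on UNIV"
  proof (rule summable_on_finite_support)
    show "finite ({m1..m1 + int n} \<times> {m2..m2 + int n})" by simp
  next
    fix p assume "p \<notin> {m1..m1 + int n} \<times> {m2..m2 + int n}"
    then show "seed_term n m1 m2 m3 p = 0"
      by (cases p) (auto simp: seed_term_def ecoef_eq_0)
  qed
  then show ?thesis unfolding seed_sum_def by (rule has_sum_infsum)
qed

lemma seed_swap12: "seed_sum n m2 m1 m3 = - seed_sum n m1 m2 m3"
proof -
  have "((\<lambda>p. seed_term n m2 m1 m3 ((\<lambda>(x, y). (y, x)) p)) has_sum seed_sum n m2 m1 m3) UNIV"
    unfolding has_sum_bij_UNIV[OF bij_swap12] by (rule seed_has_sum)
  also have "(\<lambda>p. seed_term n m2 m1 m3 ((\<lambda>(x, y). (y, x)) p)) = (\<lambda>p. - seed_term n m1 m2 m3 p)"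
  proof
    fix p :: "int \<times> int"
    obtain x y where p: "p = (x, y)" by force
    show "seed_term n m2 m1 m3 ((\<lambda>(x, y). (y, x)) p) = - seed_term n m1 m2 m3 p"
      unfolding p seed_term_def prod.case chi3_swap[of y x] qexp_swap[of y x]
      by (simp add: mult_ac minus_diff_commute)
  qed
  finally have 1: "((\<lambda>p. - seed_term n m1 m2 m3 p) has_sum seed_sum n m2 m1 m3) UNIV" .
  have 2: "((\<lambda>p. - seed_term n m1 m2 m3 p) has_sum - seed_sum n m1 m2 m3) UNIV"
    by (simp add: has_sum_uminus seed_has_sum)
  show ?thesis using 1 2 by (rule has_sum_unique)
qed

lemma seed_swap23: "seed_sum n m1 m3 m2 = - seed_sum n m1 m2 m3"
proof -
  have "((\<lambda>p. seed_term n m1 m3 m2 ((\<lambda>(x, y). (x, - x - y)) p)) has_sum seed_sum n m1 m3 m2) UNIV"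
    unfolding has_sum_bij_UNIV[OF bij_swap23] by (rule seed_has_sum)
  also have "(\<lambda>p. seed_term n m1 m3 m2 ((\<lambda>(x, y). (x, - x - y)) p)) = (\<lambda>p. - seed_term n m1 m2 m3 p)"
  proof
    fix p :: "int \<times> int"
    obtain x y where p: "p = (x, y)" by force
    show "seed_term n m1 m3 m2 ((\<lambda>(x, y). (x, - x - y)) p) = - seed_term n m1 m2 m3 p"
      unfolding p seed_term_def prod.case chi3_swap23 qexp_swap23 by (simp add: mult_ac)
  qed
  finally have 1: "((\<lambda>p. - seed_term n m1 m2 m3 p) has_sum seed_sum n m1 m3 m2) UNIV" .
  have 2: "((\<lambda>p. - seed_term n m1 m2 m3 p) has_sum - seed_sum n m1 m2 m3) UNIV"
    by (simp add: has_sum_uminus seed_has_sum)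
  show ?thesis using 1 2 by (rule has_sum_unique)
qed

lemma seed_eq12: "seed_sum n m m m3 = 0"
  using seed_swap12[of n m m m3] by simp

lemma seed_eq23: "seed_sum n m1 m m = 0"
  using seed_swap23[of n m1 m m] by simp

lemma seed_eq13: "seed_sum n m m2 m = 0"
  using seed_swap12[of n m m2 m] seed_eq23[of n m2 m] by simp

lemma seed_rotate: "seed_sum n m3 m1 m2 = seed_sum n m1 m2 m3"
  using seed_swap12[of n m1 m3 m2] seed_swap23[of n m1 m2 m3] by simp

lemma seed_shift:
  "seed_sum n m1 m2 m3 - inverse q * seed_sum n (m1 + 1) m2 m3
   = q powi (m1 - 1) * (seed_sum n (m1 - 2) (m2 + 1) (m3 + 1) - q ^ n * seed_sum n (m1 - 1) (m2 + 1) (m3 + 1))"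
proof -
  let ?f = "\<lambda>p. q powi (m1 - 1) * (seed_term n (m1 - 2) (m2 + 1) (m3 + 1) p - q ^ n * seed_term n (m1 - 1) (m2 + 1) (m3 + 1) p)"
  let ?g = "\<lambda>p. seed_term n m1 m2 m3 p - inverse q * seed_term n (m1 + 1) m2 m3 p"
  have f: "(?f has_sum q powi (m1 - 1) * (seed_sum n (m1 - 2) (m2 + 1) (m3 + 1) - q ^ n * seed_sum n (m1 - 1) (m2 + 1) (m3 + 1))) UNIV"
    by (intro has_sum_cmult_right has_sum_diff_complex seed_has_sum)
  have g: "(?g has_sum (seed_sum n m1 m2 m3 - inverse q * seed_sum n (m1 + 1) m2 m3)) UNIV"
    by (intro has_sum_cmult_right has_sum_diff_complex seed_has_sum)
  \<comment> \<open>After the translation the part depending on m1 is q^j (e_j - e_(j-1)/q), where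
    e_j stands for \<open>ecoef n j\<close>; \<open>ecoef_shift\<close> turns it into e_j - q^n
    e_(j-1).\<close>
  have "?g ((\<lambda>(x, y). (x + 2, y - 1)) p) = ?f p" for p
  proof -
    obtain x y where p: "p = (x, y)" by force
    define j where "j = x + 2 - m1"
    define c where "c = chi3 (x - y) * ecoef n (y - (m2 + 1)) * ecoef n (- x - y - (m3 + 1))"
    have chi: "chi3 (x + 2 - (y - 1)) = chi3 (x - y)"
      using chi3_add_mult3[of "x - y" 1] by (simp add: algebra_simps)
    have 1: "?g ((\<lambda>(x, y). (x + 2, y - 1)) p) = c * (q powi (qexp x y + x + 1) * (ecoef n j - inverse q * ecoef n (j - 1)))"
    proof -
      have e: "y - 1 - m2 = y - (m2 + 1)" "- (x + 2) - (y - 1) - m3 = - x - y - (m3 + 1)"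
        "x + 2 - (m1 + 1) = x + 2 - m1 - 1" by auto
      show ?thesis
        unfolding p seed_term_def prod.case qexp_shift chi c_def j_def e by (simp only: ring_distribs mult_ac)
    qed
    have 2: "?f p = c * (q powi (m1 - 1) * q powi qexp x y * (ecoef n j - q ^ n * ecoef n (j - 1)))"
    proof -
      have e: "x - (m1 - 2) = x + 2 - m1" "x - (m1 - 1) = x + 2 - m1 - 1" by auto
      show ?thesis
        unfolding p seed_term_def prod.case c_def j_def e by (simp only: ring_distribs mult_ac)
    qed
    have "q powi (qexp x y + x + 1) = q powi (m1 - 1) * q powi qexp x y * q powi j"
      unfolding powi_add[symmetric] j_def by (rule powi_cong) simp
    moreover have "q powi j * (ecoef n j - inverse q * ecoef n (j - 1)) = ecoef n j - q ^ n * ecoef n (j - 1)"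
    proof -
      have "q powi j * inverse q = q powi (j - 1)"
        using q_nonzero powi_add[of j "-1"] by (simp add: power_int_minus)
      then show ?thesis using ecoef_shift[of j n] by (simp add: algebra_simps mult.assoc[of _ _ "ecoef n (j - 1)", symmetric])
    qed
    ultimately show ?thesis unfolding 1 2 by (simp add: mult.assoc)
  qed
  then have "(?f has_sum (seed_sum n m1 m2 m3 - inverse q * seed_sum n (m1 + 1) m2 m3)) UNIV"
    using g has_sum_bij_UNIV[OF bij_shift, of ?g] by simp
  then show ?thesis using f by (rule has_sum_unique)
qed

text \<open>Expansion of the three new factors 1 - q^n z_i, each z_i raising the corresponding
  \<open>m\<close> by one.\<close>

lemma seed_Suc:
  "seed_sum (Suc n) m1 m2 m3 = seed_sum n m1 m2 m3
     - q ^ n * (seed_sum n (m1 + 1) m2 m3 + seed_sum n m1 (m2 + 1) m3 + seed_sum n m1 m2 (m3 + 1))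
     + q ^ n * q ^ n * (seed_sum n (m1 + 1) (m2 + 1) m3 + seed_sum n (m1 + 1) m2 (m3 + 1) + seed_sum n m1 (m2 + 1) (m3 + 1))
     - q ^ n * q ^ n * q ^ n * seed_sum n (m1 + 1) (m2 + 1) (m3 + 1)" (is "_ = ?r")
proof -
  let ?f = "\<lambda>p. seed_term n m1 m2 m3 p
     - q ^ n * (seed_term n (m1 + 1) m2 m3 p + seed_term n m1 (m2 + 1) m3 p + seed_term n m1 m2 (m3 + 1) p)
     + q ^ n * q ^ n * (seed_term n (m1 + 1) (m2 + 1) m3 p + seed_term n (m1 + 1) m2 (m3 + 1) p + seed_term n m1 (m2 + 1) (m3 + 1) p)
     - q ^ n * q ^ n * q ^ n * seed_term n (m1 + 1) (m2 + 1) (m3 + 1) p"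
  have "(?f has_sum ?r) UNIV"
    by (intro has_sum_cmult_right has_sum_diff_complex has_sum_add seed_has_sum)
  moreover have "?f = seed_term (Suc n) m1 m2 m3"
  proof
    fix p :: "int \<times> int"
    obtain x y where p: "p = (x, y)" by force
    define X Y Z X' Y' Z' where d: "X = ecoef n (x - m1)" "Y = ecoef n (y - m2)" "Z = ecoef n (- x - y - m3)"
        "X' = ecoef n (x - m1 - 1)" "Y' = ecoef n (y - m2 - 1)" "Z' = ecoef n (- x - y - m3 - 1)"
    have e: "x - (m1 + 1) = x - m1 - 1" "y - (m2 + 1) = y - m2 - 1" "- x - y - (m3 + 1) = - x - y - m3 - 1"
      by auto
    show "?f p = seed_term (Suc n) m1 m2 m3 p"
      unfolding p seed_term_def prod.case ecoef_Suc e d[symmetric] by (simp add: algebra_simps)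
  qed
  ultimately have "(seed_term (Suc n) m1 m2 m3 has_sum ?r) UNIV" by (simp only:)
  then show ?thesis by (rule has_sum_unique[OF seed_has_sum])
qed

definition tri3 :: "int \<Rightarrow> complex" where
  "tri3 L = (-1) powi L * q powi (3 * (L * (L - 1) div 2))"

lemma tri3_pred: "tri3 (L - 1) = - (q powi (- (3 * (L - 1)))) * tri3 L"
proof -
  have "q powi (3 * ((L - 1) * (L - 1 - 1) div 2)) = q powi (- (3 * (L - 1))) * q powi (3 * (L * (L - 1) div 2))"
    unfolding powi_add[symmetric] tri_pred[of L] by (rule powi_cong) simp
  then show ?thesis unfolding tri3_def esign_pred[of L] by simp
qed

text \<open>\<open>seed_shift\<close> at (1 - L, -L, -1 - L): one shifted triple is a rotation of
  the original, the other has two equal entries and contributes nothing.\<close>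

lemma seed_e1: "seed_sum n (2 - L) (- L) (- 1 - L) = q * (1 - q powi (- L)) * seed_sum n (1 - L) (- L) (- 1 - L)"
proof -
  have "seed_sum n (- 1 - L) (1 - L) (- L) = seed_sum n (1 - L) (- L) (- 1 - L)"
    by (rule seed_rotate)
  then show ?thesis
    using seed_shift[of n "1 - L" "- L" "- 1 - L"] seed_eq13[of n "- L" "1 - L"] q_nonzero
    by (simp add: field_simps)
qed

text \<open>\<open>seed_shift\<close> at (1 - L, 1 - L, -L), where the leading term vanishes by
  antisymmetry and the shifted triples are rotations of those in the claim.\<close>

lemma seed_e2: "seed_sum n (2 - L) (1 - L) (- 1 - L) = (q ^ n - q powi (L - 1)) * seed_sum n (2 - L) (1 - L) (- L)"
proof -
  have "seed_sum n (- 1 - L) (2 - L) (1 - L) = seed_sum n (2 - L) (1 - L) (- 1 - L)"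
    "seed_sum n (- L) (2 - L) (1 - L) = seed_sum n (2 - L) (1 - L) (- L)"
    by (rule seed_rotate)+
  then have *: "- (inverse q * seed_sum n (2 - L) (1 - L) (- L)) =
     q powi (- L) * (seed_sum n (2 - L) (1 - L) (- 1 - L) - q ^ n * seed_sum n (2 - L) (1 - L) (- L))"
    using seed_shift[of n "1 - L" "1 - L" "- L"] by (simp add: seed_eq12)
  have one: "q powi L * q powi (- L) = 1" by (simp flip: powi_add)
  have "q powi (L - 1) = q powi L * inverse q"
    using powi_add[of L "-1"] by (simp add: power_int_minus)
  then show ?thesis using arg_cong[OF *, of "\<lambda>z. q powi L * z"]
    unfolding mult.assoc[of "q powi L" "q powi (- L)", symmetric] one by (simp add: algebra_simps)
qed

text \<open>In \<open>seed_Suc\<close> antisymmetry removes four of the eight terms. Of the rest,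
  \<open>seed_e1\<close> and \<open>seed_e2\<close> express two through the diagonal values at
  \<open>L\<close> and \<open>L - 1\<close>, so the induction closes on these values alone, with
  \<open>L\<close> arbitrary.\<close>

lemma seed_diag: "seed_sum n (1 - L) (- L) (- 1 - L) = tri3 L * qbin n L"
proof (induction n arbitrary: L)
  case 0
  have e0: "ecoef 0 j = (if j = 0 then 1 else 0)" for j
    by (cases j "0::int" rule: linorder_cases) (auto simp: ecoef_def qbin_def)
  \<comment> \<open>For n = 0 only the point (m1, m2, m3) could contribute, and its coordinates sum
    to -3 L, so it lies on the lattice only when L = 0.\<close>
  have "seed_sum 0 (1 - L) (- L) (- 1 - L) = (if L = 0 then 1 else 0)"
  proof (rule has_sum_unique[OF seed_has_sum])
    have "seed_term 0 (1 - L) (- L) (- 1 - L) = (\<lambda>p. if p = (1, 0) \<and> L = 0 then 1 else 0)"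
      by (rule ext) (auto simp: seed_term_def e0 chi3_def qexp_def qform_def split: if_splits)
    moreover have "((\<lambda>p. if p = (1::int, 0::int) \<and> L = 0 then 1 else 0) has_sum (if L = 0 then 1 else 0::complex)) UNIV"
      by (rule has_sum_finite_neutralI[of "{(1, 0)}"]) auto
    ultimately show "(seed_term 0 (1 - L) (- L) (- 1 - L) has_sum (if L = 0 then 1 else 0)) UNIV"
      by simp
  qed
  also have "\<dots> = tri3 L * qbin 0 L"
    by (cases L "0::int" rule: linorder_cases) (auto simp: tri3_def qbin_def)
  finally show ?case .
next
  case (Suc n)
  define X where "X = q powi L"
  define Y where "Y = q powi (int n + 1 - L)"
  have IH2: "seed_sum n (2 - L) (1 - L) (- L) = tri3 (L - 1) * qbin n (L - 1)"
    using Suc.IH[of "L - 1"] by simp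
  have XY: "X * Y = q powi (int n + 1)"
    unfolding X_def Y_def powi_add[symmetric] by simp
  have qn1: "q ^ n * q = X * Y"
    unfolding XY by (simp add: powi_add)
  have qn: "q ^ n * q * q powi (- L) = Y"
    unfolding Y_def by (simp add: powi_add powi_add[of "int n + 1" "-L", simplified])
  have b0: "qbin n L = (1 - Y) * (qfac (int n) * rqfac L * rqfac (int n + 1 - L))"
    unfolding qbin_def Y_def using rqfac_pred[of "int n + 1 - L"] by simp
  have b1: "qbin n (L - 1) = (1 - X) * (qfac (int n) * rqfac L * rqfac (int n + 1 - L))"
    unfolding qbin_def X_def rqfac_pred[of L] by (simp add: algebra_simps)
  have b2: "qbin (Suc n) L = (1 - X * Y) * (qfac (int n) * rqfac L * rqfac (int n + 1 - L))"
    unfolding qbin_def qfac_Suc XY by (simp add: algebra_simps)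
  have p: "q ^ n * q ^ n * q powi (L - 1) * q powi (- (3 * (L - 1))) = Y * Y"
    unfolding power_int_of_nat[symmetric] Y_def powi_add[symmetric] by (rule powi_cong) simp
  have "seed_sum (Suc n) (1 - L) (- L) (- 1 - L) = seed_sum n (1 - L) (- L) (- 1 - L)
     - q ^ n * seed_sum n (2 - L) (- L) (- 1 - L) + q ^ n * q ^ n * seed_sum n (2 - L) (1 - L) (- 1 - L)
     - q ^ n * q ^ n * q ^ n * seed_sum n (2 - L) (1 - L) (- L)"
    unfolding seed_Suc by (simp add: seed_eq12 seed_eq13 seed_eq23)
  also have "\<dots> = (1 - q ^ n * q + q ^ n * q * q powi (- L)) * seed_sum n (1 - L) (- L) (- 1 - L)
      - q ^ n * q ^ n * q powi (L - 1) * seed_sum n (2 - L) (1 - L) (- L)"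
    unfolding seed_e1 seed_e2 by (simp add: algebra_simps)
  also have "\<dots> = (1 - X * Y + Y) * (tri3 L * qbin n L)
      + (q ^ n * q ^ n * q powi (L - 1) * q powi (- (3 * (L - 1)))) * (tri3 L * qbin n (L - 1))"
    unfolding qn unfolding qn1 Suc.IH IH2 tri3_pred by (simp add: algebra_simps)
  also have "\<dots> = tri3 L * ((1 - X * Y + Y) * qbin n L + Y * Y * qbin n (L - 1))"
    unfolding p by (simp add: algebra_simps)
  also have "(1 - X * Y + Y) * qbin n L + Y * Y * qbin n (L - 1) = qbin (Suc n) L"
    unfolding b0 b1 b2 by (simp add: algebra_simps)
  finally show ?case .
qed

end

section \<open>Changing between Bailey frames\<close>

lemma has_sum_sum_complex:
  fixes f :: "'b \<Rightarrow> 'a \<Rightarrow> complex"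
  assumes "\<And>i. i \<in> I \<Longrightarrow> (f i has_sum s i) A"
  shows "((\<lambda>x. \<Sum>i\<in>I. f i x) has_sum (\<Sum>i\<in>I. s i)) A"
  using assms by (induction I rule: infinite_finite_induct) (auto intro!: has_sum_add has_sum_0)

context qser
begin

text \<open>The kernels belonging to Bailey steps with linear exponents \<open>\<lambda> + \<mu>\<close>, \<open>\<lambda>\<close> and \<open>0\<close>, respectively.\<close>

definition ker11 :: "int \<Rightarrow> int \<Rightarrow> int \<Rightarrow> nat \<Rightarrow> nat \<Rightarrow> complex" where
  "ker11 x y z L M = bker (int L) (int M + 2) (x + 1) (y + 1) (z + 1)"

definition ker10 :: "int \<Rightarrow> int \<Rightarrow> int \<Rightarrow> nat \<Rightarrow> nat \<Rightarrow> complex" where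
  "ker10 x y z L M = bker (int L) (int M + 1) (x + 1) (y + 1) z"

definition ker00 :: "int \<Rightarrow> int \<Rightarrow> int \<Rightarrow> nat \<Rightarrow> nat \<Rightarrow> complex" where
  "ker00 x y z L M = bker (int L) (int M) (x + 1) y (z - 1)"

section \<open>Kernel symmetries and signed lattice sums\<close>

lemma bker_swap12: "bker x y k2 k1 k3 = bker x y k1 k2 k3"
  and bker_swap23: "bker x y k1 k3 k2 = bker x y k1 k2 k3"
  by (simp_all add: bker_def mult_ac)

lemma ker11_perm: "ker11 y x z L M = ker11 x y z L M" "ker11 x z y L M = ker11 x y z L M"
  by (simp_all add: ker11_def bker_swap12 bker_swap23)

lemma ker10_swap: "ker10 y x z L M = ker10 x y z L M"
  by (simp add: ker10_def bker_swap12)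

definition gw :: "int \<Rightarrow> int \<Rightarrow> int \<Rightarrow> complex" where
  "gw E x y = chi3 (x - y) * q powi (E * qexp x y)"

lemma gw_swap: "gw E y x = - gw E x y"
  by (simp add: gw_def chi3_swap[of y x] qexp_swap[of y x])

lemma gw_rotate: "gw E y (- x - y) = gw E x y"
  unfolding gw_def chi3_rotate qexp_rotate ..

text \<open>A relation instead of a value, so that convergence travels with each identity. Passing z
  = -x - y as a third argument lets permutations act by permuting the arguments of
  \<open>\<phi>\<close>.\<close>

definition lsum :: "int \<Rightarrow> (int \<Rightarrow> int \<Rightarrow> int \<Rightarrow> complex) \<Rightarrow> complex \<Rightarrow> bool" where
  "lsum E \<phi> S \<longleftrightarrow> ((\<lambda>(x, y). gw E x y * \<phi> x y (- x - y)) has_sum S) UNIV"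

lemma lsum_swap:
  assumes "lsum E \<phi> S"
  shows "lsum E (\<lambda>x y z. \<phi> y x z) (- S)"
proof -
  have "((\<lambda>p. (\<lambda>(x, y). gw E x y * \<phi> x y (- x - y)) ((\<lambda>(x, y). (y, x)) p)) has_sum S) UNIV"
    unfolding has_sum_bij_UNIV[OF bij_swap12] using assms by (simp add: lsum_def)
  also have "(\<lambda>p. (\<lambda>(x, y). gw E x y * \<phi> x y (- x - y)) ((\<lambda>(x, y). (y, x)) p))
     = (\<lambda>p. - (\<lambda>(x, y). gw E x y * \<phi> y x (- x - y)) p)"
    unfolding fun_eq_iff
  proof
    fix p :: "int \<times> int"
    obtain x y where p: "p = (x, y)" by force
    have e: "- y - x = - x - y" by simp
    show "(\<lambda>(x, y). gw E x y * \<phi> x y (- x - y)) ((\<lambda>(x, y). (y, x)) p) = - (\<lambda>(x, y). gw E x y * \<phi> y x (- x - y)) p"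
      unfolding p prod.case gw_swap[of E y x] e by simp
  qed
  finally show ?thesis unfolding lsum_def has_sum_uminus by simp
qed

lemma lsum_rotate:
  assumes "lsum E \<phi> S"
  shows "lsum E (\<lambda>x y z. \<phi> y z x) S"
proof -
  have "((\<lambda>p. (\<lambda>(x, y). gw E x y * \<phi> x y (- x - y)) ((\<lambda>(x, y). (y, - x - y)) p)) has_sum S) UNIV"
    unfolding has_sum_bij_UNIV[OF bij_rotate] using assms by (simp add: lsum_def)
  also have "(\<lambda>p. (\<lambda>(x, y). gw E x y * \<phi> x y (- x - y)) ((\<lambda>(x, y). (y, - x - y)) p))
     = (\<lambda>(x, y). gw E x y * \<phi> y (- x - y) x)"
    by (auto simp: fun_eq_iff gw_rotate)
  finally show ?thesis unfolding lsum_def by simp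
qed

lemma lsum_add: "lsum E \<phi> S \<Longrightarrow> lsum E \<psi> T \<Longrightarrow> lsum E (\<lambda>x y z. \<phi> x y z + \<psi> x y z) (S + T)"
  unfolding lsum_def by (drule (1) has_sum_add) (simp add: case_prod_unfold algebra_simps)

lemma lsum_cmult: "lsum E \<phi> S \<Longrightarrow> lsum E (\<lambda>x y z. c * \<phi> x y z) (c * S)"
  unfolding lsum_def by (drule has_sum_cmult_right[of _ _ _ c]) (simp add: case_prod_unfold algebra_simps)

lemma lsum_diff: "lsum E \<phi> S \<Longrightarrow> lsum E \<psi> T \<Longrightarrow> lsum E (\<lambda>x y z. \<phi> x y z - \<psi> x y z) (S - T)"
  using lsum_add[of E \<phi> S "\<lambda>x y z. - 1 * \<psi> x y z" "- 1 * T"] lsum_cmult[of E \<psi> T "-1"] by simp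

text \<open>Agreement is asked only where \<open>chi3\<close> is nonzero, which is where
  \<open>qexp\<close> is an exact quotient and the effect of a Bailey step can be expressed through
  it.\<close>

lemma lsum_cong:
  assumes "lsum E \<phi> S"
    "\<And>x y z. x + y + z = 0 \<Longrightarrow> chi3 (x - y) \<noteq> 0 \<Longrightarrow> q powi (E * qexp x y) * \<phi> x y z = q powi (E' * qexp x y) * \<psi> x y z"
  shows "lsum E' \<psi> S"
proof -
  have "gw E x y * \<phi> x y (- x - y) = gw E' x y * \<psi> x y (- x - y)" for x y
    using assms(2)[of x y "- x - y"] by (cases "chi3 (x - y) = 0") (auto simp: gw_def)
  then show ?thesis using assms(1) by (simp add: lsum_def)
qed

lemma lsum_unique: "lsum E \<phi> S \<Longrightarrow> lsum E \<phi> T \<Longrightarrow> S = T"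
  unfolding lsum_def by (rule has_sum_unique)

text \<open>A Bailey step is a finite linear combination, hence commutes with the lattice sum
  without any convergence argument.\<close>

lemma lsum_bstep:
  assumes "\<And>L M. lsum E (\<lambda>x y z. \<phi> x y z * D x y z L M) (f L M)"
  shows "lsum E (\<lambda>x y z. \<phi> x y z * bstep p1 p2 (D x y z) L M) (bstep p1 p2 f L M)"
proof -
  have "lsum E (\<lambda>x y z. bstep p1 p2 (\<lambda>L M. \<phi> x y z * D x y z L M) L M) (bstep p1 p2 f L M)"
  proof -
    let ?c = "\<lambda>r s. q powi (int r * int r - int r * int s + int s * int s + p1 * int r + p2 * int s)"
    have "((\<lambda>p. \<Sum>r\<le>L. \<Sum>s\<le>M. ?c r s * (case p of (x, y) \<Rightarrow> gw E x y * (\<phi> x y (- x - y) * D x y (- x - y) r s))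
        * rqfac (int L - int r) * rqfac (int M - int s)) has_sum bstep p1 p2 f L M) UNIV"
      unfolding bstep_def
      by (intro has_sum_sum_complex has_sum_cmult_left has_sum_cmult_right assms[unfolded lsum_def])
    also have "(\<lambda>p. \<Sum>r\<le>L. \<Sum>s\<le>M. ?c r s * (case p of (x, y) \<Rightarrow> gw E x y * (\<phi> x y (- x - y) * D x y (- x - y) r s))
        * rqfac (int L - int r) * rqfac (int M - int s))
       = (\<lambda>(x, y). gw E x y * bstep p1 p2 (\<lambda>L M. \<phi> x y (- x - y) * D x y (- x - y) L M) L M)"
      by (auto simp: fun_eq_iff bstep_def sum_distrib_left mult_ac)
    finally show ?thesis unfolding lsum_def .
  qed
  also have "(\<lambda>x y z. bstep p1 p2 (\<lambda>L M. \<phi> x y z * D x y z L M) L M) = (\<lambda>x y z. \<phi> x y z * bstep p1 p2 (D x y z) L M)"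
    by (intro ext) (simp add: bstep_def sum_distrib_left mult_ac)
  finally show ?thesis .
qed

lemma bstep_ker11:
  assumes "x + y + z = 0" "chi3 (x - y) \<noteq> 0"
  shows "bstep 1 1 (ker11 x y z) L M = q powi (3 * qexp x y) * ker11 x y z L M"
proof -
  have z: "z = - x - y" using assms by simp
  \<comment> \<open>The origin must be excluded: its kernel has parameters (1, 1, 1) and need not
    vanish for a second argument equal to 1, which is below the offset 2. Elsewhere the largest
    coordinate is at least 1 and the smallest at most -1.\<close>
  have ne: "\<not> (x = 0 \<and> y = 0)" using assms(2) by (auto simp: chi3_def)
  have "bstep 1 1 (\<lambda>r s. bker (int r) (int s + 2) (x + 1) (y + 1) (z + 1)) L M
     = q powi (2 * 2 - 1 * 2 - ((x + 1) * (y + 1) + (x + 1) * (z + 1) + (y + 1) * (z + 1))) * bker (int L) (int M + 2) (x + 1) (y + 1) (z + 1)"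
    by (rule bstep_bker) (use ne in \<open>auto simp: z intro!: bker_eq_0\<close>)
  also have "2 * 2 - 1 * 2 - ((x + 1) * (y + 1) + (x + 1) * (z + 1) + (y + 1) * (z + 1)) = 3 * qexp x y"
    using qform_eq_qexp[OF assms(2)] by (simp add: qform_def z algebra_simps)
  finally show ?thesis by (simp add: ker11_def[abs_def])
qed

lemma bstep_ker10:
  assumes "x + y + z = 0" "chi3 (x - y) \<noteq> 0"
  shows "bstep 1 0 (ker10 x y z) L M = q powi (3 * qexp x y + 1 - z) * ker10 x y z L M"
proof -
  have z: "z = - x - y" using assms by simp
  have "bstep 1 0 (\<lambda>r s. bker (int r) (int s + 1) (x + 1) (y + 1) z) L M
     = q powi (1 * 1 - 0 * 1 - ((x + 1) * (y + 1) + (x + 1) * z + (y + 1) * z)) * bker (int L) (int M + 1) (x + 1) (y + 1) z"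
    by (rule bstep_bker) (auto simp: z intro!: bker_eq_0)
  also have "1 * 1 - 0 * 1 - ((x + 1) * (y + 1) + (x + 1) * z + (y + 1) * z) = 3 * qexp x y + 1 - z"
    using qform_eq_qexp[OF assms(2)] by (simp add: qform_def z algebra_simps)
  finally show ?thesis by (simp add: ker10_def[abs_def])
qed

lemma bstep_ker00:
  assumes "x + y + z = 0" "chi3 (x - y) \<noteq> 0"
  shows "bstep 0 0 (ker00 x y z) L M = q powi (3 * qexp x y + 2 + x - z) * ker00 x y z L M"
proof -
  have z: "z = - x - y" using assms by simp
  have "bstep 0 0 (\<lambda>r s. bker (int r) (int s + 0) (x + 1) y (z - 1)) L M
     = q powi (0 * 0 - 0 * 0 - ((x + 1) * y + (x + 1) * (z - 1) + y * (z - 1))) * bker (int L) (int M + 0) (x + 1) y (z - 1)"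
    by (rule bstep_bker) (auto simp: z intro!: bker_eq_0)
  also have "0 * 0 - 0 * 0 - ((x + 1) * y + (x + 1) * (z - 1) + y * (z - 1)) = 3 * qexp x y + 2 + x - z"
    using qform_eq_qexp[OF assms(2)] by (simp add: qform_def z algebra_simps)
  finally show ?thesis by (simp add: ker00_def[abs_def])
qed

text \<open>Lagrange interpolation in \<open>Y = q\<close>\<open>\<^bsup>M+1\<^esup>\<close> with denominators cleared.\<close>

lemma ker10_ker11:
  "(q powi (x - z) - q powi (y - z) + q powi (y - x) - q powi (z - x) + q powi (z - y) - q powi (x - y)) * ker11 x y z L M
   = (q powi (x - z) - q powi (y - z)) * ker10 x y z L M
   + (q powi (y - x) - q powi (z - x)) * ker10 y z x L M
   + (q powi (z - y) - q powi (x - y)) * ker10 z x y L M"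
proof -
  define a b c where abc: "a = q powi x" "b = q powi y" "c = q powi z"
  have nz: "a \<noteq> 0" "b \<noteq> 0" "c \<noteq> 0" using q_nonzero by (auto simp: abc)
  define X where "X = q powi (int L + 1)"
  define Y where "Y = q powi (int M + 1)"
  define w where "w = qfac (int L + int M + 1) * (rqfac (int L + x + 1) * rqfac (int L + y + 1) * rqfac (int L + z + 1) *
     (rqfac (int M + 1 - x) * rqfac (int M + 1 - y) * rqfac (int M + 1 - z)))"
  have L: "rqfac (int L + t) = (1 - X * q powi t) * rqfac (int L + t + 1)" for t
    using rqfac_eq_succ[of "int L + t"] powi_add[of "int L + 1" t] by (simp add: X_def algebra_simps)
  have M: "rqfac (int M - t) = (1 - Y / q powi t) * rqfac (int M + 1 - t)" for t
    using rqfac_eq_succ[of "int M - t"] power_int_diff[of q "int M + 1" t] q_nonzero by (simp add: Y_def algebra_simps)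
  have e: "int L + (t + 1) = int L + t + 1" "int M + 1 - (t + 1) = int M - t" "int L + (int M + 1) = int L + int M + 1"
    "int M - (t - 1) = int M + 1 - t" for t
    by auto
  have k11: "ker11 x y z L M = (1 - X * Y) * w"
  proof -
    have XY: "X * Y = q powi (int L + int M + 2)"
      unfolding X_def Y_def powi_add[symmetric] by (rule powi_cong) simp
    have qe: "qfac (int L + (int M + 2)) = (1 - X * Y) * qfac (int L + int M + 1)"
      unfolding XY using qfac_rec[of "int L + int M + 2"] by (simp add: algebra_simps)
    show ?thesis unfolding ker11_def bker_def w_def qe by (simp add: algebra_simps)
  qed
  have k10: "ker10 x y z L M = (1 - X * c) * (1 - Y / a) * (1 - Y / b) * w"
    unfolding ker10_def bker_def e unfolding L[of z] M[of x] M[of y] w_def abc by (simp only: mult_ac)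
  have k10': "ker10 y z x L M = (1 - X * a) * (1 - Y / b) * (1 - Y / c) * w"
    unfolding ker10_def bker_def e unfolding L[of x] M[of z] M[of y] w_def abc by (simp only: mult_ac)
  have k10'': "ker10 z x y L M = (1 - X * b) * (1 - Y / c) * (1 - Y / a) * w"
    unfolding ker10_def bker_def e unfolding L[of y] M[of x] M[of z] w_def abc by (simp only: mult_ac)
  have "(a / c - b / c + b / a - c / a + c / b - a / b) * (1 - X * Y)
     = (a / c - b / c) * ((1 - X * c) * (1 - Y / a) * (1 - Y / b))
     + (b / a - c / a) * ((1 - X * a) * (1 - Y / b) * (1 - Y / c))
     + (c / b - a / b) * ((1 - X * b) * (1 - Y / c) * (1 - Y / a))" (is "?l = ?r")
    using nz by (simp add: field_simps)
  then have "(a / c - b / c + b / a - c / a + c / b - a / b) * (1 - X * Y) * w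
     = (a / c - b / c) * ((1 - X * c) * (1 - Y / a) * (1 - Y / b) * w)
     + (b / a - c / a) * ((1 - X * a) * (1 - Y / b) * (1 - Y / c) * w)
     + (c / b - a / b) * ((1 - X * b) * (1 - Y / c) * (1 - Y / a) * w)"
  proof -
    assume "?l = ?r"
    then have "?l * w = ?r * w" by (rule arg_cong)
    then show ?thesis by (simp only: distrib_right mult.assoc)
  qed
  moreover have "q powi (x - z) = a / c" "q powi (y - z) = b / c" "q powi (y - x) = b / a" "q powi (z - x) = c / a"
    "q powi (z - y) = c / b" "q powi (x - y) = a / b"
    unfolding abc using q_nonzero by (simp_all add: power_int_diff)
  ultimately show ?thesis
    unfolding k11 k10 k10' k10'' by (simp only: mult.assoc)
qed

text \<open>The terms differ, but their signed sums over all six permutations agree pointwise by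
  \<open>ker10_ker11\<close>, since \<open>ker11\<close> is symmetric and pulls out. As the weight
  \<open>gw\<close> is antisymmetric, this signed sum multiplies each lattice sum by 6.\<close>

lemma lsum_ker11_ker10_unique:
  assumes "lsum E (\<lambda>x y z. q powi (x - z) * ker11 x y z L M) S" "lsum E (\<lambda>x y z. q powi (x - z) * ker10 x y z L M) T"
  shows "S = T"
proof -
  let ?a = "\<lambda>x y z. q powi (x - z) * ker11 x y z L M"
  let ?b = "\<lambda>x y z. q powi (x - z) * ker10 x y z L M"
  let ?A = "\<lambda>x y z. (?a x y z - ?a y x z) + (?a y z x - ?a z y x) + (?a z x y - ?a x z y)"
  let ?B = "\<lambda>x y z. (?b x y z - ?b y x z) + (?b y z x - ?b z y x) + (?b z x y - ?b x z y)"
  have 1: "lsum E (\<lambda>x y z. \<phi> x y z - \<phi> y x z) (2 * U)" if "lsum E \<phi> U" for \<phi> U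
    using lsum_diff[OF that lsum_swap[OF that]] by simp
  have 2: "lsum E (\<lambda>x y z. (\<phi> x y z - \<phi> y x z) + (\<phi> y z x - \<phi> z y x) + (\<phi> z x y - \<phi> x z y)) (6 * U)"
    if "lsum E \<phi> U" for \<phi> U
    using lsum_add[OF lsum_add[OF 1[OF that] lsum_rotate[OF 1[OF that]]] lsum_rotate[OF lsum_rotate[OF 1[OF that]]]]
    by simp
  have e: "?A = ?B"
  proof (intro ext)
    fix x y z
    have p: "ker11 y x z L M = ker11 x y z L M" "ker11 y z x L M = ker11 x y z L M" "ker11 z y x L M = ker11 x y z L M"
       "ker11 z x y L M = ker11 x y z L M" "ker11 x z y L M = ker11 x y z L M"
      by (metis ker11_perm)+
    show "?A x y z = ?B x y z"
      using ker10_ker11[of x z y L M] unfolding p ker10_swap[of y x z] ker10_swap[of z y x] ker10_swap[of x z y]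
      by (simp add: algebra_simps)
  qed
  have "lsum E ?B (6 * S)" using 2[OF assms(1)] unfolding e .
  then have "6 * S = 6 * T" using 2[OF assms(2)] by (rule lsum_unique)
  then show ?thesis by simp
qed

lemma lsum_finite_support:
  assumes "\<And>x y z. x + y + z = 0 \<Longrightarrow> \<bar>x\<bar> > B \<or> \<bar>y\<bar> > B \<Longrightarrow> \<phi> x y z = 0"
  shows "\<exists>S. lsum E \<phi> S"
proof -
  have "(\<lambda>(x, y). gw E x y * \<phi> x y (- x - y)) summable_on UNIV"
  proof (rule summable_on_finite_support)
    show "finite ({-B..B} \<times> {-B..B})" by simp
  next
    fix p :: "int \<times> int" assume "p \<notin> {-B..B} \<times> {-B..B}"
    then have "\<phi> (fst p) (snd p) (- fst p - snd p) = 0"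
      by (intro assms) (auto simp: mem_Times_iff)
    then show "(case p of (x, y) \<Rightarrow> gw E x y * \<phi> x y (- x - y)) = 0"
      by (simp add: case_prod_unfold)
  qed
  then show ?thesis unfolding lsum_def summable_on_def .
qed

lemma ker10_support: "x + y + z = 0 \<Longrightarrow> \<bar>x\<bar> > int L + int M + 2 \<or> \<bar>y\<bar> > int L + int M + 2 \<Longrightarrow> ker10 x y z L M = 0"
  unfolding ker10_def by (rule bker_eq_0) auto

lemma ker11_support: "x + y + z = 0 \<Longrightarrow> \<bar>x\<bar> > int L + int M + 2 \<or> \<bar>y\<bar> > int L + int M + 2 \<Longrightarrow> ker11 x y z L M = 0"
  unfolding ker11_def by (rule bker_eq_0) auto

lemma ker00_support: "x + y + z = 0 \<Longrightarrow> \<bar>x\<bar> > int L + int M + 2 \<or> \<bar>y\<bar> > int L + int M + 2 \<Longrightarrow> ker00 x y z L M = 0"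
  unfolding ker00_def by (rule bker_eq_0) auto

lemma lsum_ker11_to_ker10:
  assumes "lsum E (\<lambda>x y z. q powi (x - z) * ker11 x y z L M) S"
  shows "lsum E (\<lambda>x y z. q powi (x - z) * ker10 x y z L M) S"
proof -
  have "\<exists>T. lsum E (\<lambda>x y z. q powi (x - z) * ker10 x y z L M) T"
    by (rule lsum_finite_support[of "int L + int M + 2"]) (auto simp: ker10_support)
  then show ?thesis using lsum_ker11_ker10_unique[OF assms] by auto
qed

lemma lsum_ker10_to_ker11:
  assumes "lsum E (\<lambda>x y z. q powi (x - z) * ker10 x y z L M) S"
  shows "lsum E (\<lambda>x y z. q powi (x - z) * ker11 x y z L M) S"
proof -
  have "\<exists>T. lsum E (\<lambda>x y z. q powi (x - z) * ker11 x y z L M) T"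
    by (rule lsum_finite_support[of "int L + int M + 2"]) (auto simp: ker11_support)
  then show ?thesis using lsum_ker11_ker10_unique[OF _ assms] by auto
qed

text \<open>Besides a two-term interpolation in the parameters of x and y, the third parameter drops
  from z to z - 1. This costs the factor 1 - q^(L+z), the source of the correction term in the
  theorem.\<close>

lemma ker00_ker10:
  "(q powi x - q powi y) * (1 - q powi (int L + z)) * ker10 x y z L M
    = q powi x * ker00 x y z L M - q powi y * ker00 y x z L M"
proof -
  define a b c where abc: "a = q powi (x + 1)" "b = q powi (y + 1)" "c = q powi z"
  have nz: "a \<noteq> 0" "b \<noteq> 0" "c \<noteq> 0" using q_nonzero by (auto simp: abc)
  define X where "X = q powi (int L)"
  define Y where "Y = q powi (int M + 1)"
  define w where "w = qfac (int L + int M) * (rqfac (int L + x + 1) * rqfac (int L + y + 1) * rqfac (int L + z) *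
     (rqfac (int M - x) * rqfac (int M - y) * rqfac (int M + 1 - z)))"
  have L: "rqfac (int L + t) = (1 - X * q powi (t + 1)) * rqfac (int L + t + 1)" for t
    using rqfac_eq_succ[of "int L + t"] powi_add[of "int L" "t + 1"] by (simp add: X_def algebra_simps)
  have L': "rqfac (int L + (z - 1)) = (1 - X * c) * rqfac (int L + z)"
    using rqfac_pred[of "int L + z"] powi_add[of "int L" z] by (simp add: X_def abc algebra_simps)
  have M: "rqfac (int M - (t + 1)) = (1 - Y / q powi (t + 1)) * rqfac (int M - t)" for t
    using rqfac_pred[of "int M - t"] power_int_diff[of q "int M + 1" "t + 1"] q_nonzero by (simp add: Y_def algebra_simps)
  have e: "int L + (t + 1) = int L + t + 1" "int M + 1 - (t + 1) = int M - t" "int L + (int M + 1) = int L + int M + 1"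
    "int M - (t - 1) = int M + 1 - t" for t
    by auto
  have k10: "ker10 x y z L M = (1 - X * Y) * w"
  proof -
    have XY: "X * Y = q powi (int L + int M + 1)"
      unfolding X_def Y_def powi_add[symmetric] by (rule powi_cong) simp
    have qe: "qfac (int L + (int M + 1)) = (1 - X * Y) * qfac (int L + int M)"
      unfolding XY using qfac_rec[of "int L + int M + 1"] by (simp add: algebra_simps)
    show ?thesis unfolding ker10_def bker_def w_def qe by (simp add: algebra_simps)
  qed
  have k00: "ker00 x y z L M = (1 - X * b) * (1 - X * c) * (1 - Y / a) * w"
    unfolding ker00_def bker_def e unfolding L[of y] L' M[of x] w_def abc by (simp only: mult_ac)
  have k00': "ker00 y x z L M = (1 - X * a) * (1 - X * c) * (1 - Y / b) * w"
    unfolding ker00_def bker_def e unfolding L[of x] L' M[of y] w_def abc by (simp only: mult_ac)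
  have p: "q powi x = a / q" "q powi y = b / q" "q powi (int L + z) = X * c"
    using q_nonzero by (auto simp: abc X_def powi_add)
  have "(a / q - b / q) * (1 - X * c) * (1 - X * Y)
     = a / q * ((1 - X * b) * (1 - X * c) * (1 - Y / a)) - b / q * ((1 - X * a) * (1 - X * c) * (1 - Y / b))"
    using nz q_nonzero by (simp add: field_simps)
  then have "((a / q - b / q) * (1 - X * c) * (1 - X * Y)) * w
     = (a / q * ((1 - X * b) * (1 - X * c) * (1 - Y / a)) - b / q * ((1 - X * a) * (1 - X * c) * (1 - Y / b))) * w"
    by simp
  then show ?thesis
    unfolding k10 k00 k00' p by (simp only: left_diff_distrib mult.assoc)
qed

text \<open>Only the exchange of x and y is used, so the weight may contain any linear function of
  z; this is what allows the change after several steps of exponent lambda.\<close>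

lemma lsum_ker10_to_ker00:
  assumes "lsum E (\<lambda>x y z. q powi (x - v * z + c) * (1 - q powi (int L + z)) * ker10 x y z L M) S"
  shows "lsum E (\<lambda>x y z. q powi (x - v * z + c) * ker00 x y z L M) S"
proof -
  let ?a = "\<lambda>x y z. q powi (x - v * z + c) * (1 - q powi (int L + z)) * ker10 x y z L M"
  let ?b = "\<lambda>x y z. q powi (x - v * z + c) * ker00 x y z L M"
  have 1: "lsum E (\<lambda>x y z. \<phi> x y z - \<phi> y x z) (2 * U)" if "lsum E \<phi> U" for \<phi> U
    using lsum_diff[OF that lsum_swap[OF that]] by simp
  have "\<exists>T. lsum E ?b T"
    by (rule lsum_finite_support[of "int L + int M + 2"]) (auto simp: ker00_support)
  then obtain T where T: "lsum E ?b T" by blast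
  have "(\<lambda>x y z. ?a x y z - ?a y x z) = (\<lambda>x y z. ?b x y z - ?b y x z)"
  proof (intro ext)
    fix x y z
    have p: "q powi (t - v * z + c) = q powi (- v * z + c) * q powi t" for t
      unfolding powi_add[symmetric] by (rule powi_cong) simp
    have "?a x y z - ?a y x z = q powi (- v * z + c) * ((q powi x - q powi y) * (1 - q powi (int L + z)) * ker10 x y z L M)"
      unfolding p ker10_swap[of y x] by (simp add: algebra_simps)
    also have "\<dots> = ?b x y z - ?b y x z"
      unfolding p ker00_ker10 by (simp only: ring_distribs mult_ac)
    finally show "?a x y z - ?a y x z = ?b x y z - ?b y x z" .
  qed
  then have "lsum E (\<lambda>x y z. ?b x y z - ?b y x z) (2 * S)"
    using 1[OF assms] by simp
  then have "2 * S = 2 * T" using 1[OF T] by (rule lsum_unique)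
  then show ?thesis using T by simp
qed

end

section \<open>Iterating the Bailey step\<close>

context qser
begin

definition beta0 :: "nat \<Rightarrow> nat \<Rightarrow> complex" where
  "beta0 L M = rqfac (int L) * rqfac (int M) * rqfac (int L + int M + 1)"

lemma double_tri: "2 * (j * (j - 1) div 2) = j * (j - (1::int))"
  by simp

text \<open>The product of the three coefficients \<open>ecoef\<close> in the seed sum is, up to
  sign and a power of \<open>q\<close>, a multiple of \<open>ker10\<close>; the value of the sum
  comes from \<open>seed_e1\<close> and \<open>seed_diag\<close> at L + 1.\<close>

lemma lsum_seed:
  "lsum 4 (\<lambda>x y z. q powi (x - z) * ker10 x y z L M) (- (q powi (-2)) * beta0 L M)"
proof -
  \<comment> \<open>Chosen so that the lower indices of the q-binomials are L + x + 1, L + y + 1, L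
    + z and their complements M - x, M - y, M + 1 - z, as in \<open>ker10\<close>.\<close>
  define n where "n = L + M + 1"
  define l where "l = int L + 1"
  define T where "T = l * (l - 1) div 2"
  \<comment> \<open>Everything in the seed term that does not depend on the lattice point.\<close>
  define K where "K = (-1) powi int L * q powi (3 * T - int L + 2) * (qfac (int n) * qfac (int n))"
  have K0: "K \<noteq> 0" using q_nonzero by (simp add: K_def)
  have val: "seed_sum n (2 - l) (- 1 - l) (- l) = K * (- (q powi (-2)) * beta0 L M)"
  proof -
    have "seed_sum n (2 - l) (- 1 - l) (- l) = - (q * (1 - q powi (- l)) * (tri3 l * qbin n l))"
      unfolding seed_swap23[of n "2 - l" "- 1 - l" "- l"] seed_e1 seed_diag by simp
    also have "tri3 l = - ((-1) powi int L * q powi (3 * T))"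
      using esign_pred[of l] by (simp add: tri3_def T_def l_def)
    also have "qbin n l = qfac (int n) * rqfac l * rqfac (int M)"
      by (simp add: qbin_def n_def l_def)
    also have "q * (1 - q powi (- l)) = - (q powi (1 - l) * (1 - q powi l))"
      using powi_add[of 1 "- l"] powi_add[of "1 - l" l] by (simp add: algebra_simps)
    also have "- (- (q powi (1 - l) * (1 - q powi l)) * (- ((-1) powi int L * q powi (3 * T)) * (qfac (int n) * rqfac l * rqfac (int M))))
       = - (((-1) powi int L * (q powi (1 - l) * q powi (3 * T)) * qfac (int n)) * (((1 - q powi l) * rqfac l) * rqfac (int M)))"
      by (simp add: algebra_simps)
    also have "(1 - q powi l) * rqfac l = rqfac (int L)"
      using rqfac_pred[of l] by (simp add: l_def)
    also have "q powi (1 - l) * q powi (3 * T) = q powi (3 * T - int L + 2) * q powi (-2)"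
      unfolding powi_add[symmetric] by (rule powi_cong) (simp add: l_def)
    also have "- ((-1) powi int L * (q powi (3 * T - int L + 2) * q powi (-2)) * qfac (int n) * (rqfac (int L) * rqfac (int M)))
        = K * (- (q powi (-2)) * beta0 L M) * (qfac (int n) * rqfac (int n)) / (qfac (int n) * rqfac (int n))"
      by (simp add: K_def beta0_def n_def rqfac_def algebra_simps)
    finally show ?thesis by (simp add: n_def rqfac_def)
  qed
  have "((\<lambda>p. seed_term n (2 - l) (- 1 - l) (- l) ((\<lambda>(x, y). (x + 2, y - 1)) p)) has_sum K * (- (q powi (-2)) * beta0 L M)) UNIV"
    unfolding has_sum_bij_UNIV[OF bij_shift] val[symmetric] by (rule seed_has_sum)
  also have "(\<lambda>p. seed_term n (2 - l) (- 1 - l) (- l) ((\<lambda>(x, y). (x + 2, y - 1)) p))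
      = (\<lambda>p. K * (case p of (x, y) \<Rightarrow> gw 4 x y * (q powi (x - (- x - y)) * ker10 x y (- x - y) L M)))"
  proof
    fix p :: "int \<times> int"
    obtain x y where p: "p = (x, y)" by force
    show "seed_term n (2 - l) (- 1 - l) (- l) ((\<lambda>(x, y). (x + 2, y - 1)) p)
       = K * (case p of (x, y) \<Rightarrow> gw 4 x y * (q powi (x - (- x - y)) * ker10 x y (- x - y) L M))"
    proof (cases "chi3 (x - y) = 0")
      case True
      then show ?thesis using chi3_add_mult3[of "x - y" 1] by (simp add: p seed_term_def gw_def algebra_simps)
    next
      case False
      define a b c where abc: "a = int L + (x + 1)" "b = int L + (y + 1)" "c = int L + (- x - y)"
      have chi: "chi3 (x + 2 - (y - 1)) = chi3 (x - y)"
        using chi3_add_mult3[of "x - y" 1] by (simp add: algebra_simps)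
      have args: "x + 2 - (2 - l) = a" "y - 1 - (- 1 - l) = b" "- (x + 2) - (y - 1) - - l = c"
        using abc by (auto simp: l_def)
      have prod: "ecoef n a * ecoef n b * ecoef n c = ((-1) powi a * (-1) powi b * (-1) powi c) *
          (q powi (a * (a - 1) div 2) * q powi (b * (b - 1) div 2) * q powi (c * (c - 1) div 2)) *
          (qfac (int n) * qfac (int n) * ker10 x y (- x - y) L M)"
        unfolding ecoef_def qbin_def ker10_def bker_def abc by (simp add: n_def algebra_simps)
      have sgn: "(-1) powi a * (-1) powi b * (-1) powi c = ((-1) powi int L :: complex)"
      proof -
        have "(-1) powi a * (-1) powi b * (-1) powi c = ((-1) powi (a + b + c) :: complex)"
          by (simp add: power_int_add)
        also have "a + b + c = int L + 2 * (int L + 1)" by (simp add: abc)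
        also have "(-1 :: complex) powi (int L + 2 * (int L + 1)) = (-1) powi int L * ((-1) powi 2) powi (int L + 1)"
          unfolding power_int_mult[symmetric] by (subst power_int_add) auto
        finally show ?thesis by simp
      qed
      have "ta + tb + tc = qform x y + x + y + 3 * T - int L"
        if "2 * ta = a * (a - 1)" "2 * tb = b * (b - 1)" "2 * tc = c * (c - 1)" "2 * T = l * (l - 1)" for ta tb tc
      proof -
        have "2 * (ta + tb + tc) = 2 * (qform x y + x + y + 3 * T - int L)"
          using that by (simp add: abc l_def qform_def algebra_simps)
        then show ?thesis by simp
      qed
      from this[OF double_tri double_tri double_tri double_tri[of l, folded T_def]]
      have tri: "a * (a - 1) div 2 + b * (b - 1) div 2 + c * (c - 1) div 2 = 3 * qexp x y + 1 + x + y + 3 * T - int L"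
        unfolding qform_eq_qexp[OF False] .
      have "q powi (qexp x y + x + 1) * (q powi (a * (a - 1) div 2) * q powi (b * (b - 1) div 2) * q powi (c * (c - 1) div 2))
         = q powi (3 * T - int L + 2) * (q powi (4 * qexp x y) * q powi (x - (- x - y)))"
        unfolding powi_add[symmetric] tri by (rule powi_cong) simp
      then show ?thesis
        unfolding p prod.case seed_term_def chi qexp_shift args prod sgn gw_def K_def
        by (simp add: mult_ac)
    qed
  qed
  finally show ?thesis
    unfolding lsum_def has_sum_cmult_right_iff[OF K0] by (simp add: K0)
qed

section \<open>Linearity of the step and the chains of steps\<close>

lemma bstep_linear: "bstep p1 p2 (\<lambda>L M. c * f L M) L M = c * bstep p1 p2 f L M"
  by (simp add: bstep_def sum_distrib_left mult_ac)

lemma bstep_diff: "bstep p1 p2 (\<lambda>L M. f L M - g L M) L M = bstep p1 p2 f L M - bstep p1 p2 g L M"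
  by (simp add: bstep_def sum_subtractf algebra_simps)

text \<open>A factor q^L in the argument is a linear exponent of the step; this absorbs the unwanted
  half of 1 - q^(L+z).\<close>

lemma bstep_twist: "bstep p1 p2 (\<lambda>L M. q powi (int L) * f L M) = bstep (p1 + 1) p2 f"
proof (intro ext)
  fix L M
  have "q powi (int r * int r - int r * int s + int s * int s + (p1 + 1) * int r + p2 * int s)
     = q powi (int r * int r - int r * int s + int s * int s + p1 * int r + p2 * int s) * q powi (int r)" for r s :: nat
    unfolding powi_add[symmetric] by (rule powi_cong) (simp add: algebra_simps)
  then show "bstep p1 p2 (\<lambda>L M. q powi (int L) * f L M) L M = bstep (p1 + 1) p2 f L M"
    unfolding bstep_def by (simp only: mult.assoc)
qed

text \<open>The constant of \<open>lsum_seed\<close>. The same factor appears when the Macdonald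
  identity is specialised in \<open>weight_sum\<close>, and the two cancel.\<close>

definition cseed :: complex where "cseed = - (q powi (-2))"

lemma cseed_nonzero: "cseed \<noteq> 0"
  using q_nonzero by (simp add: cseed_def)

text \<open>On the lattice a (1, 1) step is multiplication by q^(3 qexp) with no linear term, so the
  weight q^(x-z) needed for the next change of kernel survives any number of steps.\<close>

lemma chain11:
  "lsum (4 + 3 * int n) (\<lambda>x y z. q powi (x - z) * ker11 x y z L M) (cseed * (bstep 1 1 ^^ n) beta0 L M)"
proof (induction n arbitrary: L M)
  case 0
  then show ?case using lsum_ker10_to_ker11[OF lsum_seed] by (simp add: cseed_def)
next
  case (Suc n)
  have "lsum (4 + 3 * int n) (\<lambda>x y z. q powi (x - z) * bstep 1 1 (ker11 x y z) L M)
      (bstep 1 1 (\<lambda>L M. cseed * (bstep 1 1 ^^ n) beta0 L M) L M)"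
    by (rule lsum_bstep[OF Suc.IH])
  then have *: "lsum (4 + 3 * int n) (\<lambda>x y z. q powi (x - z) * bstep 1 1 (ker11 x y z) L M) (cseed * (bstep 1 1 ^^ Suc n) beta0 L M)"
    by (simp add: bstep_linear)
  show ?case
  proof (rule lsum_cong[OF *])
    fix x y z :: int assume A: "x + y + z = 0" "chi3 (x - y) \<noteq> 0"
    have "q powi ((4 + 3 * int (Suc n)) * qexp x y) = q powi ((4 + 3 * int n) * qexp x y) * q powi (3 * qexp x y)"
      unfolding powi_add[symmetric] by (rule powi_cong) (simp add: algebra_simps)
    then show "q powi ((4 + 3 * int n) * qexp x y) * (q powi (x - z) * bstep 1 1 (ker11 x y z) L M) =
         q powi ((4 + 3 * int (Suc n)) * qexp x y) * (q powi (x - z) * ker11 x y z L M)"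
      unfolding bstep_ker11[OF A] by (simp add: mult_ac)
  qed
qed

lemma lsum_step10:
  assumes "\<And>L M. lsum E (\<lambda>x y z. q powi (x - v * z + c) * ker10 x y z L M) (f L M)"
  shows "lsum (E + 3) (\<lambda>x y z. q powi (x - (v + 1) * z + (c + 1)) * ker10 x y z L M) (bstep 1 0 f L M)"
proof (rule lsum_cong[OF lsum_bstep[OF assms]])
  fix x y z :: int assume A: "x + y + z = 0" "chi3 (x - y) \<noteq> 0"
  have "q powi ((E + 3) * qexp x y) * q powi (x - (v + 1) * z + (c + 1)) = q powi (E * qexp x y) * q powi (x - v * z + c) * q powi (3 * qexp x y + 1 - z)"
    unfolding powi_add[symmetric] by (rule powi_cong) (simp add: algebra_simps)
  then show "q powi (E * qexp x y) * (q powi (x - v * z + c) * bstep 1 0 (ker10 x y z) L M) =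
       q powi ((E + 3) * qexp x y) * (q powi (x - (v + 1) * z + (c + 1)) * ker10 x y z L M)"
    unfolding bstep_ker10[OF A] by (simp add: mult.assoc[symmetric])
qed

lemma lsum_step00:
  assumes "\<And>L M. lsum E (\<lambda>x y z. q powi (u * x - v * z + c) * ker00 x y z L M) (f L M)"
  shows "lsum (E + 3) (\<lambda>x y z. q powi ((u + 1) * x - (v + 1) * z + (c + 2)) * ker00 x y z L M) (bstep 0 0 f L M)"
proof (rule lsum_cong[OF lsum_bstep[OF assms]])
  fix x y z :: int assume A: "x + y + z = 0" "chi3 (x - y) \<noteq> 0"
  have "q powi ((E + 3) * qexp x y) * q powi ((u + 1) * x - (v + 1) * z + (c + 2)) = q powi (E * qexp x y) * q powi (u * x - v * z + c) * q powi (3 * qexp x y + 2 + x - z)"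
    unfolding powi_add[symmetric] by (rule powi_cong) (simp add: algebra_simps)
  then show "q powi (E * qexp x y) * (q powi (u * x - v * z + c) * bstep 0 0 (ker00 x y z) L M) =
       q powi ((E + 3) * qexp x y) * (q powi ((u + 1) * x - (v + 1) * z + (c + 2)) * ker00 x y z L M)"
    unfolding bstep_ker00[OF A] by (simp add: mult.assoc[symmetric])
qed

definition chain :: "nat \<Rightarrow> nat \<Rightarrow> nat \<Rightarrow> nat \<Rightarrow> complex" where
  "chain n1 n = (bstep 1 0 ^^ n) ((bstep 1 1 ^^ n1) beta0)"

lemma chain10:
  "lsum (4 + 3 * int (n1 + n)) (\<lambda>x y z. q powi (x - (1 + int n) * z + int n) * ker10 x y z L M) (cseed * chain n1 n L M)"
proof (induction n arbitrary: L M)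
  case 0
  show ?case using lsum_ker11_to_ker10[OF chain11[of n1]] by (simp add: chain_def)
next
  case (Suc n)
  show ?case
    using lsum_step10[OF Suc.IH, of L M] by (simp add: chain_def bstep_linear algebra_simps)
qed

text \<open>The change of kernel happens once, in the base case; later (0, 0) steps carry both terms
  along. The correction has one (0, 0) step fewer and one (1, 1) step more, as befits (a - 1, b -
  1).\<close>

lemma chain00:
  "lsum (4 + 3 * int (n1 + n + Suc a)) (\<lambda>x y z. q powi ((int a + 2) * x - (int n + int a + 2) * z + (int n + 2 * int a + 2)) * ker00 x y z L M)
    (cseed * ((bstep 0 0 ^^ Suc a) (chain n1 n) L M - q * (bstep 0 0 ^^ a) (chain (Suc n1) n) L M))"
proof (induction a arbitrary: L M)
  case 0
  define E where "E = 4 + 3 * int (n1 + n)"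
  \<comment> \<open>The lattice sum that multiplies q^L in the second half. It is never evaluated
    itself: after one (1, 0) step its weight coincides with that of \<open>chain10\<close> for
    \<open>Suc n1\<close>, which identifies the result.\<close>
  define P where "P L M = (SOME S. lsum E (\<lambda>x y z. q powi (x - int n * z + (int n - 1)) * ker10 x y z L M) S)" for L M
  have P: "lsum E (\<lambda>x y z. q powi (x - int n * z + (int n - 1)) * ker10 x y z L M) (P L M)" for L M
    unfolding P_def
    by (rule someI_ex, rule lsum_finite_support[of "int L + int M + 2"]) (auto simp: ker10_support)
  have P1: "bstep 1 0 P L M = cseed * chain (Suc n1) n L M" for L M
  proof -
    have "lsum (E + 3) (\<lambda>x y z. q powi (x - (int n + 1) * z + (int n - 1 + 1)) * ker10 x y z L M) (bstep 1 0 P L M)"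
      by (rule lsum_step10[OF P])
    moreover have "lsum (E + 3) (\<lambda>x y z. q powi (x - (int n + 1) * z + (int n - 1 + 1)) * ker10 x y z L M) (cseed * chain (Suc n1) n L M)"
      using chain10[of "Suc n1" n L M] by (simp add: E_def algebra_simps)
    ultimately show ?thesis by (rule lsum_unique)
  qed
  have "lsum E (\<lambda>x y z. q powi (x - (1 + int n) * z + int n) * ker00 x y z L M)
      (cseed * chain n1 n L M - q * (q powi int L * P L M))" for L M
  proof (rule lsum_ker10_to_ker00)
    have "lsum E (\<lambda>x y z. q powi (x - (1 + int n) * z + int n) * ker10 x y z L M -
        (q * q powi int L) * (q powi (x - int n * z + (int n - 1)) * ker10 x y z L M)) (cseed * chain n1 n L M - (q * q powi int L) * P L M)"
      unfolding E_def by (rule lsum_diff[OF chain10 lsum_cmult[OF P[unfolded E_def]]])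
    moreover have "q powi (x - (1 + int n) * z + int n) * ker10 x y z L M -
        (q * q powi int L) * (q powi (x - int n * z + (int n - 1)) * ker10 x y z L M)
       = q powi (x - (1 + int n) * z + int n) * (1 - q powi (int L + z)) * ker10 x y z L M" for x y z
    proof -
      have "q powi (x - (1 + int n) * z + int n) * q powi (int L + z) = q powi 1 * q powi int L * q powi (x - int n * z + (int n - 1))"
        unfolding powi_add[symmetric] by (rule powi_cong) (simp add: algebra_simps)
      then show ?thesis unfolding right_diff_distrib left_diff_distrib by (simp add: mult.assoc[symmetric])
    qed
    ultimately show "lsum E (\<lambda>x y z. q powi (x - (1 + int n) * z + int n) * (1 - q powi (int L + z)) * ker10 x y z L M)
      (cseed * chain n1 n L M - q * (q powi int L * P L M))"
      by (simp only: mult.assoc)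
  qed
  then have "\<And>L M. lsum E (\<lambda>x y z. q powi (1 * x - (1 + int n) * z + int n) * ker00 x y z L M)
      (cseed * chain n1 n L M - q * (q powi int L * P L M))"
    by simp
  from lsum_step00[OF this, of L M]
  have *: "lsum (E + 3) (\<lambda>x y z. q powi ((1 + 1) * x - (1 + int n + 1) * z + (int n + 2)) * ker00 x y z L M)
     (bstep 0 0 (\<lambda>L M. cseed * chain n1 n L M - q * (q powi int L * P L M)) L M)" .
  \<comment> \<open>A (0, 0) step on q^L P is a (1, 0) step on P, hence a known chain.\<close>
  have eq: "bstep 0 0 (\<lambda>L M. cseed * chain n1 n L M - q * (q powi int L * P L M)) L M
      = cseed * (bstep 0 0 (chain n1 n) L M - q * chain (Suc n1) n L M)"
    unfolding bstep_diff bstep_linear bstep_twist by (simp add: P1 algebra_simps)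
  show ?case using *[unfolded eq] by (simp add: E_def algebra_simps)
next
  case (Suc a)
  show ?case
    using lsum_step00[OF Suc.IH, of L M] by (simp add: bstep_linear bstep_diff algebra_simps)
qed

end

section \<open>From the symmetric multisum to the binomial multisum\<close>

context qser
begin

definition eps :: "nat \<Rightarrow> nat \<Rightarrow> int" where
  "eps b i = (if i > b then 1 else 0)"

text \<open>\<open>fch k a b j\<close> is the nested sum in which the innermost \<open>j\<close> pairs \<open>(\<lambda>\<^sub>i, \<mu>\<^sub>i)\<close>, those with \<open>i > k - j\<close>, have been summed.
  The choice \<open>b = k + 1\<close> replaces the starting function by \<open>(\<lambda>\<^sub>k) (\<mu>\<^sub>k) (\<lambda>\<^sub>k + \<mu>\<^sub>k)\<close>.\<close>

fun fch :: "nat \<Rightarrow> nat \<Rightarrow> nat \<Rightarrow> nat \<Rightarrow> nat \<Rightarrow> nat \<Rightarrow> complex" where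
  "fch k a b 0 = (\<lambda>l m. rqfac (int l) * rqfac (int m) * rqfac (int l + int m + eps b (k + 1)))"
| "fch k a b (Suc j) = bstep (eps a (k - j)) (eps b (k - j)) (fch k a b j)"

lemma fch_eq_chain:
  assumes "a \<le> b" "b \<le> k"
  shows "fch k a b k = (bstep 0 0 ^^ a) (chain (k - b) (b - a))"
proof -
  have 1: "fch k a b j = (bstep 1 1 ^^ j) beta0" if "j \<le> k - b" for j
    using that assms by (induction j) (auto simp: eps_def beta0_def[abs_def])
  have 2: "fch k a b (k - b + j) = (bstep 1 0 ^^ j) (fch k a b (k - b))" if "j \<le> b - a" for j
    using that assms by (induction j) (auto simp: eps_def)
  have 3: "fch k a b (k - a + j) = (bstep 0 0 ^^ j) (fch k a b (k - a))" if "j \<le> a" for j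
    using that assms by (induction j) (auto simp: eps_def)
  have "fch k a b (k - a + a) = (bstep 0 0 ^^ a) (fch k a b (k - a))"
    by (rule 3) simp
  moreover have "fch k a b (k - a) = chain (k - b) (b - a)"
    using 2[of "b - a"] 1[of "k - b"] assms by (simp add: chain_def)
  ultimately show ?thesis using assms by simp
qed

lemma fch_swap:
  assumes "a \<le> k" "b \<le> k"
  shows "fch k a b j L M = fch k b a j M L"
proof (induction j arbitrary: L M)
  case 0
  show ?case using assms by (simp add: eps_def add.commute mult.commute)
next
  case (Suc j)
  show ?case
    unfolding fch.simps bstep_def
  proof (subst sum.swap, intro sum.cong refl)
    fix s r
    have "q powi (int r * int r - int r * int s + int s * int s + eps a (k - j) * int r + eps b (k - j) * int s)
        = q powi (int s * int s - int s * int r + int r * int r + eps b (k - j) * int s + eps a (k - j) * int r)"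
      by (rule powi_cong) (simp add: algebra_simps)
    then show "q powi (int r * int r - int r * int s + int s * int s + eps a (k - j) * int r + eps b (k - j) * int s) *
         fch k a b j r s * rqfac (int L - int r) * rqfac (int M - int s) =
       q powi (int s * int s - int s * int r + int r * int r + eps b (k - j) * int s + eps a (k - j) * int r) *
         fch k b a j s r * rqfac (int M - int s) * rqfac (int L - int r)"
      using Suc.IH[of r s] by simp
  qed
qed

text \<open>By (l + m) = (1 - q^(l+m+1)) (l + m + 1), the changed starting function is the old one
  minus q times its twist by q^(l+m), and the twist turns the first (0, 0) step into a (1, 1) step.
  The single multisum thus equals the difference of two in the case a = b = k.\<close>

lemma fch_special:
  assumes "k \<ge> 1"
  shows "fch k k (k + 1) k L M = fch k k k k L M - q * fch k (k - 1) (k - 1) k L M"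
proof -
  obtain n where k: "k = Suc n" using assms by (cases k) auto
  let ?b = "\<lambda>l m. rqfac (int l) * rqfac (int m) * rqfac (int l + int m)"
  have 1: "fch k k (k + 1) j = (bstep 0 0 ^^ j) ?b" if "j \<le> k" for j
    using that by (induction j) (auto simp: eps_def)
  have 2: "fch k k k k = (bstep 0 0 ^^ n) (bstep 0 0 beta0)"
    using fch_eq_chain[of k k k] by (simp add: chain_def k funpow_swap1)
  have 3: "fch k n n k = (bstep 0 0 ^^ n) (bstep 1 1 beta0)"
    using fch_eq_chain[of n n k] by (simp add: chain_def k)
  have b: "?b = (\<lambda>l m. beta0 l m - q * (q powi int l * (q powi int m * beta0 l m)))"
  proof (intro ext)
    fix l m
    have r: "rqfac (int l + int m) = (1 - q powi 1 * q powi int l * q powi int m) * rqfac (int l + int m + 1)"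
      unfolding powi_add[symmetric] rqfac_eq_succ[of "int l + int m"] by (simp add: add_ac)
    show "?b l m = beta0 l m - q * (q powi int l * (q powi int m * beta0 l m))"
      unfolding r beta0_def by (simp add: algebra_simps)
  qed
  have tw: "bstep 1 0 (\<lambda>l m. q powi int m * f l m) L M = bstep 1 1 f L M" for f L M
  proof -
    have "q powi (int r * int r - int r * int s + int s * int s + 1 * int r + 1 * int s)
     = q powi (int r * int r - int r * int s + int s * int s + 1 * int r + 0 * int s) * q powi (int s)" for r s :: nat
      unfolding powi_add[symmetric] by (rule powi_cong) (simp add: algebra_simps)
    then show ?thesis
      unfolding bstep_def by (simp only: mult.assoc)
  qed
  have step: "bstep 0 0 ?b L M = bstep 0 0 beta0 L M - q * bstep 1 1 beta0 L M" for L M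
    unfolding b bstep_diff bstep_linear bstep_twist add_0 tw ..
  have "(bstep 0 0 ^^ j) (bstep 0 0 ?b) L M = (bstep 0 0 ^^ j) (bstep 0 0 beta0) L M - q * (bstep 0 0 ^^ j) (bstep 1 1 beta0) L M" for j L M
  proof (induction j arbitrary: L M)
    case 0
    show ?case by (simp add: step)
  next
    case (Suc j)
    have "(bstep 0 0 ^^ j) (bstep 0 0 ?b) = (\<lambda>L M. (bstep 0 0 ^^ j) (bstep 0 0 beta0) L M - q * (bstep 0 0 ^^ j) (bstep 1 1 beta0) L M)"
      by (intro ext Suc.IH)
    then show ?case by (simp only: funpow.simps o_apply bstep_diff bstep_linear)
  qed
  then show ?thesis
    using 1[of k] 2 3 by (simp add: k funpow_swap1)
qed

section \<open>Exchanging the mu-sums for q-binomial coefficients\<close>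

lemma qbinom_eq: "qbinom q n m = qfac n * rqfac m * rqfac (n - m)"
  by (auto simp: qbinom_def rqfac_def qfac_def)

definition hw :: "nat \<Rightarrow> nat \<Rightarrow> nat \<Rightarrow> nat \<Rightarrow> nat \<Rightarrow> complex" where
  "hw a b i x y = q powi (int x * int x - int x * int y + int y * int y + eps a i * int x + eps b i * int y)"

text \<open>The Kronecker delta of the theorem, in the form in which it arises: the jump of the
  linear mu-exponent between consecutive indices.\<close>

definition dd :: "nat \<Rightarrow> nat \<Rightarrow> int" where
  "dd b i = eps b (i + 1) - eps b i"

lemma dd_bounds: "0 \<le> dd b i" "dd b i \<le> 1"
  by (auto simp: dd_def eps_def)

text \<open>The \<open>q\<close>-binomial multisum with \<open>(\<lambda>\<^sub>i, \<mu>\<^sub>i) = (x, y)\<close> fixed for \<open>i = k - j\<close> and summed over all larger indices;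
  the bound on \<open>y'\<close> contains the support.\<close>

fun hch :: "nat \<Rightarrow> nat \<Rightarrow> nat \<Rightarrow> nat \<Rightarrow> nat \<Rightarrow> nat \<Rightarrow> complex" where
  "hch k a b 0 x y = hw a b k x y * (rqfac (int x) * qbinom q (2 * int x + dd b k) (int y))"
| "hch k a b (Suc j) x y = hw a b (k - Suc j) x y *
     (\<Sum>x'\<le>x. \<Sum>y'\<le>2 * x' + j + 1. rqfac (int x - int x') *
        qbinom q (int x - int x' + int y' + dd b (k - Suc j)) (int y) * hch k a b j x' y')"

text \<open>\<open>durfee_transform'\<close> with A = 0; multiplying by (q;q)_(B-h), which needs B -
  h nonnegative, completes the factors to a q-binomial coefficient.\<close>

lemma durfee_qbinom:
  assumes "0 \<le> B - h" "B - h \<le> int Y"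
  shows "(\<Sum>m\<le>M. q powi (int m * int m + h * int m) * rqfac (int M - int m) * rqfac (int m) * rqfac (int m + B))
    = rqfac (int M) * (\<Sum>y\<le>Y. q powi (int y * int y + h * int y) * qbinom q (B - h) (int y) * rqfac (int M + int y + h))"
proof -
  let ?S = "\<Sum>r=0..int M. q powi (r * r + h * r) * rqfac (int M - r) * rqfac r * rqfac (r + B)"
  let ?T = "\<Sum>c=0..int Y. q powi (c * c + h * c) * rqfac c * rqfac (B - h - c) * rqfac (int M + c + h)"
  have "rqfac (B - h) * ?S = rqfac (int M) * ?T"
    using durfee_transform'[of 0 0 "int M" "int M" 0 B h "int Y"] assms by simp
  then have "(rqfac (B - h) * qfac (B - h)) * ?S = rqfac (int M) * (qfac (B - h) * ?T)"
    by (simp only: mult_ac)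
  then have "?S = rqfac (int M) * (qfac (B - h) * ?T)"
    unfolding rqfac_qfac[OF assms(1)] by (simp only: mult_1_left)
  also have "qfac (B - h) * ?T = (\<Sum>c=0..int Y. q powi (c * c + h * c) * qbinom q (B - h) c * rqfac (int M + c + h))"
    by (simp add: sum_distrib_left qbinom_eq mult_ac)
  finally show ?thesis
    using sum_le_nat_int[of "\<lambda>r. q powi (r * r + h * r) * rqfac (int M - r) * rqfac r * rqfac (r + B)" M]
      sum_le_nat_int[of "\<lambda>c. q powi (c * c + h * c) * qbinom q (B - h) c * rqfac (int M + c + h)" Y]
    by simp
qed

lemma hw_split: "hw a b i x y = q powi (int x * int x + eps a i * int x) * q powi (int y * int y + (eps b i - int x) * int y)"
  unfolding hw_def powi_add[symmetric] by (rule powi_cong) (simp add: algebra_simps)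

lemma bstep_fch:
  "bstep (eps a i) (eps b i) f L M = (\<Sum>l\<le>L. rqfac (int L - int l) * (q powi (int l * int l + eps a i * int l) *
     (\<Sum>m\<le>M. q powi (int m * int m + (eps b i - int l) * int m) * rqfac (int M - int m) * f l m)))"
  unfolding bstep_def hw_def[symmetric] hw_split by (simp add: sum_distrib_left mult_ac)

text \<open>At each level the mu-sum is replaced by a sum over a new index y, using
  \<open>durfee_qbinom\<close> with h = eps b i - l and B taken from the single factor in which mu
  survives from the level below. Then B - h is the upper entry of the q-binomial. Innermost, B = l +
  eps b (k+1), which explains the conventions for lambda and mu at k + 1.\<close>

lemma fch_eq_hch:
  assumes "j < k"
  shows "fch k a b (Suc j) L M = rqfac (int M) * (\<Sum>l\<le>L. \<Sum>y\<le>2 * l + j + 1.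
     rqfac (int L - int l) * hch k a b j l y * rqfac (int M + int y - int l + eps b (k - j)))"
  using assms
proof (induction j arbitrary: L M)
  case 0
  have "fch k a b (Suc 0) L M = (\<Sum>l\<le>L. rqfac (int L - int l) * (q powi (int l * int l + eps a k * int l) * (rqfac (int l) *
     (\<Sum>m\<le>M. q powi (int m * int m + (eps b k - int l) * int m) * rqfac (int M - int m) * rqfac (int m) * rqfac (int m + (int l + eps b (k + 1)))))))"
    unfolding fch.simps bstep_fch by (simp add: sum_distrib_left mult_ac add_ac)
  also have "\<dots> = (\<Sum>l\<le>L. rqfac (int L - int l) * (q powi (int l * int l + eps a k * int l) * (rqfac (int l) *
     (rqfac (int M) * (\<Sum>y\<le>2 * l + 1. q powi (int y * int y + (eps b k - int l) * int y) *
        qbinom q (int l + eps b (k + 1) - (eps b k - int l)) (int y) * rqfac (int M + int y + (eps b k - int l)))))))"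
    by (intro sum.cong refl arg_cong2[where f="(*)"] durfee_qbinom) (auto simp: eps_def)
  also have "\<dots> = rqfac (int M) * (\<Sum>l\<le>L. \<Sum>y\<le>2 * l + 0 + 1.
     rqfac (int L - int l) * hch k a b 0 l y * rqfac (int M + int y - int l + eps b (k - 0)))"
    unfolding sum_distrib_left
  proof (intro sum.cong)
    fix l y :: nat
    have e: "int l + eps b (k + 1) - (eps b k - int l) = 2 * int l + dd b k" by (simp add: dd_def)
    have e': "int M + int y + (eps b k - int l) = int M + int y - int l + eps b (k - 0)" by simp
    show "rqfac (int L - int l) * (q powi (int l * int l + eps a k * int l) * (rqfac (int l) *
     (rqfac (int M) * (q powi (int y * int y + (eps b k - int l) * int y) *
        qbinom q (int l + eps b (k + 1) - (eps b k - int l)) (int y) * rqfac (int M + int y + (eps b k - int l))))))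
      = rqfac (int M) * (rqfac (int L - int l) * hch k a b 0 l y * rqfac (int M + int y - int l + eps b (k - 0)))"
      unfolding hch.simps hw_split e e' by (simp only: mult_ac)
  qed auto
  finally show ?case by simp
next
  case (Suc j)
  define i where "i = k - Suc j"
  have i: "k - j = i + 1" using Suc.prems by (simp add: i_def)
  have IH: "fch k a b (Suc j) l m = rqfac (int m) * (\<Sum>x\<le>l. \<Sum>y\<le>2 * x + j + 1.
     rqfac (int l - int x) * hch k a b j x y * rqfac (int m + (int y - int x + eps b (i + 1))))" for l m
  proof -
    have e: "int m + int y - int x + eps b (i + 1) = int m + (int y - int x + eps b (i + 1))" for x y by simp
    show ?thesis using Suc.IH[OF Suc_lessD[OF Suc.prems], of l m] unfolding i e .
  qed
  have "fch k a b (Suc (Suc j)) L M = (\<Sum>l\<le>L. rqfac (int L - int l) * (q powi (int l * int l + eps a i * int l) *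
     (\<Sum>m\<le>M. \<Sum>x\<le>l. \<Sum>y'\<le>2 * x + j + 1. rqfac (int l - int x) * hch k a b j x y' * (q powi (int m * int m + (eps b i - int l) * int m) * rqfac (int M - int m) * rqfac (int m) *
       rqfac (int m + (int y' - int x + eps b (i + 1)))))))"
    unfolding fch.simps(2)[of k a b "Suc j"] i_def[symmetric] bstep_fch IH by (simp only: sum_distrib_left mult_ac)
  also have "\<dots> = (\<Sum>l\<le>L. rqfac (int L - int l) * (q powi (int l * int l + eps a i * int l) *
     (\<Sum>x\<le>l. \<Sum>y'\<le>2 * x + j + 1. rqfac (int l - int x) * hch k a b j x y' * (\<Sum>m\<le>M. q powi (int m * int m + (eps b i - int l) * int m) * rqfac (int M - int m) * rqfac (int m) *
       rqfac (int m + (int y' - int x + eps b (i + 1)))))))"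
  proof (intro sum.cong[OF refl] arg_cong2[where f="(*)"] refl)
    fix l
    show "(\<Sum>m\<le>M. \<Sum>x\<le>l. \<Sum>y'\<le>2 * x + j + 1. rqfac (int l - int x) * hch k a b j x y' * (q powi (int m * int m + (eps b i - int l) * int m) * rqfac (int M - int m) * rqfac (int m) *
       rqfac (int m + (int y' - int x + eps b (i + 1))))) = (\<Sum>x\<le>l. \<Sum>y'\<le>2 * x + j + 1. rqfac (int l - int x) * hch k a b j x y' * (\<Sum>m\<le>M. q powi (int m * int m + (eps b i - int l) * int m) * rqfac (int M - int m) * rqfac (int m) *
       rqfac (int m + (int y' - int x + eps b (i + 1)))))"
      unfolding sum_distrib_left by (subst sum.swap, intro sum.cong[OF refl]) (subst sum.swap, rule refl)
  qed
  also have "\<dots> = (\<Sum>l\<le>L. rqfac (int L - int l) * (q powi (int l * int l + eps a i * int l) *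
     (\<Sum>x\<le>l. \<Sum>y'\<le>2 * x + j + 1. rqfac (int l - int x) * hch k a b j x y' *
       (rqfac (int M) * (\<Sum>y\<le>2 * l + Suc j + 1. q powi (int y * int y + (eps b i - int l) * int y) *
        qbinom q ((int y' - int x + eps b (i + 1)) - (eps b i - int l)) (int y) * rqfac (int M + int y + (eps b i - int l)))))))"
    by (intro sum.cong refl arg_cong2[where f="(*)"] durfee_qbinom) (auto simp: eps_def)
  also have "\<dots> = (\<Sum>l\<le>L. \<Sum>y\<le>2 * l + Suc j + 1. \<Sum>x\<le>l. \<Sum>y'\<le>2 * x + j + 1.
        rqfac (int L - int l) * (q powi (int l * int l + eps a i * int l) * (rqfac (int l - int x) * hch k a b j x y' *
       (rqfac (int M) * (q powi (int y * int y + (eps b i - int l) * int y) *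
        qbinom q ((int y' - int x + eps b (i + 1)) - (eps b i - int l)) (int y) * rqfac (int M + int y + (eps b i - int l)))))))"
  proof (rule sum.cong[OF refl])
    fix l
    have sw: "(\<Sum>x\<le>l. \<Sum>y'\<le>2 * x + j + 1. \<Sum>y\<le>N. F x y' y) = (\<Sum>y\<le>N. \<Sum>x\<le>l. \<Sum>y'\<le>2 * x + j + 1. F x y' (y::nat) :: complex)" for F N
    proof -
      have "(\<Sum>x\<le>l. \<Sum>y'\<le>2 * x + j + 1. \<Sum>y\<le>N. F x y' y) = (\<Sum>x\<le>l. \<Sum>y\<le>N. \<Sum>y'\<le>2 * x + j + 1. F x y' y)"
        by (intro sum.cong[OF refl] sum.swap)
      also have "\<dots> = (\<Sum>y\<le>N. \<Sum>x\<le>l. \<Sum>y'\<le>2 * x + j + 1. F x y' y)" by (rule sum.swap)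
      finally show ?thesis .
    qed
    show "rqfac (int L - int l) * (q powi (int l * int l + eps a i * int l) *
     (\<Sum>x\<le>l. \<Sum>y'\<le>2 * x + j + 1. rqfac (int l - int x) * hch k a b j x y' *
       (rqfac (int M) * (\<Sum>y\<le>2 * l + Suc j + 1. q powi (int y * int y + (eps b i - int l) * int y) *
        qbinom q ((int y' - int x + eps b (i + 1)) - (eps b i - int l)) (int y) * rqfac (int M + int y + (eps b i - int l))))))
      = (\<Sum>y\<le>2 * l + Suc j + 1. \<Sum>x\<le>l. \<Sum>y'\<le>2 * x + j + 1.
        rqfac (int L - int l) * (q powi (int l * int l + eps a i * int l) * (rqfac (int l - int x) * hch k a b j x y' *
       (rqfac (int M) * (q powi (int y * int y + (eps b i - int l) * int y) *
        qbinom q ((int y' - int x + eps b (i + 1)) - (eps b i - int l)) (int y) * rqfac (int M + int y + (eps b i - int l)))))))"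
      unfolding sum_distrib_left sw ..
  qed
  also have "\<dots> = rqfac (int M) * (\<Sum>l\<le>L. \<Sum>y\<le>2 * l + Suc j + 1.
     rqfac (int L - int l) * hch k a b (Suc j) l y * rqfac (int M + int y - int l + eps b i))"
    unfolding sum_distrib_left
  proof (rule sum.cong[OF refl], rule sum.cong[OF refl])
    fix l y :: nat
    have e: "(int y' - int x + eps b (i + 1)) - (eps b i - int l) = int l - int x + int y' + dd b i" for x y' by (simp add: dd_def)
    have e': "int M + int y + (eps b i - int l) = int M + int y - int l + eps b i" by simp
    show "(\<Sum>x\<le>l. \<Sum>y'\<le>2 * x + j + 1.
        rqfac (int L - int l) * (q powi (int l * int l + eps a i * int l) * (rqfac (int l - int x) * hch k a b j x y' *
       (rqfac (int M) * (q powi (int y * int y + (eps b i - int l) * int y) *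
        qbinom q ((int y' - int x + eps b (i + 1)) - (eps b i - int l)) (int y) * rqfac (int M + int y + (eps b i - int l)))))))
      = rqfac (int M) * (rqfac (int L - int l) * hch k a b (Suc j) l y * rqfac (int M + int y - int l + eps b i))"
      unfolding hch.simps hw_split i_def[symmetric] e e' sum_distrib_left sum_distrib_right
      by (simp only: mult_ac)
  qed
  finally show ?case by (simp add: i_def)
qed

text \<open>The upper entry of the q-binomial is at most 2x plus one for each level, the ones coming
  from the Kronecker delta.\<close>

lemma hch_eq_0:
  assumes "y > 2 * x + j + 1"
  shows "hch k a b j x y = 0"
proof (cases j)
  case 0
  have "qbinom q (2 * int x + dd b k) (int y) = 0"
    using assms dd_bounds[of b k] by (simp add: qbinom_def 0)
  then show ?thesis by (simp add: 0)
next
  case (Suc j')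
  have "qbinom q (int x - int x' + int y' + dd b (k - Suc j')) (int y) = 0" if "x' \<le> x" "y' \<le> 2 * x' + j' + 1" for x' y'
    using assms dd_bounds[of b "k - Suc j'"] that by (simp add: qbinom_def Suc)
  then show ?thesis by (simp add: Suc)
qed

end

section \<open>Limits\<close>

text \<open>Lebesgue's theorem for the counting measure; absolute summability identifies
  \<open>infsum\<close> with the integral.\<close>

lemma infsum_dominated_convergence:
  fixes f :: "nat \<Rightarrow> 'a \<Rightarrow> complex"
  assumes h: "h summable_on A"
    and bound: "\<And>n x. x \<in> A \<Longrightarrow> norm (f n x) \<le> h x"
    and lim: "\<And>x. x \<in> A \<Longrightarrow> (\<lambda>n. f n x) \<longlonglongrightarrow> g x"
  shows "(\<lambda>n. infsum (f n) A) \<longlonglongrightarrow> infsum g A"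
proof -
  have h0: "h x \<ge> 0" if "x \<in> A" for x
    using bound[OF that, of 0] norm_ge_zero order_trans by blast
  have hs: "(\<lambda>x. norm (h x)) summable_on A"
    using h by (rule summable_on_cong[THEN iffD1, rotated]) (use h0 in auto)
  have g_bound: "norm (g x) \<le> h x" if "x \<in> A" for x
    using lim[OF that] bound[OF that] by (intro LIMSEQ_le_const2[OF tendsto_norm]) auto
  have fs: "(\<lambda>x. norm (f n x)) summable_on A" for n
    by (rule Infinite_Sum.abs_summable_on_comparison_test[OF hs]) (use bound h0 in auto)
  have gs: "(\<lambda>x. norm (g x)) summable_on A"
    by (rule Infinite_Sum.abs_summable_on_comparison_test[OF hs]) (use g_bound h0 in auto)
  have int_h: "integrable (count_space A) h"
    using hs unfolding abs_summable_equivalent abs_summable_on_def .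
  have "(\<lambda>n. integral\<^sup>L (count_space A) (f n)) \<longlonglongrightarrow> integral\<^sup>L (count_space A) g"
    by (rule integral_dominated_convergence[OF _ _ int_h]) (use lim bound in \<open>auto simp: AE_count_space\<close>)
  moreover have "integral\<^sup>L (count_space A) (f n) = infsum (f n) A" for n
    using infsetsum_infsum[of "f n" A] fs[of n] unfolding abs_summable_equivalent infsetsum_def by simp
  moreover have "integral\<^sup>L (count_space A) g = infsum g A"
    using infsetsum_infsum[of g A] gs unfolding abs_summable_equivalent infsetsum_def by simp
  ultimately show ?thesis by simp
qed

section \<open>Limits and uniform bounds of q-factorials and kernels\<close>

lemma convergent_prod_qpoch:
  fixes a p :: complex
  assumes "norm p < 1"
  shows "convergent_prod (\<lambda>j. 1 - a * p ^ j)"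
proof (rule abs_convergent_prod_imp_convergent_prod)
  have "summable (\<lambda>j. norm a * norm p ^ j)"
    using assms by (intro summable_mult summable_geometric) auto
  then show "abs_convergent_prod (\<lambda>j. 1 - a * p ^ j)"
    by (simp add: abs_convergent_prod_conv_summable norm_mult norm_power)
qed

lemma qpoch_LIMSEQ:
  assumes "norm p < 1"
  shows "(\<lambda>n. qpoch a p n) \<longlonglongrightarrow> qpoch_inf a p"
proof -
  have "(\<lambda>n. \<Prod>i\<le>n. 1 - a * p ^ i) \<longlonglongrightarrow> qpoch_inf a p"
    unfolding qpoch_inf_def by (rule convergent_prod_LIMSEQ[OF convergent_prod_qpoch[OF assms]])
  then have "(\<lambda>n. qpoch a p (Suc n)) \<longlonglongrightarrow> qpoch_inf a p"
    by (simp add: qpoch_def lessThan_Suc_atMost)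
  then show ?thesis by (rule LIMSEQ_imp_Suc)
qed

lemma filterlim_nat_int_offset: "filterlim (\<lambda>n. nat (int n + c)) sequentially sequentially"
  unfolding filterlim_at_top
proof
  fix Z
  show "\<forall>\<^sub>F n in sequentially. Z \<le> nat (int n + c)"
    using eventually_ge_at_top[of "nat (int Z + \<bar>c\<bar>)"] by eventually_elim linarith
qed

context qser
begin

definition qinf :: complex where "qinf = qpoch_inf q q"

lemma qinf_nonzero: "qinf \<noteq> 0"
proof -
  have "q * q ^ j \<noteq> 1" for j
    using powi_neq_1[of "int (Suc j)"] by (simp del: of_nat_Suc)
  then show ?thesis unfolding qinf_def qpoch_inf_def
    by (intro prodinf_nonzero convergent_prod_qpoch norm_q_less_1) auto
qed

lemma qfac_LIMSEQ: "(\<lambda>n. qfac (int n + c)) \<longlonglongrightarrow> qinf"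
  unfolding qfac_def qinf_def
  by (rule filterlim_compose[OF qpoch_LIMSEQ[OF norm_q_less_1] filterlim_nat_int_offset])

lemma rqfac_LIMSEQ: "(\<lambda>n. rqfac (int n + c)) \<longlonglongrightarrow> 1 / qinf"
proof -
  have "(\<lambda>n. 1 / qfac (int n + c)) \<longlonglongrightarrow> 1 / qinf"
    by (intro tendsto_intros qfac_LIMSEQ qinf_nonzero)
  moreover have "\<forall>\<^sub>F n in sequentially. 1 / qfac (int n + c) = rqfac (int n + c)"
    using eventually_ge_at_top[of "nat \<bar>c\<bar>"] by eventually_elim (auto simp: rqfac_def)
  ultimately show ?thesis by (rule Lim_transform_eventually)
qed

lemma qfac_bounded: "\<exists>C>0. \<forall>n. norm (qfac n) \<le> C"
proof -
  have "Bseq (\<lambda>n. qfac (int n + 0))"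
    using qfac_LIMSEQ by (rule convergent_imp_Bseq[OF convergentI])
  then obtain C where C: "C > 0" "\<And>n. norm (qfac (int n + 0)) \<le> C"
    by (auto simp: Bseq_def)
  have "norm (qfac n) \<le> C" for n
    using C(2)[of "nat n"] by (cases "n \<ge> 0") (auto simp: qfac_def)
  then show ?thesis using C(1) by blast
qed

lemma rqfac_bounded: "\<exists>C>0. \<forall>n. norm (rqfac n) \<le> C"
proof -
  have "Bseq (\<lambda>n. rqfac (int n + 0))"
    using rqfac_LIMSEQ by (rule convergent_imp_Bseq[OF convergentI])
  then obtain C where C: "C > 0" "\<And>n. norm (rqfac (int n + 0)) \<le> C"
    by (auto simp: Bseq_def)
  have "norm (rqfac n) \<le> C" for n
    using C(1) C(2)[of "nat n"] by (cases "n \<ge> 0") auto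
  then show ?thesis using C(1) by blast
qed

text \<open>One bound for all q-factorials and their reciprocals, available because both sequences
  converge; it supplies the dominating functions below.\<close>

definition qbd :: real where
  "qbd = (SOME C. C > 0 \<and> (\<forall>n. norm (qfac n) \<le> C) \<and> (\<forall>n. norm (rqfac n) \<le> C))"

lemma qbd: "qbd > 0" "norm (qfac n) \<le> qbd" "norm (rqfac n) \<le> qbd"
proof -
  obtain C D where "C > 0" "\<forall>n. norm (qfac n) \<le> C" "D > 0" "\<forall>n. norm (rqfac n) \<le> D"
    using qfac_bounded rqfac_bounded by blast
  then have "\<exists>C. C > 0 \<and> (\<forall>n. norm (qfac n) \<le> C) \<and> (\<forall>n. norm (rqfac n) \<le> C)"
    by (intro exI[of _ "max C D"]) (auto simp: le_max_iff_disj)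
  from someI_ex[OF this, folded qbd_def] show "qbd > 0" "norm (qfac n) \<le> qbd" "norm (rqfac n) \<le> qbd"
    by auto
qed

lemma bker_bound: "norm (bker x y k1 k2 k3) \<le> qbd ^ 7"
proof -
  have "norm (bker x y k1 k2 k3) \<le> qbd * (qbd * qbd * qbd * (qbd * qbd * qbd))"
    unfolding bker_def norm_mult by (intro mult_mono qbd mult_nonneg_nonneg norm_ge_zero less_imp_le[OF qbd(1)])
  then show ?thesis by (simp add: eval_nat_numeral mult_ac)
qed

lemma qbinom_bound: "norm (qbinom q n m) \<le> qbd ^ 3"
proof -
  have "norm (qbinom q n m) \<le> qbd * qbd * qbd"
    unfolding qbinom_eq norm_mult by (intro mult_mono qbd mult_nonneg_nonneg norm_ge_zero less_imp_le[OF qbd(1)])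
  then show ?thesis by (simp add: eval_nat_numeral mult_ac)
qed

text \<open>One factor (q;q)_inf against six reciprocals, whatever the parameters.\<close>

lemma bker_LIMSEQ: "(\<lambda>n. bker (int n) (int n + w) k1 k2 k3) \<longlonglongrightarrow> 1 / qinf ^ 5"
proof -
  have 1: "(\<lambda>n. rqfac (int n + w - c)) \<longlonglongrightarrow> 1 / qinf" for c
    using rqfac_LIMSEQ[of "w - c"] by (simp add: algebra_simps)
  have "filterlim (\<lambda>n::nat. 2 * n) sequentially sequentially"
    by (rule mult_nat_left_at_top) simp
  from filterlim_compose[OF qfac_LIMSEQ[of w] this]
  have 2: "(\<lambda>n. qfac (int n + (int n + w))) \<longlonglongrightarrow> qinf"
    by (simp add: algebra_simps)
  have "(\<lambda>n. bker (int n) (int n + w) k1 k2 k3) \<longlonglongrightarrow> qinf * (1 / qinf * (1 / qinf) * (1 / qinf) * (1 / qinf * (1 / qinf) * (1 / qinf)))"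
    unfolding bker_def by (intro tendsto_mult 1 2 rqfac_LIMSEQ)
  then show ?thesis using qinf_nonzero by (simp add: eval_nat_numeral field_simps)
qed

text \<open>The weights alone are absolutely summable, since a complex sum in the sense of
  \<open>has_sum\<close> always is; uniformly bounded kernels are therefore dominated by
  them.\<close>

lemma lsum_LIMSEQ:
  assumes S: "\<And>L. lsum E (\<lambda>x y z. \<phi> x y z * D x y z L) (S L)"
    and W: "lsum E \<phi> W"
    and D: "\<And>x y z L. norm (D x y z L) \<le> C" "\<And>x y z. (\<lambda>L. D x y z L) \<longlonglongrightarrow> d"
  shows "S \<longlonglongrightarrow> d * W"
proof -
  let ?w = "\<lambda>(x, y). gw E x y * \<phi> x y (- x - y)"
  have w: "(?w has_sum W) UNIV" using W by (simp add: lsum_def)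
  then have "(\<lambda>p. norm (?w p)) summable_on UNIV"
    using has_sum_imp_summable summable_on_iff_abs_summable_on_complex by blast
  then have "(\<lambda>p. norm (?w p) * C) summable_on UNIV"
    by (rule summable_on_cmult_left)
  then have "(\<lambda>L. infsum (\<lambda>p. ?w p * D (fst p) (snd p) (- fst p - snd p) L) UNIV) \<longlonglongrightarrow> infsum (\<lambda>p. ?w p * d) UNIV"
    by (rule infsum_dominated_convergence) (auto simp: norm_mult intro!: mult_left_mono D tendsto_intros)
  also have "infsum (\<lambda>p. ?w p * d) UNIV = d * W"
    using has_sum_cmult_left[OF w, of d] by (simp add: infsumI mult.commute)
  also have "(\<lambda>L. infsum (\<lambda>p. ?w p * D (fst p) (snd p) (- fst p - snd p) L) UNIV) = S"
  proof
    fix L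
    have "((\<lambda>p. ?w p * D (fst p) (snd p) (- fst p - snd p) L) has_sum S L) UNIV"
      using S[of L] by (simp add: lsum_def case_prod_unfold mult.assoc)
    then show "infsum (\<lambda>p. ?w p * D (fst p) (snd p) (- fst p - snd p) L) UNIV = S L"
      by (rule infsumI)
  qed
  finally show ?thesis .
qed

end

section \<open>The Jacobi triple product and the A2 Macdonald identity\<close>

lemma gauss_summable:
  fixes r y :: real
  assumes "0 < r" "r < 1" "y > 0"
  shows "summable (\<lambda>n. r ^ (n * (n - 1) div 2) * y ^ n)"
proof -
  have "(\<lambda>n. r ^ n * y) \<longlonglongrightarrow> 0 * y"
    using assms by (intro tendsto_intros LIMSEQ_power_zero) auto
  then have "\<forall>\<^sub>F n in sequentially. r ^ n * y < 1 / 2"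
    by (rule order_tendstoD) auto
  then obtain N where N: "\<And>n. n \<ge> N \<Longrightarrow> r ^ n * y < 1 / 2"
    by (auto simp: eventually_sequentially)
  show ?thesis
  proof (rule summable_ratio_test[of "1/2" N])
    fix n assume "n \<ge> N"
    have "Suc n * (Suc n - 1) div 2 = n * (n - 1) div 2 + n"
      by (cases n) (auto simp: algebra_simps)
    then have "r ^ (Suc n * (Suc n - 1) div 2) * y ^ Suc n = (r ^ n * y) * (r ^ (n * (n - 1) div 2) * y ^ n)"
      by (simp add: power_add mult_ac)
    also have "\<dots> \<le> 1 / 2 * (r ^ (n * (n - 1) div 2) * y ^ n)"
      using N[OF \<open>n \<ge> N\<close>] assms by (intro mult_right_mono) auto
    finally show "norm (r ^ (Suc n * (Suc n - 1) div 2) * y ^ Suc n) \<le> 1 / 2 * norm (r ^ (n * (n - 1) div 2) * y ^ n)"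
      using assms by simp
  qed auto
qed

lemma has_sum_prod_complex:
  fixes f :: "'a \<Rightarrow> complex" and g :: "'b \<Rightarrow> complex"
  assumes f: "(f has_sum S) A" and g: "(g has_sum T) B"
  shows "((\<lambda>(x, y). f x * g y) has_sum (S * T)) (A \<times> B)"
proof (rule has_sum_SigmaI)
  show "((\<lambda>y. case (x, y) of (x, y) \<Rightarrow> f x * g y) has_sum f x * T) B" for x
    using has_sum_cmult_right[OF g] by simp
  show "((\<lambda>x. f x * T) has_sum S * T) A"
    by (rule has_sum_cmult_left[OF f])
  have fa: "(\<lambda>x. norm (f x)) summable_on A" and ga: "(\<lambda>x. norm (g x)) summable_on B"
    using f g has_sum_imp_summable summable_on_iff_abs_summable_on_complex by blast+
  have "(\<lambda>p. norm (case p of (x, y) \<Rightarrow> f x * g y)) summable_on A \<times> B"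
    unfolding Infinite_Sum.abs_summable_on_Sigma_iff
  proof (intro conjI ballI)
    fix x
    show "(\<lambda>y. norm (case (x, y) of (x, y) \<Rightarrow> f x * g y)) summable_on B"
      using summable_on_cmult_right[OF ga, of "norm (f x)"] by (simp add: norm_mult)
  next
    show "(\<lambda>x. norm (\<Sum>\<^sub>\<infinity>y\<in>B. norm (case (x, y) of (x, y) \<Rightarrow> f x * g y))) summable_on A"
      using summable_on_cmult_left[OF fa, of "\<bar>infsum (\<lambda>y. norm (g y)) B\<bar>"]
      by (simp add: norm_mult infsum_cmult_right' abs_mult)
  qed
  then show "(\<lambda>(x, y). f x * g y) summable_on A \<times> B"
    by (rule Infinite_Sum.abs_summable_summable)
qed

lemma bij_add_int: "bij (\<lambda>x. x + (c::int))"
  by (rule bij_betw_byWitness[where f'="\<lambda>x. x - c"]) auto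

context qser
begin

definition tsg :: "int \<Rightarrow> complex" where
  "tsg n = (-1) powi n * q powi (n * (n - 1) div 2)"

lemma tsg_pred: "tsg n = - (q powi (n - 1)) * tsg (n - 1)"
  unfolding tsg_def tri_pred[of n] powi_add esign_pred[of n] by (simp add: mult_ac)

lemma qbin_rec1: "qbin (Suc n) j = qbin n j + q powi (int n + 1 - j) * qbin n (j - 1)"
proof -
  have 0: "1 - q powi (int n + 1) = (1 - q powi (int n + 1 - j)) + q powi (int n + 1 - j) * (1 - q powi j)"
    by (simp add: algebra_simps flip: powi_add)
  have 1: "(1 - q powi j) * rqfac j = rqfac (j - 1)"
    by (simp add: rqfac_pred)
  have 2: "(1 - q powi (int n + 1 - j)) * rqfac (int n + 1 - j) = rqfac (int n - j)"
    using rqfac_pred[of "int n + 1 - j"] by simp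
  have "qbin (Suc n) j = qfac (int n) * (rqfac j * ((1 - q powi (int n + 1 - j)) * rqfac (int n + 1 - j))
     + q powi (int n + 1 - j) * ((1 - q powi j) * rqfac j) * rqfac (int n + 1 - j))"
    unfolding qbin_def qfac_Suc 0 by (simp add: algebra_simps)
  then show ?thesis unfolding 1 2 by (simp add: qbin_def algebra_simps)
qed

lemma qbin_sym: "qbin n (int n - j) = qbin n j"
  by (simp add: qbin_def)

lemma qbin_rec2: "qbin (Suc n) j = qbin n (j - 1) + q powi j * qbin n j"
proof -
  have "qbin (Suc n) j = qbin (Suc n) (int (Suc n) - j)" by (simp only: qbin_sym)
  also have "\<dots> = qbin n (int (Suc n) - j) + q powi j * qbin n (int n - j)"
    unfolding qbin_rec1 by simp
  also have "qbin n (int (Suc n) - j) = qbin n (j - 1)"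
    using qbin_sym[of n "j - 1"] by (simp add: algebra_simps)
  finally show ?thesis by (simp only: qbin_sym)
qed

text \<open>Finite form of the Jacobi triple product. With m = 0 it is the q-binomial theorem;
  raising n and raising m correspond to the two q-Pascal rules \<open>qbin_rec1\<close> and
  \<open>qbin_rec2\<close>.\<close>

lemma finite_triple_product:
  assumes "x \<noteq> 0"
  shows "((\<lambda>k. tsg k * x powi k * qbin (n + m) (int m + k)) has_sum qpoch x q n * qpoch (q / x) q m) UNIV"
proof (induction m)
  case 0
  show ?case
  proof (induction n)
    case 0
    have "((\<lambda>k. tsg k * x powi k * qbin (0 + 0) (int 0 + k)) has_sum (\<Sum>k\<in>{0}. tsg k * x powi k * qbin (0 + 0) (int 0 + k))) UNIV"
    proof (rule has_sum_finite_neutralI)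
      fix k :: int assume "k \<in> UNIV - {0}"
      then show "tsg k * x powi k * qbin (0 + 0) (int 0 + k) = 0"
        by (cases k "0::int" rule: linorder_cases) (auto simp: qbin_def)
    qed auto
    then show ?case by (simp add: qpoch_def tsg_def qbin_def)
  next
    case (Suc n)
    have sh: "((\<lambda>k. tsg (k - 1) * x powi (k - 1) * qbin (n + 0) (int 0 + (k - 1))) has_sum qpoch x q n * qpoch (q / x) q 0) UNIV"
      using has_sum_bij_UNIV[OF bij_add_int[of "-1"], of "\<lambda>k. tsg k * x powi k * qbin (n + 0) (int 0 + k)"] Suc.IH by simp
    have "((\<lambda>k. tsg k * x powi k * qbin (n + 0) (int 0 + k) - (x * q ^ n) * (tsg (k - 1) * x powi (k - 1) * qbin (n + 0) (int 0 + (k - 1))))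
       has_sum (qpoch x q n * qpoch (q / x) q 0 - (x * q ^ n) * (qpoch x q n * qpoch (q / x) q 0))) UNIV"
      by (intro has_sum_diff_complex has_sum_cmult_right sh Suc.IH)
    moreover have "tsg k * x powi k * qbin (n + 0) (int 0 + k) - (x * q ^ n) * (tsg (k - 1) * x powi (k - 1) * qbin (n + 0) (int 0 + (k - 1)))
      = tsg k * x powi k * qbin (Suc n + 0) (int 0 + k)" for k
    proof -
      have a: "x * x powi (k - 1) = x powi k"
        using assms power_int_add[of x 1 "k - 1"] by simp
      have b: "q powi (int n + 1 - k) * q powi (k - 1) = q ^ n"
        by (simp flip: powi_add)
      have "tsg k * x powi k * qbin (Suc n) k = tsg k * x powi k * qbin n k - (q powi (int n + 1 - k) * q powi (k - 1)) * (tsg (k - 1) * x powi k * qbin n (k - 1))"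
        unfolding qbin_rec1 distrib_left unfolding tsg_pred[of k] by (simp add: mult_ac)
      then show ?thesis unfolding b a[symmetric] by (simp add: mult_ac)
    qed
    moreover have "qpoch x q n * qpoch (q / x) q 0 - (x * q ^ n) * (qpoch x q n * qpoch (q / x) q 0) = qpoch x q (Suc n) * qpoch (q / x) q 0"
      by (simp add: qpoch_def algebra_simps)
    ultimately show ?case by simp
  qed
next
  case (Suc m)
  have sh: "((\<lambda>k. tsg (k + 1) * x powi (k + 1) * qbin (n + m) (int m + (k + 1))) has_sum qpoch x q n * qpoch (q / x) q m) UNIV"
    using has_sum_bij_UNIV[OF bij_add_int[of "1"], of "\<lambda>k. tsg k * x powi k * qbin (n + m) (int m + k)"] Suc.IH by simp
  have "((\<lambda>k. tsg k * x powi k * qbin (n + m) (int m + k) - (q / x * q ^ m) * (tsg (k + 1) * x powi (k + 1) * qbin (n + m) (int m + (k + 1))))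
       has_sum (qpoch x q n * qpoch (q / x) q m - (q / x * q ^ m) * (qpoch x q n * qpoch (q / x) q m))) UNIV"
    by (intro has_sum_diff_complex has_sum_cmult_right sh Suc.IH)
  moreover have "tsg k * x powi k * qbin (n + m) (int m + k) - (q / x * q ^ m) * (tsg (k + 1) * x powi (k + 1) * qbin (n + m) (int m + (k + 1)))
      = tsg k * x powi k * qbin (n + Suc m) (int (Suc m) + k)" for k
  proof -
    have a: "x powi (k + 1) / x = x powi k"
      using assms power_int_add[of x k 1] by simp
    have b: "q powi (int (Suc m) + k) = q * q ^ m * q powi k"
      using powi_add[of "int (Suc m)" k] by (simp del: of_nat_Suc)
    have c: "tsg (k + 1) = - (q powi k) * tsg k" using tsg_pred[of "k + 1"] by simp
    have "qbin (n + Suc m) (int (Suc m) + k) = qbin (n + m) (int m + k) + q * q ^ m * q powi k * qbin (n + m) (int m + (k + 1))"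
      using qbin_rec2[of "n + m" "int (Suc m) + k"] unfolding b by (simp add: add_ac)
    then show ?thesis
      unfolding a[symmetric] c by (simp add: algebra_simps)
  qed
  moreover have "qpoch x q n * qpoch (q / x) q m - (q / x * q ^ m) * (qpoch x q n * qpoch (q / x) q m) = qpoch x q n * qpoch (q / x) q (Suc m)"
    by (simp add: qpoch_def algebra_simps)
  ultimately show ?case by simp
qed

lemma tsg_summable:
  assumes "x \<noteq> 0"
  shows "(\<lambda>k. norm (tsg k * x powi k)) summable_on UNIV"
proof -
  let ?f = "\<lambda>k. norm (tsg k * x powi k)"
  have nf: "?f k = norm q powi (k * (k - 1) div 2) * norm x powi k" for k
    by (simp add: tsg_def norm_mult norm_power_int)
  have nq: "0 < norm q" using q_nonzero by simp
  have nx: "0 < norm x" using assms by simp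
  have 1: "(\<lambda>n. ?f (int n)) summable_on UNIV"
  proof -
    have "?f (int n) = norm q ^ (n * (n - 1) div 2) * norm x ^ n" for n
    proof -
      have "int n * (int n - 1) div 2 = int (n * (n - 1) div 2)"
        by (cases n) (auto simp: zdiv_int algebra_simps)
      then show ?thesis unfolding nf by simp
    qed
    then show ?thesis
      using gauss_summable[OF nq norm_q_less_1 nx] by (simp add: summable_nonneg_imp_summable_on)
  qed
  have 2: "(\<lambda>n. ?f (- 1 - int n)) summable_on UNIV"
  proof -
    \<comment> \<open>The negative half is again a Gaussian series, now with |q|^2 / |x| in place of
      |x|.\<close>
    have "?f (- 1 - int n) = (norm q / norm x) * (norm q ^ (n * (n - 1) div 2) * (norm q * norm q / norm x) ^ n)" for n
    proof -
      have "2 * ((- 1 - int n) * (- 1 - int n - 1) div 2) = 2 * (int (n * (n - 1) div 2) + (2 * int n + 1))"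
      proof -
        have "2 * int (n * (n - 1) div 2) = int n * (int n - 1)"
          by (cases n) (auto simp: zdiv_int algebra_simps)
        then show ?thesis unfolding double_tri distrib_left by (simp add: algebra_simps)
      qed
      then have e: "(- 1 - int n) * (- 1 - int n - 1) div 2 = int (n * (n - 1) div 2) + (2 * int n + 1)" by simp
      have "norm q powi (int (n * (n - 1) div 2) + (2 * int n + 1)) = norm q ^ (n * (n - 1) div 2) * ((norm q * norm q) ^ n * norm q)"
      proof -
        have "norm q powi (2 * int n + 1) = (norm q * norm q) ^ n * norm q"
          using nq by (simp add: power_int_add power_int_mult power2_eq_square)
        then show ?thesis
          using nq power_int_add[of "norm q" "int (n * (n - 1) div 2)" "2 * int n + 1"] by simp
      qed
      moreover have "norm x powi (- 1 - int n) = inverse (norm x) * inverse (norm x ^ n)"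
        using nx power_int_diff[of "norm x" "-1" "int n"] by (simp add: power_int_minus field_simps)
      ultimately show ?thesis unfolding nf e by (simp add: field_simps power_divide power_mult_distrib)
    qed
    moreover have "summable (\<lambda>n. norm q ^ (n * (n - 1) div 2) * (norm q * norm q / norm x) ^ n)"
      using nq nx by (intro gauss_summable norm_q_less_1) auto
    ultimately show ?thesis
      by (simp add: summable_nonneg_imp_summable_on summable_on_cmult_right)
  qed
  have "bij_betw int UNIV {0..}"
    by (rule bij_betw_byWitness[where f'=nat]) auto
  with 1 have A: "?f summable_on {0..}"
    using summable_on_reindex_bij_betw[of int UNIV "{0..}" ?f] by simp
  have "bij_betw (\<lambda>n. - 1 - int n) UNIV {..<0}"
    by (rule bij_betw_byWitness[where f'="\<lambda>k. nat (- 1 - k)"]) auto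
  with 2 have B: "?f summable_on {..<0}"
    using summable_on_reindex_bij_betw[of "\<lambda>n. - 1 - int n" UNIV "{..<0}" ?f] by simp
  have "{0..} \<union> {..<0::int} = UNIV" by auto
  moreover have "{0..} \<inter> {..<0::int} = {}" by auto
  ultimately show ?thesis using summable_on_Un_disjoint[OF A B] by (simp only:)
qed

theorem jacobi_triple_product:
  assumes "x \<noteq> 0"
  shows "((\<lambda>k. tsg k * x powi k) has_sum (qinf * qtheta x q)) UNIV"
proof -
  let ?w = "\<lambda>k. tsg k * x powi k"
  have fa: "(\<lambda>k. norm (?w k)) summable_on UNIV" by (rule tsg_summable[OF assms])
  then have sm: "?w summable_on UNIV" by (rule Infinite_Sum.abs_summable_summable)
  have "(\<lambda>k. norm (?w k) * qbd ^ 3) summable_on UNIV"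
    by (rule summable_on_cmult_left[OF fa])
  then have "(\<lambda>n. infsum (\<lambda>k. ?w k * qbin (n + n) (int n + k)) UNIV) \<longlonglongrightarrow> infsum (\<lambda>k. ?w k * (1 / qinf)) UNIV"
  proof (rule infsum_dominated_convergence)
    fix n k
    have "norm (qbin (n + n) (int n + k)) \<le> qbd ^ 3"
      using qbinom_bound[of "int (n + n)" "int n + k"] by (simp add: qbinom_eq qbin_def)
    then show "norm (?w k * qbin (n + n) (int n + k)) \<le> norm (?w k) * qbd ^ 3"
      unfolding norm_mult[of "?w k"] by (intro mult_left_mono) auto
  next
    fix k
    have "filterlim (\<lambda>n::nat. 2 * n) sequentially sequentially"
      by (rule mult_nat_left_at_top) simp
    from filterlim_compose[OF qfac_LIMSEQ[of 0] this]
    have 1: "(\<lambda>n. qfac (int (n + n))) \<longlonglongrightarrow> qinf"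
      by (simp add: algebra_simps)
    have 2: "(\<lambda>n. rqfac (int (n + n) - (int n + k))) \<longlonglongrightarrow> 1 / qinf"
      using rqfac_LIMSEQ[of "- k"] by (simp add: algebra_simps)
    have "(\<lambda>n. qbin (n + n) (int n + k)) \<longlonglongrightarrow> qinf * (1 / qinf) * (1 / qinf)"
      unfolding qbin_def by (intro tendsto_mult 1 2 rqfac_LIMSEQ)
    then have "(\<lambda>n. qbin (n + n) (int n + k)) \<longlonglongrightarrow> 1 / qinf"
      using qinf_nonzero by simp
    then show "(\<lambda>n. ?w k * qbin (n + n) (int n + k)) \<longlonglongrightarrow> ?w k * (1 / qinf)"
      by (intro tendsto_intros)
  qed
  moreover have "infsum (\<lambda>k. ?w k * qbin (n + n) (int n + k)) UNIV = qpoch x q n * qpoch (q / x) q n" for n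
    by (rule infsumI[OF finite_triple_product[OF assms]])
  moreover have "(\<lambda>n. qpoch x q n * qpoch (q / x) q n) \<longlonglongrightarrow> qtheta x q"
    unfolding qtheta_def by (intro tendsto_mult qpoch_LIMSEQ norm_q_less_1)
  ultimately have "infsum (\<lambda>k. ?w k * (1 / qinf)) UNIV = qtheta x q"
    by (metis (no_types, lifting) LIMSEQ_unique ext)
  then have "infsum ?w UNIV * (1 / qinf) = qtheta x q"
    by (simp only: infsum_cmult_left')
  then have "infsum ?w UNIV = qinf * qtheta x q"
    using qinf_nonzero by (simp add: field_simps)
  then show ?thesis using sm by (metis has_sum_infsum)
qed

section \<open>Pentagonal series and the coefficients of the theta product\<close>

lemma neg1_powi_add: "(-1 :: complex) powi (i + j) = (-1) powi i * (-1) powi j"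
  by (simp add: power_int_add)

lemma pent_double: "2 * (c * (3 * c + 1) div 2) = c * (3 * c + (1::int))"
  by simp

lemma pent_add: "(c + s) * (3 * (c + s) + 1) div 2 = c * (3 * c + 1) div 2 + s * (3 * s + 1) div 2 + 3 * c * (s::int)"
proof -
  have "u = v + w + 3 * c * s"
    if "2 * u = (c + s) * (3 * (c + s) + 1)" "2 * v = c * (3 * c + 1)" "2 * w = s * (3 * s + 1)" for u v w :: int
  proof -
    have "2 * u = 2 * (v + w + 3 * c * s)" using that by (simp add: algebra_simps)
    then show ?thesis by simp
  qed
  from this[OF pent_double pent_double pent_double] show ?thesis .
qed

lemma qpoch_trisect: "qpoch q q (3 * n) = qpoch (q ^ 3) (q ^ 3) n * (qpoch (q ^ 2) (q ^ 3) n * qpoch q (q ^ 3) n)"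
proof (induction n)
  case (Suc n)
  have e: "3 * Suc n = Suc (Suc (Suc (3 * n)))" by simp
  have p: "q * q ^ (3 * n) = q * (q ^ 3) ^ n" "q * q ^ Suc (3 * n) = q ^ 2 * (q ^ 3) ^ n" "q * q ^ Suc (Suc (3 * n)) = q ^ 3 * (q ^ 3) ^ n"
    by (simp_all add: power_mult power2_eq_square power3_eq_cube)
  have "qpoch q q (3 * Suc n) = qpoch q q (3 * n) * (1 - q * (q ^ 3) ^ n) * (1 - q ^ 2 * (q ^ 3) ^ n) * (1 - q ^ 3 * (q ^ 3) ^ n)"
    unfolding e qpoch_def prod.lessThan_Suc p by simp
  then show ?case unfolding Suc.IH by (simp only: qpoch_def prod.lessThan_Suc mult_ac)
qed (simp add: qpoch_def)

lemma qinf_trisect: "qpoch_inf (q ^ 3) (q ^ 3) * (qpoch_inf (q ^ 2) (q ^ 3) * qpoch_inf q (q ^ 3)) = qinf"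
proof (rule LIMSEQ_unique)
  have n3: "norm (q ^ 3) < 1"
    using norm_q_less_1 by (simp add: norm_power power_less_one_iff)
  show "(\<lambda>n. qpoch q q (3 * n)) \<longlonglongrightarrow> qpoch_inf (q ^ 3) (q ^ 3) * (qpoch_inf (q ^ 2) (q ^ 3) * qpoch_inf q (q ^ 3))"
    unfolding qpoch_trisect by (intro tendsto_mult qpoch_LIMSEQ n3)
  have "filterlim (\<lambda>n::nat. 3 * n) sequentially sequentially"
    by (rule mult_nat_left_at_top) simp
  then show "(\<lambda>n. qpoch q q (3 * n)) \<longlonglongrightarrow> qinf"
    unfolding qinf_def by (rule filterlim_compose[OF qpoch_LIMSEQ[OF norm_q_less_1]])
qed

lemma qtheta_1: "qtheta 1 (q ^ 3) = 0"
proof -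
  have n3: "norm (q ^ 3) < 1"
    using norm_q_less_1 by (simp add: norm_power power_less_one_iff)
  have "(\<lambda>n. qpoch 1 (q ^ 3) (Suc n)) \<longlonglongrightarrow> qpoch_inf 1 (q ^ 3)"
    by (rule LIMSEQ_Suc[OF qpoch_LIMSEQ[OF n3]])
  moreover have "qpoch 1 (q ^ 3) (Suc n) = 0" for n
    unfolding qpoch_def prod.lessThan_Suc_shift by simp
  ultimately have "qpoch_inf 1 (q ^ 3) = 0"
    by (simp add: LIMSEQ_const_iff)
  then show ?thesis by (simp add: qtheta_def)
qed

text \<open>The triple product with base q^3 at x = q^(2-r). For r = 0 and r = 1 the factors are the
  three residue classes of (q;q)_inf, giving Euler's pentagonal number theorem; for r = 2 the theta
  function is taken at its zero 1.\<close>

lemma pentagonal_residue: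
  fixes r :: int
  assumes "0 \<le> r" "r \<le> 2"
  shows "((\<lambda>c. (-1) powi c * q powi (c * (3 * c + 1) div 2 - r * c)) has_sum (if r = 2 then 0 else qinf)) UNIV"
proof -
  have n3: "norm (q ^ 3) < 1"
    using norm_q_less_1 by (simp add: norm_power power_less_one_iff)
  interpret cube: qser "q ^ 3"
    by unfold_locales (use n3 q_nonzero in auto)
  have "((\<lambda>k. cube.tsg k * (q powi (2 - r)) powi k) has_sum cube.qinf * qtheta (q powi (2 - r)) (q ^ 3)) UNIV"
    by (rule cube.jacobi_triple_product) (use q_nonzero in simp)
  moreover have "cube.tsg k * (q powi (2 - r)) powi k = (-1) powi k * q powi (k * (3 * k + 1) div 2 - r * k)" for k
  proof -
    have "2 * u = 2 * (3 * v + (2 - r) * k + r * k)" if "2 * u = k * (3 * k + 1)" "2 * v = k * (k - 1)" for u v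
      using that by (simp add: algebra_simps)
    from this[OF pent_double double_tri]
    have e: "k * (3 * k + 1) div 2 - r * k = 3 * (k * (k - 1) div 2) + (2 - r) * k" by simp
    have "(q ^ 3) powi (k * (k - 1) div 2) = q powi (3 * (k * (k - 1) div 2))"
      using power_int_mult[of q 3 "k * (k - 1) div 2"] by simp
    then show ?thesis unfolding cube.tsg_def e powi_add by (simp add: power_int_mult)
  qed
  moreover have "cube.qinf * qtheta (q powi (2 - r)) (q ^ 3) = (if r = 2 then 0 else qinf)"
  proof -
    consider "r = 0" | "r = 1" | "r = 2" using assms by linarith
    then show ?thesis
    proof cases
      case 1
      have "q ^ 3 / q ^ 2 = q" using q_nonzero by (simp add: eval_nat_numeral)
      then show ?thesis using qinf_trisect 1 by (simp add: cube.qinf_def qtheta_def)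
    next
      case 2
      have "q ^ 3 / q = q ^ 2" using q_nonzero by (simp add: eval_nat_numeral)
      then show ?thesis using qinf_trisect 2 by (simp add: cube.qinf_def qtheta_def mult.commute)
    next
      case 3
      then show ?thesis by (simp add: qtheta_1)
    qed
  qed
  ultimately show ?thesis by simp
qed

text \<open>The coefficient of X^(x+1) Y^(x+y+1) in the product of the theta series in X, Y and XY.
  Its exponent is pentagonal in c; recentring at s with m + n = 3s + r leaves a series depending
  only on the residue r, and r = 2 means x = y modulo 3. This is where \<open>chi3\<close> comes
  from.\<close>

lemma theta_coefficient:
  "((\<lambda>c. tsg (x + 1 - c) * tsg (x + y + 1 - c) * tsg c) has_sum (- chi3 (x - y) * q powi qexp x y * qinf)) UNIV"
proof -
  define m n where mn: "m = x + 1" "n = x + y + 1"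
  define r where "r = 2 - (x - y) mod 3"
  define e where "e = (x - y) div 3"
  define s where "s = x - e"
  have r: "0 \<le> r" "r \<le> 2"
    unfolding r_def using pos_mod_bound[of 3 "x - y"] pos_mod_sign[of 3 "x - y"] by auto
  have d: "x - y = 3 * e + (2 - r)" unfolding r_def e_def by simp
  have j: "m + n = 3 * s + r" using d by (simp add: mn s_def)
  define Z where "Z = (-1) powi (m + n + s) * q powi (m * (m - 1) div 2 + n * (n - 1) div 2 + (s * (3 * s + 1) div 2 - 3 * s * s - r * s))"
  have Z: "tsg (m - (c + s)) * tsg (n - (c + s)) * tsg (c + s) = Z * ((-1) powi c * q powi (c * (3 * c + 1) div 2 - r * c))" for c
  proof -
    define a where "a = c + s"
    have "u + v + w = um + un + p - (m + n) * a"
      if "2 * u = (m - a) * (m - a - 1)" "2 * v = (n - a) * (n - a - 1)" "2 * w = a * (a - 1)"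
         "2 * um = m * (m - 1)" "2 * un = n * (n - 1)" "2 * p = a * (3 * a + 1)" for u v w um un p
    proof -
      have "2 * (u + v + w) = 2 * (um + un + p - (m + n) * a)" using that by (simp add: algebra_simps)
      then show ?thesis by simp
    qed
    from this[OF double_tri double_tri double_tri double_tri double_tri pent_double]
    have E: "(m - a) * (m - a - 1) div 2 + (n - a) * (n - a - 1) div 2 + a * (a - 1) div 2
       = m * (m - 1) div 2 + n * (n - 1) div 2 + a * (3 * a + 1) div 2 - (m + n) * a" .
    have h: "a * (3 * a + 1) div 2 - (m + n) * a = (s * (3 * s + 1) div 2 - 3 * s * s - r * s) + (c * (3 * c + 1) div 2 - r * c)"
      unfolding a_def pent_add j by (simp add: algebra_simps)
    have E': "(m - a) * (m - a - 1) div 2 + (n - a) * (n - a - 1) div 2 + a * (a - 1) div 2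
       = (m * (m - 1) div 2 + n * (n - 1) div 2 + (s * (3 * s + 1) div 2 - 3 * s * s - r * s)) + (c * (3 * c + 1) div 2 - r * c)"
      unfolding E add_diff_eq[symmetric] h by (simp only: add.assoc)
    have sg: "(-1) powi (m - a) * (-1) powi (n - a) * (-1) powi a = ((-1) powi (m + n + s) * (-1) powi c :: complex)"
    proof -
      have "(-1) powi (m - a) * (-1) powi (n - a) * (-1) powi a = ((-1) powi (m + n - a) :: complex)"
        unfolding neg1_powi_add[symmetric] by (rule arg_cong[where f="\<lambda>n. (-1) powi n"]) simp
      also have "\<dots> = (-1) powi (m + n + s + c) * ((-1) powi 2) powi (- a)"
        unfolding power_int_mult[symmetric] neg1_powi_add[symmetric]
        by (rule arg_cong[where f="\<lambda>n. (-1) powi n"]) (simp add: a_def)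
      finally show ?thesis by (simp add: neg1_powi_add)
    qed
    have "tsg (m - a) * tsg (n - a) * tsg a = ((-1) powi (m - a) * (-1) powi (n - a) * (-1) powi a) *
       q powi ((m - a) * (m - a - 1) div 2 + (n - a) * (n - a - 1) div 2 + a * (a - 1) div 2)"
      unfolding tsg_def powi_add by (simp only: mult_ac)
    also have "\<dots> = Z * ((-1) powi c * q powi (c * (3 * c + 1) div 2 - r * c))"
      unfolding sg E' Z_def powi_add by (simp only: mult_ac)
    finally show ?thesis unfolding a_def .
  qed
  have "((\<lambda>c. tsg (m - (c + s)) * tsg (n - (c + s)) * tsg (c + s)) has_sum (Z * (if r = 2 then 0 else qinf))) UNIV"
    unfolding Z by (intro has_sum_cmult_right pentagonal_residue r)
  then have *: "((\<lambda>c. tsg (m - c) * tsg (n - c) * tsg c) has_sum (Z * (if r = 2 then 0 else qinf))) UNIV"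
    using has_sum_bij_UNIV[OF bij_add_int[of s], of "\<lambda>c. tsg (m - c) * tsg (n - c) * tsg c"] by simp
  have "Z * (if r = 2 then 0 else qinf) = - chi3 (x - y) * q powi qexp x y * qinf"
  proof (cases "r = 2")
    case True
    then have "chi3 (x - y) = 0" by (simp add: r_def chi3_def)
    then show ?thesis using True by simp
  next
    case False
    then have r01: "r = 0 \<or> r = 1" using r by auto
    then have chi: "chi3 (x - y) = - ((-1) powi r)" by (auto simp: r_def chi3_def)
    then have nz: "chi3 (x - y) \<noteq> 0" by auto
    have sg: "(-1 :: complex) powi (m + n + s) = (-1) powi r"
    proof -
      have "(-1 :: complex) powi (m + n + s) = (-1) powi r * ((-1) powi 2) powi (2 * s)"
        unfolding power_int_mult[symmetric] neg1_powi_add[symmetric]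
        by (rule arg_cong[where f="\<lambda>n. (-1) powi n"]) (simp add: j)
      then show ?thesis by simp
    qed
    have "u + v + (w - 3 * s * s - r * s) = qexp x y"
      if "2 * u = m * (m - 1)" "2 * v = n * (n - 1)" "2 * w = s * (3 * s + 1)" for u v w
    proof -
      have "6 * (u + v + (w - 3 * s * s - r * s)) = 3 * (2 * u) + 3 * (2 * v) + 3 * (2 * w) - 18 * s * s - 6 * r * s"
        by simp
      also have "\<dots> = 3 * (m * (m - 1)) + 3 * (n * (n - 1)) + 3 * (s * (3 * s + 1)) - 18 * s * s - 6 * r * s"
        unfolding that ..
      also have "y = x - 3 * e - (2 - r)" using d by simp
      then have "3 * (m * (m - 1)) + 3 * (n * (n - 1)) + 3 * (s * (3 * s + 1)) - 18 * s * s - 6 * r * s = 2 * (qform x y - 1)"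
        using r01 by (auto simp: mn s_def qform_def algebra_simps)
      finally show ?thesis using qform_eq_qexp[OF nz] by simp
    qed
    from this[OF double_tri double_tri pent_double]
    have "m * (m - 1) div 2 + n * (n - 1) div 2 + (s * (3 * s + 1) div 2 - 3 * s * s - r * s) = qexp x y" .
    then show ?thesis using False unfolding Z_def sg chi by simp
  qed
  then show ?thesis using * by (simp add: mn)
qed

text \<open>Three triple products, in X, Y and XY, give three factors (q;q)_inf; collecting equal
  monomials returns one of them through \<open>theta_coefficient\<close>, hence the square.\<close>

theorem macdonald_A2:
  assumes X: "X \<noteq> 0" and Y: "Y \<noteq> 0"
  shows "((\<lambda>(x, y). chi3 (x - y) * q powi qexp x y * (X powi x * Y powi (x + y))) has_sum
     (- (qinf ^ 2 * qtheta X q * qtheta Y q * qtheta (X * Y) q) / (X * Y))) UNIV"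
proof -
  let ?F = "\<lambda>(a, b, c). tsg a * X powi a * (tsg b * Y powi b * (tsg c * (X * Y) powi c))"
  \<comment> \<open>Sorts the triple series by total powers X^(a+c) Y^(b+c). The offset 1 recentres
    the monomials at 1/(XY), where the coefficients become antisymmetric.\<close>
  let ?h = "\<lambda>((x, y), c). (x + 1 - c, x + y + 1 - c, c) :: int \<times> int \<times> int"
  define T where "T = (qinf * qtheta X q) * ((qinf * qtheta Y q) * (qinf * qtheta (X * Y) q))"
  have "((\<lambda>(a, p). tsg a * X powi a * (case p of (b, c) \<Rightarrow> tsg b * Y powi b * (tsg c * (X * Y) powi c))) has_sum T) (UNIV \<times> (UNIV \<times> UNIV))"
    unfolding T_def using X Y by (intro has_sum_prod_complex jacobi_triple_product) auto
  then have F: "(?F has_sum T) UNIV"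
    by (simp add: case_prod_unfold)
  have bh: "bij ?h"
    by (rule bij_betw_byWitness[where f'="\<lambda>(a, b, c). ((a + c - 1, b - a), c)"]) auto
  have term_eq: "?F (?h ((x, y), c)) = (X powi (x + 1) * Y powi (x + y + 1)) * (tsg (x + 1 - c) * tsg (x + y + 1 - c) * tsg c)" for x y c
  proof -
    have e: "X powi (x + 1) = X powi (x + 1 - c) * X powi c" "Y powi (x + y + 1) = Y powi (x + y + 1 - c) * Y powi c"
      using X Y by (simp_all flip: power_int_add)
    show ?thesis unfolding e prod.case power_int_mult_distrib by (simp only: mult_ac)
  qed
  have "((\<lambda>p. ?F (?h p)) has_sum T) (UNIV \<times> UNIV)"
    using has_sum_bij_UNIV[OF bh, of ?F] F by simp
  then have "((\<lambda>(x, y). (X powi (x + 1) * Y powi (x + y + 1)) * (- chi3 (x - y) * q powi qexp x y * qinf)) has_sum T) UNIV"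
  proof (rule has_sum_SigmaD)
    fix p :: "int \<times> int"
    obtain x y where p: "p = (x, y)" by force
    show "((\<lambda>c. ?F (?h (p, c))) has_sum (case p of (x, y) \<Rightarrow> (X powi (x + 1) * Y powi (x + y + 1)) * (- chi3 (x - y) * q powi qexp x y * qinf))) UNIV"
    proof -
      have "(\<lambda>c. ?F (?h ((x, y), c))) = (\<lambda>c. (X powi (x + 1) * Y powi (x + y + 1)) * (tsg (x + 1 - c) * tsg (x + y + 1 - c) * tsg c))"
        by (rule ext, rule term_eq)
      moreover have "((\<lambda>c. (X powi (x + 1) * Y powi (x + y + 1)) * (tsg (x + 1 - c) * tsg (x + y + 1 - c) * tsg c)) has_sum
          ((X powi (x + 1) * Y powi (x + y + 1)) * (- chi3 (x - y) * q powi qexp x y * qinf))) UNIV"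
        by (intro has_sum_cmult_right theta_coefficient)
      ultimately show ?thesis unfolding p by (simp only: prod.case)
    qed
  qed
  then have "((\<lambda>p. - (1 / (qinf * X * Y)) * (case p of (x, y) \<Rightarrow> (X powi (x + 1) * Y powi (x + y + 1)) * (- chi3 (x - y) * q powi qexp x y * qinf)))
      has_sum (- (1 / (qinf * X * Y)) * T)) UNIV"
    by (rule has_sum_cmult_right)
  moreover have "- (1 / (qinf * X * Y)) * (case p of (x, y) \<Rightarrow> (X powi (x + 1) * Y powi (x + y + 1)) * (- chi3 (x - y) * q powi qexp x y * qinf))
     = (case p of (x, y) \<Rightarrow> chi3 (x - y) * q powi qexp x y * (X powi x * Y powi (x + y)))" for p
    using X Y qinf_nonzero by (cases p) (simp add: power_int_add field_simps)
  moreover have "- (1 / (qinf * X * Y)) * T = - (qinf ^ 2 * qtheta X q * qtheta Y q * qtheta (X * Y) q) / (X * Y)"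
    unfolding T_def using X Y qinf_nonzero by (simp add: field_simps power2_eq_square)
  ultimately show ?thesis by simp
qed

end

section \<open>Product limits\<close>

lemma chi_tilde_sym: "chi_tilde K a b q = chi_tilde K b a q"
  by (simp add: chi_tilde_def add.commute mult_ac)

context qser
begin

text \<open>Macdonald's identity with base q^K at X = q^(a+1), Y = q^(b+1): the three theta factors
  are those of \<open>chi_tilde\<close>, and x + y = -z turns the monomial into the weight left by
  the chains.\<close>

lemma weight_sum:
  fixes k a b :: nat
  defines "K \<equiv> 3 * k + 4"
  shows "lsum (4 + 3 * int k) (\<lambda>x y z. q powi ((int a + 1) * x - (int b + 1) * z + (int a + int b)))
    (cseed * (chi_tilde K a b q * qinf ^ 2))"
proof -
  have nK: "norm (q ^ K) < 1"
    using norm_q_less_1 by (simp add: norm_power power_less_one_iff K_def)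
  interpret big: qser "q ^ K"
    by unfold_locales (use nK q_nonzero in auto)
  let ?X = "q ^ (a + 1)" and ?Y = "q ^ (b + 1)"
  have ne: "?X \<noteq> 0" "?Y \<noteq> 0" using q_nonzero by auto
  have "((\<lambda>p. q ^ (a + b) * (case p of (x, y) \<Rightarrow> chi3 (x - y) * (q ^ K) powi qexp x y * (?X powi x * ?Y powi (x + y)))) has_sum
     q ^ (a + b) * (- (big.qinf ^ 2 * qtheta ?X (q ^ K) * qtheta ?Y (q ^ K) * qtheta (?X * ?Y) (q ^ K)) / (?X * ?Y))) UNIV"
    by (intro has_sum_cmult_right big.macdonald_A2 ne)
  moreover have "q ^ (a + b) * (case p of (x, y) \<Rightarrow> chi3 (x - y) * (q ^ K) powi qexp x y * (?X powi x * ?Y powi (x + y)))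
      = (case p of (x, y) \<Rightarrow> gw (4 + 3 * int k) x y * q powi ((int a + 1) * x - (int b + 1) * (- x - y) + (int a + int b)))" for p
  proof -
    obtain x y where p: "p = (x, y)" by force
    have 1: "(q ^ K) powi qexp x y = q powi ((4 + 3 * int k) * qexp x y)"
    proof -
      have iK: "4 + 3 * int k = int K" by (simp add: K_def)
      show ?thesis unfolding iK power_int_mult by (simp only: power_int_of_nat)
    qed
    have 2: "?X powi x = q powi ((int a + 1) * x)"
    proof -
      have i1: "int a + 1 = int (a + 1)" by simp
      show ?thesis unfolding i1 power_int_mult by (simp only: power_int_of_nat)
    qed
    have 3: "?Y powi (x + y) = q powi ((int b + 1) * (x + y))"
    proof -
      have i1: "int b + 1 = int (b + 1)" by simp
      show ?thesis unfolding i1 power_int_mult by (simp only: power_int_of_nat)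
    qed
    have 4: "q ^ (a + b) * (q powi ((int a + 1) * x) * q powi ((int b + 1) * (x + y))) = q powi ((int a + 1) * x - (int b + 1) * (- x - y) + (int a + int b))"
      unfolding power_int_of_nat[symmetric] powi_add[symmetric] by (rule powi_cong) (simp add: algebra_simps)
    show ?thesis unfolding p prod.case 1 2 3 4[symmetric] gw_def by (simp only: mult_ac)
  qed
  moreover have "q ^ (a + b) * (- (big.qinf ^ 2 * qtheta ?X (q ^ K) * qtheta ?Y (q ^ K) * qtheta (?X * ?Y) (q ^ K)) / (?X * ?Y))
     = cseed * (chi_tilde K a b q * qinf ^ 2)"
  proof -
    have XY: "?X * ?Y = q ^ (a + b + 2)" by (simp add: power_add eval_nat_numeral)
    have c: "cseed = - (q ^ (a + b) / q ^ (a + b + 2))"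
      using q_nonzero by (simp add: cseed_def power_int_minus power_add power2_eq_square field_simps)
    have "chi_tilde K a b q * qinf ^ 2 = big.qinf ^ 2 * qtheta ?X (q ^ K) * qtheta ?Y (q ^ K) * qtheta (q ^ (a + b + 2)) (q ^ K)"
      using qinf_nonzero by (simp add: chi_tilde_def qinf_def big.qinf_def)
    then show ?thesis unfolding XY c by simp
  qed
  ultimately show ?thesis unfolding lsum_def by (simp only:)
qed

lemma fch_LIMSEQ_product:
  assumes "a \<le> b" "b \<le> k"
  shows "(\<lambda>L. fch k a b k L L - (if a = 0 then 0 else q * fch k (a - 1) (b - 1) k L L)) \<longlonglongrightarrow> chi_tilde (3 * k + 4) a b q / qinf ^ 3"
proof -
  let ?f = "\<lambda>L. fch k a b k L L - (if a = 0 then 0 else q * fch k (a - 1) (b - 1) k L L)"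
  let ?W = "cseed * (chi_tilde (3 * k + 4) a b q * qinf ^ 2)"
  have W: "lsum (4 + 3 * int k) (\<lambda>x y z. q powi ((int a + 1) * x - (int b + 1) * z + (int a + int b))) ?W"
    by (rule weight_sum)
  have "(\<lambda>L. cseed * ?f L) \<longlonglongrightarrow> 1 / qinf ^ 5 * ?W"
  \<comment> \<open>Without a (0, 0) step the last kernel is \<open>ker10\<close>, whose weight is
    already the one of \<open>weight_sum\<close>, so no correction arises.\<close>
  proof (cases "a = 0")
    case True
    show ?thesis
    proof (rule lsum_LIMSEQ[OF _ W, where D = "\<lambda>x y z L. ker10 x y z L L" and C = "qbd ^ 7"])
      fix L
      show "lsum (4 + 3 * int k) (\<lambda>x y z. q powi ((int a + 1) * x - (int b + 1) * z + (int a + int b)) * ker10 x y z L L) (cseed * ?f L)"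
        using chain10[of "k - b" b L L] fch_eq_chain[OF assms] assms True by (simp add: add.commute)
    qed (auto simp: ker10_def bker_bound bker_LIMSEQ)
  next
    case False
    then obtain a' where a': "a = Suc a'" by (cases a) auto
    show ?thesis
    proof (rule lsum_LIMSEQ[OF _ W, where D = "\<lambda>x y z L. ker00 x y z L L" and C = "qbd ^ 7"])
      fix L
      have 1: "fch k a b k = (bstep 0 0 ^^ Suc a') (chain (k - b) (b - a))"
        using fch_eq_chain[OF assms] a' by simp
      have 2: "fch k (a - 1) (b - 1) k = (bstep 0 0 ^^ a') (chain (Suc (k - b)) (b - a))"
        using fch_eq_chain[of "a - 1" "b - 1" k] a' assms by (simp add: Suc_diff_le)
      have e: "int (k - b + (b - a) + Suc a') = int k" using assms a' by simp
      have e': "(int a' + 2) * x - (int (b - a) + int a' + 2) * z + (int (b - a) + 2 * int a' + 2)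
         = (int a + 1) * x - (int b + 1) * z + (int a + int b)" for x z
        using assms a' by (simp add: of_nat_diff algebra_simps)
      show "lsum (4 + 3 * int k) (\<lambda>x y z. q powi ((int a + 1) * x - (int b + 1) * z + (int a + int b)) * ker00 x y z L L) (cseed * ?f L)"
        using chain00[of "k - b" "b - a" a' L L] False unfolding e e' 1 2 by simp
    next
      fix x y z
      show "(\<lambda>L. ker00 x y z L L) \<longlonglongrightarrow> 1 / qinf ^ 5"
        using bker_LIMSEQ[of 0 "x + 1" y "z - 1"] by (simp add: ker00_def)
    qed (auto simp: ker00_def bker_bound)
  qed
  then have "(\<lambda>L. inverse cseed * (cseed * ?f L)) \<longlonglongrightarrow> inverse cseed * (1 / qinf ^ 5 * ?W)"
    by (rule tendsto_mult_left)
  moreover have "inverse cseed * (cseed * ?f L) = ?f L" for L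
    using cseed_nonzero by simp
  moreover have "inverse cseed * (1 / qinf ^ 5 * ?W) = chi_tilde (3 * k + 4) a b q / qinf ^ 3"
    using cseed_nonzero qinf_nonzero by (simp add: field_simps eval_nat_numeral)
  ultimately show ?thesis by (simp only:)
qed

text \<open>In \<open>fch_eq_hch\<close> exactly three factors \<open>rqfac\<close> depend on L,
  each tending to 1/(q;q)_inf, while \<open>hch\<close> itself is the dominating weight.\<close>

lemma fch_LIMSEQ_sum:
  assumes k: "k \<ge> 1" and H: "((\<lambda>(x, y). hch k a b (k - 1) x y) has_sum S) UNIV"
  shows "(\<lambda>L. fch k a b k L L) \<longlonglongrightarrow> S / qinf ^ 3"
proof -
  obtain j where j: "k = Suc j" using k by (cases k) auto
  have "k - 1 = j" using j by simp
  note H' = H[unfolded this]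
  let ?t = "\<lambda>L (x, y). rqfac (int L - int x) * hch k a b j x y * rqfac (int L + int y - int x + eps b (k - j))"
  have fin: "(\<Sum>l\<le>L. \<Sum>y\<le>2 * l + j + 1. rqfac (int L - int l) * hch k a b j l y * rqfac (int L + int y - int l + eps b (k - j)))
     = infsum (?t L) UNIV" for L
  proof (rule infsumI[symmetric], rule has_sum_finite_neutralI[of "Sigma {..L} (\<lambda>l. {..2 * l + j + 1})"])
    fix p :: "nat \<times> nat" assume p: "p \<in> UNIV - Sigma {..L} (\<lambda>l. {..2 * l + j + 1})"
    then show "?t L p = 0" by (cases p) (auto simp: hch_eq_0)
  next
    show "(\<Sum>l\<le>L. \<Sum>y\<le>2 * l + j + 1. rqfac (int L - int l) * hch k a b j l y * rqfac (int L + int y - int l + eps b (k - j)))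
        = sum (?t L) (Sigma {..L} (\<lambda>l. {..2 * l + j + 1}))"
      by (subst sum.Sigma) auto
  qed auto
  have h: "(\<lambda>p. norm (case p of (x, y) \<Rightarrow> hch k a b j x y)) summable_on UNIV"
    using has_sum_imp_summable[OF H'] by (simp only: summable_on_iff_abs_summable_on_complex)
  have "(\<lambda>L. infsum (?t L) UNIV) \<longlonglongrightarrow> infsum (\<lambda>p. (case p of (x, y) \<Rightarrow> hch k a b j x y) * (1 / qinf * (1 / qinf))) UNIV"
  proof (rule infsum_dominated_convergence[where h = "\<lambda>p. norm (case p of (x, y) \<Rightarrow> hch k a b j x y) * (qbd * qbd)"])
    show "(\<lambda>p. norm (case p of (x, y) \<Rightarrow> hch k a b j x y) * (qbd * qbd)) summable_on UNIV"
      by (rule summable_on_cmult_left[OF h])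
  next
    fix L and p :: "nat \<times> nat"
    obtain x y where p: "p = (x, y)" by force
    have "norm (?t L p) = norm (hch k a b j x y) * (norm (rqfac (int L - int x)) * norm (rqfac (int L + int y - int x + eps b (k - j))))"
      by (simp add: p norm_mult mult_ac)
    also have "\<dots> \<le> norm (hch k a b j x y) * (qbd * qbd)"
      by (intro mult_left_mono mult_mono qbd norm_ge_zero less_imp_le[OF qbd(1)])
    finally show "norm (?t L p) \<le> norm (case p of (x, y) \<Rightarrow> hch k a b j x y) * (qbd * qbd)" by (simp add: p)
  next
    fix p :: "nat \<times> nat"
    obtain x y where p: "p = (x, y)" by force
    have 1: "(\<lambda>L. rqfac (int L - int x)) \<longlonglongrightarrow> 1 / qinf"
      using rqfac_LIMSEQ[of "- int x"] by simp
    have 2: "(\<lambda>L. rqfac (int L + int y - int x + eps b (k - j))) \<longlonglongrightarrow> 1 / qinf"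
      using rqfac_LIMSEQ[of "int y - int x + eps b (k - j)"] by (simp add: algebra_simps)
    have "(\<lambda>L. rqfac (int L - int x) * hch k a b j x y * rqfac (int L + int y - int x + eps b (k - j))) \<longlonglongrightarrow> 1 / qinf * hch k a b j x y * (1 / qinf)"
      by (intro tendsto_mult 1 2 tendsto_const)
    then show "(\<lambda>L. ?t L p) \<longlonglongrightarrow> (case p of (x, y) \<Rightarrow> hch k a b j x y) * (1 / qinf * (1 / qinf))"
      by (simp add: p mult_ac)
  qed
  also have "infsum (\<lambda>p. (case p of (x, y) \<Rightarrow> hch k a b j x y) * (1 / qinf * (1 / qinf))) UNIV = S * (1 / qinf * (1 / qinf))"
    by (rule infsumI[OF has_sum_cmult_left[OF H']])
  finally have "(\<lambda>L. rqfac (int L + 0) * infsum (?t L) UNIV) \<longlonglongrightarrow> 1 / qinf * (S * (1 / qinf * (1 / qinf)))"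
    by (intro tendsto_mult rqfac_LIMSEQ)
  moreover have "rqfac (int L + 0) * infsum (?t L) UNIV = fch k a b k L L" for L
    using fch_eq_hch[of j k a b L L] fin[of L] j by simp
  moreover have "1 / qinf * (S * (1 / qinf * (1 / qinf))) = S / qinf ^ 3"
    by (simp add: eval_nat_numeral)
  ultimately show ?thesis by (simp only:)
qed

end

section \<open>The multisum over tuples\<close>

lemma bij_betw_PiE_peel:
  assumes "i \<notin> S"
  shows "bij_betw (\<lambda>((x, y), l, m). (l(i := x), m(i := y))) ((UNIV \<times> UNIV) \<times> (PiE S (\<lambda>_. UNIV) \<times> PiE S (\<lambda>_. UNIV)))
     (PiE (insert i S) (\<lambda>_. UNIV) \<times> PiE (insert i S) (\<lambda>_. UNIV))"
  by (rule bij_betw_byWitness[where f'="\<lambda>(l, m). ((l i, m i), l(i := undefined), m(i := undefined))"])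
     (use assms in \<open>auto simp: fun_eq_iff PiE_def extensional_def\<close>)

lemma summable_on_PiE_geometric:
  fixes G :: "('i \<Rightarrow> nat) \<times> ('i \<Rightarrow> nat) \<Rightarrow> complex" and r :: real
  assumes I: "finite I" and r: "0 \<le> r" "r < 1"
    and bound: "\<And>l m. norm (G (l, m)) \<le> C * (\<Prod>i\<in>I. r ^ (l i + m i))"
  shows "G summable_on PiE I (\<lambda>_. UNIV) \<times> PiE I (\<lambda>_. UNIV)"
proof -
  let ?P = "PiE I (\<lambda>_. UNIV :: nat set)"
  let ?g = "\<lambda>l. \<Prod>i\<in>I. complex_of_real r ^ l i"
  have "(\<lambda>n. norm (complex_of_real r ^ n)) summable_on UNIV"
    using r by (intro summable_nonneg_imp_summable_on) (auto simp: norm_power intro: summable_geometric)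
  then have "(\<lambda>l. norm (?g l)) summable_on ?P"
    unfolding abs_summable_equivalent by (intro abs_summable_on_prod_PiE I) auto
  then have g: "?g summable_on ?P" by (rule Infinite_Sum.abs_summable_summable)
  have "((\<lambda>(l, m). ?g l * ?g m) has_sum (infsum ?g ?P * infsum ?g ?P)) (?P \<times> ?P)"
    by (rule has_sum_prod_complex) (use g in auto)
  then have "(\<lambda>p. norm (case p of (l, m) \<Rightarrow> ?g l * ?g m)) summable_on (?P \<times> ?P)"
    using has_sum_imp_summable summable_on_iff_abs_summable_on_complex by blast
  then have *: "(\<lambda>p. norm (complex_of_real C * (case p of (l, m) \<Rightarrow> ?g l * ?g m))) summable_on (?P \<times> ?P)"
    unfolding norm_mult[of "complex_of_real C"] by (rule summable_on_cmult_right)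
  have "(\<lambda>p. norm (G p)) summable_on (?P \<times> ?P)"
  proof (rule Infinite_Sum.abs_summable_on_comparison_test[OF *])
    fix p :: "('i \<Rightarrow> nat) \<times> ('i \<Rightarrow> nat)"
    obtain l m where p: "p = (l, m)" by force
    have "(\<Prod>i\<in>I. r ^ (l i + m i)) = norm (?g l * ?g m)"
      using r by (simp add: norm_mult prod_norm[symmetric] norm_power power_add prod.distrib)
    then have "norm (G p) \<le> C * norm (?g l * ?g m)" using bound[of l m] by (simp add: p)
    also have "\<dots> \<le> \<bar>C\<bar> * norm (?g l * ?g m)" by (intro mult_right_mono) auto
    finally show "norm (G p) \<le> norm (complex_of_real C * (case p of (l, m) \<Rightarrow> ?g l * ?g m))"
      unfolding p prod.case norm_mult[of "complex_of_real C"] by simp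
  qed
  then show ?thesis by (rule Infinite_Sum.abs_summable_summable)
qed

context qser
begin

text \<open>The factor of index i in the multisum once 1/(q;q)_(lambda_1) and the q-binomials in
  lambda have collapsed to reciprocals of q-factorials of successive differences.\<close>

definition cell :: "nat \<Rightarrow> nat \<Rightarrow> nat \<Rightarrow> nat \<Rightarrow> (nat \<Rightarrow> nat) \<Rightarrow> (nat \<Rightarrow> nat) \<Rightarrow> complex" where
  "cell k a b i l m = hw a b i (l i) (m i) * (rqfac (lam_ext k l i - lam_ext k l (i + 1)) *
     qbinom q (lam_ext k l i - lam_ext k l (i + 1) + mu_ext k l m (i + 1) + dd b i) (int (m i)))"

text \<open>Twice the quadratic form is x^2 + y^2 + (x - y)^2, hence at least x + y; this gives
  geometric decay with ratio sqrt |q|.\<close>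

lemma hw_bound: "norm (hw a b i x y) \<le> sqrt (norm q) ^ (x + y)"
proof -
  let ?e = "int x * int x - int x * int y + int y * int y + eps a i * int x + eps b i * int y"
  have sq: "int t \<le> int t * int t" for t by (cases t) auto
  have "2 * (int x * int x - int x * int y + int y * int y) = int x * int x + int y * int y + (int x - int y) * (int x - int y)"
    by (simp add: algebra_simps)
  then have "int x + int y \<le> 2 * (int x * int x - int x * int y + int y * int y)"
    using sq[of x] sq[of y] zero_le_square[of "int x - int y"] by linarith
  moreover have "eps a i * int x \<ge> 0" "eps b i * int y \<ge> 0" by (auto simp: eps_def)
  ultimately have e: "int (x + y) \<le> 2 * ?e" by simp
  define n where "n = nat ?e"
  have n: "?e = int n" "x + y \<le> 2 * n" using e by (auto simp: n_def)
  have "norm (hw a b i x y) = norm q ^ n"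
    unfolding hw_def n(1) by (simp add: norm_power)
  also have "\<dots> = sqrt (norm q) ^ (2 * n)"
    by (simp add: power_mult)
  also have "\<dots> \<le> sqrt (norm q) ^ (x + y)"
    using n(2) norm_q_less_1 by (intro power_decreasing) auto
  finally show ?thesis .
qed

lemma cell_bound: "norm (cell k a b i l m) \<le> qbd ^ 4 * sqrt (norm q) ^ (l i + m i)"
proof -
  have "norm (cell k a b i l m) \<le> sqrt (norm q) ^ (l i + m i) * (qbd * qbd ^ 3)"
    unfolding cell_def norm_mult
    by (intro mult_mono hw_bound qbd qbinom_bound mult_nonneg_nonneg norm_ge_zero less_imp_le[OF qbd(1)]) auto
  then show ?thesis by (simp add: eval_nat_numeral mult_ac)
qed

definition tailp :: "nat \<Rightarrow> nat \<Rightarrow> nat \<Rightarrow> nat \<Rightarrow> (nat \<Rightarrow> nat) \<times> (nat \<Rightarrow> nat) \<Rightarrow> complex" where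
  "tailp k a b i = (\<lambda>(l, m). \<Prod>t\<in>{i..k}. cell k a b t l m)"

lemma tailp_bound: "norm (tailp k a b i (l, m)) \<le> (qbd ^ 4) ^ card {i..k} * (\<Prod>t\<in>{i..k}. sqrt (norm q) ^ (l t + m t))"
proof -
  have "norm (tailp k a b i (l, m)) = (\<Prod>t\<in>{i..k}. norm (cell k a b t l m))"
    by (simp add: tailp_def prod_norm)
  also have "\<dots> \<le> (\<Prod>t\<in>{i..k}. qbd ^ 4 * sqrt (norm q) ^ (l t + m t))"
    by (intro prod_mono) (auto simp: cell_bound)
  finally show ?thesis by (simp add: prod.distrib)
qed

lemma sqrt_q: "0 \<le> sqrt (norm q)" "sqrt (norm q) < 1"
  using norm_q_less_1 by auto

lemma tailp_summable: "tailp k a b i summable_on PiE {i..k} (\<lambda>_. UNIV) \<times> PiE {i..k} (\<lambda>_. UNIV)"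
  by (rule summable_on_PiE_geometric[OF _ sqrt_q tailp_bound]) auto

lemma tailp_upd_summable:
  "(\<lambda>(l, m). tailp k a b i (l(i := x), m(i := y))) summable_on PiE {i+1..k} (\<lambda>_. UNIV) \<times> PiE {i+1..k} (\<lambda>_. UNIV)"
proof (cases "i \<le> k")
  case True
  then have ins: "{i..k} = insert i {i+1..k}" by auto
  show ?thesis
  proof (rule summable_on_PiE_geometric[OF _ sqrt_q, where C = "(qbd ^ 4) ^ card {i..k}"])
    fix l m
    have "(\<Prod>t\<in>{i..k}. sqrt (norm q) ^ ((l(i := x)) t + (m(i := y)) t)) =
        sqrt (norm q) ^ (x + y) * (\<Prod>t\<in>{i+1..k}. sqrt (norm q) ^ (l t + m t))"
      unfolding ins by (subst prod.insert) (auto intro!: arg_cong2[where f="(*)"] prod.cong)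
    also have "\<dots> \<le> 1 * (\<Prod>t\<in>{i+1..k}. sqrt (norm q) ^ (l t + m t))"
      using sqrt_q by (intro mult_right_mono power_le_one prod_nonneg) auto
    finally have le: "(\<Prod>t\<in>{i..k}. sqrt (norm q) ^ ((l(i := x)) t + (m(i := y)) t)) \<le> (\<Prod>t\<in>{i+1..k}. sqrt (norm q) ^ (l t + m t))"
      by simp
    have "norm (tailp k a b i (l(i := x), m(i := y))) \<le> (qbd ^ 4) ^ card {i..k} * (\<Prod>t\<in>{i..k}. sqrt (norm q) ^ ((l(i := x)) t + (m(i := y)) t))"
      by (rule tailp_bound)
    also have "\<dots> \<le> (qbd ^ 4) ^ card {i..k} * (\<Prod>t\<in>{i+1..k}. sqrt (norm q) ^ (l t + m t))"
      by (intro mult_left_mono le zero_le_power less_imp_le[OF qbd(1)])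
    finally show "norm (case (l, m) of (l, m) \<Rightarrow> tailp k a b i (l(i := x), m(i := y))) \<le> (qbd ^ 4) ^ card {i..k} * (\<Prod>t\<in>{i+1..k}. sqrt (norm q) ^ (l t + m t))"
      by simp
  qed auto
next
  case False
  then show ?thesis by simp
qed

lemma cell_cong:
  assumes "t \<le> k" "l t = l' t" "t < k \<Longrightarrow> l (t + 1) = l' (t + 1)" "m t = m' t" "t < k \<Longrightarrow> m (t + 1) = m' (t + 1)"
  shows "cell k a b t l m = cell k a b t l' m'"
  using assms by (cases "t = k") (auto simp: cell_def lam_ext_def mu_ext_def)

text \<open>A cell involves only the indices i and i + 1, so fixing the pair at i + 1 separates the
  cell at i from the remaining tail, which is the recursion of \<open>hch\<close>.\<close>

lemma tailp_has_sum_hch: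
  assumes "j < k"
  shows "((\<lambda>(l, m). tailp k a b (k - j) (l(k - j := x), m(k - j := y))) has_sum hch k a b j x y)
    (PiE {k - j + 1..k} (\<lambda>_. UNIV) \<times> PiE {k - j + 1..k} (\<lambda>_. UNIV))"
  using assms
proof (induction j arbitrary: x y)
  case 0
  have "((\<lambda>(l, m). tailp k a b (k - 0) (l(k - 0 := x), m(k - 0 := y))) has_sum hch k a b 0 x y) {(\<lambda>_. undefined, \<lambda>_. undefined)}"
  proof (rule has_sum_finiteI)
    show "hch k a b 0 x y = (\<Sum>(l, m)\<in>{(\<lambda>_. undefined, \<lambda>_. undefined)}. tailp k a b (k - 0) (l(k - 0 := x), m(k - 0 := y)))"
      by (simp add: tailp_def cell_def lam_ext_def mu_ext_def)
  qed simp
  moreover have "PiE {k - 0 + 1..k} (\<lambda>_. UNIV :: nat set) \<times> PiE {k - 0 + 1..k} (\<lambda>_. UNIV :: nat set) = {(\<lambda>_. undefined, \<lambda>_. undefined)}"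
    by simp
  ultimately show ?case by (simp only:)
next
  case (Suc j)
  define i where "i = k - Suc j"
  have i: "k - j = i + 1" "i < k" using Suc.prems by (auto simp: i_def)
  define c where "c x' y' = hw a b i x y * (rqfac (int x - int x') * qbinom q (int x - int x' + int y' + dd b i) (int y))" for x' y' :: nat
  let ?P = "PiE {i + 1..k} (\<lambda>_. UNIV :: nat set)"
  let ?P' = "PiE {i + 2..k} (\<lambda>_. UNIV :: nat set)"
  let ?f = "\<lambda>(l, m). tailp k a b i (l(i := x), m(i := y))"
  let ?h = "\<lambda>((x', y'), l, m). (l(i + 1 := x'), m(i + 1 := y'))"
  have ins: "{i + 1..k} = insert (i + 1) {i + 2..k}" using i by auto
  have bij: "bij_betw ?h ((UNIV \<times> UNIV) \<times> (?P' \<times> ?P')) (?P \<times> ?P)"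
    unfolding ins by (rule bij_betw_PiE_peel) auto
  have IH: "((\<lambda>(l, m). tailp k a b (i + 1) (l(i + 1 := x'), m(i + 1 := y'))) has_sum hch k a b j x' y') (?P' \<times> ?P')" for x' y'
  proof -
    have e: "i + 1 + 1 = i + 2" by simp
    show ?thesis using Suc.IH[OF Suc_lessD[OF Suc.prems], of x' y'] unfolding i(1) e .
  qed
  have split: "?f (?h ((x', y'), l, m)) = c x' y' * tailp k a b (i + 1) (l(i + 1 := x'), m(i + 1 := y'))" for x' y' l m
  proof -
    let ?l = "l(i + 1 := x')" and ?m = "m(i + 1 := y')"
    have "{i..k} = insert i {i + 1..k}" using i by auto
    then have "tailp k a b i (?l(i := x), ?m(i := y)) = cell k a b i (?l(i := x)) (?m(i := y)) * (\<Prod>t\<in>{i+1..k}. cell k a b t (?l(i := x)) (?m(i := y)))"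
      unfolding tailp_def prod.case by (subst \<open>{i..k} = insert i {i + 1..k}\<close>, subst prod.insert) auto
    also have "(\<Prod>t\<in>{i+1..k}. cell k a b t (?l(i := x)) (?m(i := y))) = (\<Prod>t\<in>{i+1..k}. cell k a b t ?l ?m)"
      by (intro prod.cong refl cell_cong) auto
    also have "cell k a b i (?l(i := x)) (?m(i := y)) = c x' y'"
      using i by (simp add: cell_def c_def lam_ext_def mu_ext_def)
    finally show ?thesis unfolding tailp_def prod.case .
  qed
  have "((\<lambda>p. ?f (?h p)) has_sum hch k a b (Suc j) x y) ((UNIV \<times> UNIV) \<times> (?P' \<times> ?P'))"
  proof (rule has_sum_SigmaI)
    fix p :: "nat \<times> nat"
    obtain x' y' where p: "p = (x', y')" by force
    have "((\<lambda>r. c x' y' * (case r of (l, m) \<Rightarrow> tailp k a b (i + 1) (l(i + 1 := x'), m(i + 1 := y')))) has_sum c x' y' * hch k a b j x' y') (?P' \<times> ?P')"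
      by (rule has_sum_cmult_right[OF IH])
    moreover have "(\<lambda>r. c x' y' * (case r of (l, m) \<Rightarrow> tailp k a b (i + 1) (l(i + 1 := x'), m(i + 1 := y')))) = (\<lambda>r. ?f (?h (p, r)))"
    proof
      fix r :: "(nat \<Rightarrow> nat) \<times> (nat \<Rightarrow> nat)"
      obtain l m where r: "r = (l, m)" by force
      show "c x' y' * (case r of (l, m) \<Rightarrow> tailp k a b (i + 1) (l(i + 1 := x'), m(i + 1 := y'))) = ?f (?h (p, r))"
        unfolding p r split by simp
    qed
    ultimately show "((\<lambda>r. ?f (?h (p, r))) has_sum (case p of (x', y') \<Rightarrow> c x' y' * hch k a b j x' y')) (?P' \<times> ?P')"
      by (simp add: p)
  next
    show "((\<lambda>p. case p of (x', y') \<Rightarrow> c x' y' * hch k a b j x' y') has_sum hch k a b (Suc j) x y) (UNIV \<times> UNIV)"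
    proof (rule has_sum_finite_neutralI[of "Sigma {..x} (\<lambda>x'. {..2 * x' + j + 1})"])
      fix p :: "nat \<times> nat" assume "p \<in> UNIV \<times> UNIV - Sigma {..x} (\<lambda>x'. {..2 * x' + j + 1})"
      then show "(case p of (x', y') \<Rightarrow> c x' y' * hch k a b j x' y') = 0"
        by (cases p) (auto simp: hch_eq_0 c_def)
    next
      show "hch k a b (Suc j) x y = (\<Sum>p\<in>Sigma {..x} (\<lambda>x'. {..2 * x' + j + 1}). case p of (x', y') \<Rightarrow> c x' y' * hch k a b j x' y')"
        unfolding hch.simps i_def[symmetric] c_def sum_distrib_left by (subst sum.Sigma) (auto simp: mult_ac)
    qed auto
  next
    have "?f summable_on (?P \<times> ?P)" by (rule tailp_upd_summable)
    then show "(\<lambda>p. ?f (?h p)) summable_on ((UNIV \<times> UNIV) \<times> (?P' \<times> ?P'))"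
      using summable_on_reindex_bij_betw[OF bij, of ?f] by blast
  qed
  then have "(?f has_sum hch k a b (Suc j) x y) (?P \<times> ?P)"
    using has_sum_reindex_bij_betw[OF bij, of ?f] by blast
  then show ?case unfolding i_def .
qed

lemma hch_has_sum_tailp:
  assumes "k \<ge> 1"
  shows "((\<lambda>(x, y). hch k a b (k - 1) x y) has_sum infsum (tailp k a b 1) (idx k)) UNIV"
proof -
  let ?P = "PiE {1..k} (\<lambda>_. UNIV :: nat set)"
  let ?P' = "PiE {2..k} (\<lambda>_. UNIV :: nat set)"
  let ?h = "\<lambda>((x, y), l, m). (l(1 := x), m(1 := y))"
  have ins: "{1..k} = insert 1 {2..k}" using assms by auto
  have bij: "bij_betw ?h ((UNIV \<times> UNIV) \<times> (?P' \<times> ?P')) (?P \<times> ?P)"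
    unfolding ins by (rule bij_betw_PiE_peel) auto
  have "(tailp k a b 1 has_sum infsum (tailp k a b 1) (idx k)) (?P \<times> ?P)"
    unfolding idx_def by (rule has_sum_infsum[OF tailp_summable])
  then have "((\<lambda>p. tailp k a b 1 (?h p)) has_sum infsum (tailp k a b 1) (idx k)) ((UNIV \<times> UNIV) \<times> (?P' \<times> ?P'))"
    using has_sum_reindex_bij_betw[OF bij, of "tailp k a b 1"] by blast
  then have "((\<lambda>(x, y). hch k a b (k - 1) x y) has_sum infsum (tailp k a b 1) (idx k)) (UNIV \<times> UNIV)"
  proof (rule has_sum_SigmaD)
    fix p :: "nat \<times> nat"
    obtain x y where p: "p = (x, y)" by force
    have e: "k - (k - 1) = 1" "(1::nat) + 1 = 2" using assms by auto
    have "((\<lambda>(l, m). tailp k a b 1 (l(1 := x), m(1 := y))) has_sum hch k a b (k - 1) x y) (?P' \<times> ?P')"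
      using tailp_has_sum_hch[of "k - 1" k a b x y] assms unfolding e by simp
    then show "((\<lambda>r. tailp k a b 1 (?h (p, r))) has_sum (case p of (x, y) \<Rightarrow> hch k a b (k - 1) x y)) (?P' \<times> ?P')"
      by (simp add: p case_prod_unfold)
  qed
  then show ?thesis by simp
qed

text \<open>The q-binomial of lambda_i over lambda_(i+1) splits into a telescoping quotient and a
  factor of the difference; the telescope leaves (q;q)_(lambda_1) because lambda_(k+1) = 0.\<close>

lemma summand_eq_prod:
  "summand q k d l m = (\<Prod>i\<in>{1..k}. q ^ nat (int (l i)^2 - int (l i) * int (m i) + int (m i)^2) *
     (rqfac (lam_ext k l i - lam_ext k l (i + 1)) * qbinom q (lam_ext k l i - lam_ext k l (i + 1) + mu_ext k l m (i + 1) + d i) (int (m i))))"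
  if "k \<ge> 1"
proof -
  have nn: "lam_ext k l i \<ge> 0" for i by (simp add: lam_ext_def)
  have tel: "(\<Prod>i\<in>{1..n}. qfac (lam_ext k l i) * rqfac (lam_ext k l (i + 1))) = qfac (lam_ext k l 1) * rqfac (lam_ext k l (n + 1))" for n
  proof (induction n)
    case 0
    show ?case using rqfac_qfac[OF nn[of 1]] by (simp add: mult.commute)
  next
    case (Suc n)
    have "(\<Prod>i\<in>{1..Suc n}. qfac (lam_ext k l i) * rqfac (lam_ext k l (i + 1))) =
       qfac (lam_ext k l 1) * (rqfac (lam_ext k l (Suc n)) * qfac (lam_ext k l (Suc n))) * rqfac (lam_ext k l (Suc n + 1))"
      using Suc.IH by (simp add: mult_ac)
    then show ?case unfolding rqfac_qfac[OF nn] by simp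
  qed
  have "(\<Prod>i\<in>{1..k}. qfac (lam_ext k l i) * rqfac (lam_ext k l (i + 1))) = qpoch q q (l 1)"
    unfolding tel using that by (simp add: lam_ext_def qfac_def)
  moreover have "qpoch q q (l 1) \<noteq> 0" using qfac_nonzero[of "int (l 1)"] by (simp add: qfac_def)
  ultimately have one: "1 / qpoch q q (l 1) * (\<Prod>i\<in>{1..k}. qfac (lam_ext k l i) * rqfac (lam_ext k l (i + 1))) = 1" by simp
  have "summand q k d l m = 1 / qpoch q q (l 1) * (\<Prod>i\<in>{1..k}. (qfac (lam_ext k l i) * rqfac (lam_ext k l (i + 1))) *
     (q ^ nat (int (l i)^2 - int (l i) * int (m i) + int (m i)^2) *
     (rqfac (lam_ext k l i - lam_ext k l (i + 1)) * qbinom q (lam_ext k l i - lam_ext k l (i + 1) + mu_ext k l m (i + 1) + d i) (int (m i)))))"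
    unfolding summand_def qbinom_eq[of "lam_ext k l _" "lam_ext k l _"]
    by (rule arg_cong2[where f="(*)", OF refl], rule prod.cong[OF refl]) (simp only: mult_ac)
  also have "\<dots> = (1 / qpoch q q (l 1) * (\<Prod>i\<in>{1..k}. qfac (lam_ext k l i) * rqfac (lam_ext k l (i + 1)))) *
     (\<Prod>i\<in>{1..k}. q ^ nat (int (l i)^2 - int (l i) * int (m i) + int (m i)^2) *
     (rqfac (lam_ext k l i - lam_ext k l (i + 1)) * qbinom q (lam_ext k l i - lam_ext k l (i + 1) + mu_ext k l m (i + 1) + d i) (int (m i))))"
    unfolding prod.distrib[of "\<lambda>i. qfac (lam_ext k l i) * rqfac (lam_ext k l (i + 1))"] by (simp only: mult.assoc)
  finally show ?thesis unfolding one by (simp only: mult_1_left)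
qed

lemma hw_eq_power:
  "hw a b i x y = (q ^ (if i > a then x else 0) * q ^ (if i > b then y else 0)) * q ^ nat (int x ^ 2 - int x * int y + int y ^ 2)"
proof -
  have "2 * (int x ^ 2 - int x * int y + int y ^ 2) = int x ^ 2 + int y ^ 2 + (int x - int y) ^ 2"
    by (simp add: power2_eq_square algebra_simps)
  then have nn: "int x ^ 2 - int x * int y + int y ^ 2 \<ge> 0"
    by (smt (verit) zero_le_power2)
  have "hw a b i x y = q powi (int (if i > a then x else 0) + int (if i > b then y else 0) + int (nat (int x ^ 2 - int x * int y + int y ^ 2)))"
    unfolding hw_def using nn by (intro powi_cong) (simp add: eps_def power2_eq_square)
  also have "\<dots> = (q ^ (if i > a then x else 0) * q ^ (if i > b then y else 0)) * q ^ nat (int x ^ 2 - int x * int y + int y ^ 2)"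
    unfolding powi_add power_int_of_nat ..
  finally show ?thesis .
qed

lemma summand_eq_tailp:
  assumes "k \<ge> 1" and d: "\<And>i. i \<in> {1..k} \<Longrightarrow> d i = dd b i"
  shows "q ^ ((\<Sum>i\<in>{a+1..k}. l i) + (\<Sum>i\<in>{b+1..k}. m i)) * summand q k d l m = tailp k a b 1 (l, m)"
proof -
  have ex: "(\<Sum>i\<in>{c+1..k}. f i) = (\<Sum>i\<in>{1..k}. if i > c then f i else 0)" for c and f :: "nat \<Rightarrow> nat"
    by (rule sum.mono_neutral_cong_left) auto
  have "tailp k a b 1 (l, m) = (\<Prod>i\<in>{1..k}. (q ^ (if i > a then l i else 0) * q ^ (if i > b then m i else 0)) *
     (q ^ nat (int (l i)^2 - int (l i) * int (m i) + int (m i)^2) *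
     (rqfac (lam_ext k l i - lam_ext k l (i + 1)) * qbinom q (lam_ext k l i - lam_ext k l (i + 1) + mu_ext k l m (i + 1) + d i) (int (m i)))))"
    unfolding tailp_def cell_def prod.case hw_eq_power by (intro prod.cong refl) (simp only: d mult.assoc)
  also have "\<dots> = (\<Prod>i\<in>{1..k}. q ^ (if i > a then l i else 0) * q ^ (if i > b then m i else 0)) * summand q k d l m"
    unfolding summand_eq_prod[OF assms(1)] prod.distrib[of "\<lambda>i. q ^ (if i > a then l i else 0) * q ^ (if i > b then m i else 0)"] ..
  also have "(\<Prod>i\<in>{1..k}. q ^ (if i > a then l i else 0) * q ^ (if i > b then m i else 0)) = q ^ ((\<Sum>i\<in>{a+1..k}. l i) + (\<Sum>i\<in>{b+1..k}. m i))"
    unfolding ex power_add power_sum prod.distrib ..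
  finally show ?thesis by simp
qed

lemma dd_eq: "dd b i = (if i = b then 1 else 0)"
  by (auto simp: dd_def eps_def)

lemma fch_LIMSEQ_tailp:
  assumes "k \<ge> 1"
  shows "(\<lambda>L. fch k a b k L L) \<longlonglongrightarrow> infsum (tailp k a b 1) (idx k) / qinf ^ 3"
  by (rule fch_LIMSEQ_sum[OF assms hch_has_sum_tailp[OF assms]])

lemma chi_tilde_eq_sums:
  assumes k: "k \<ge> 1" and "a \<le> k" "b \<le> k"
  shows "chi_tilde (3 * k + 4) a b q = infsum (tailp k a b 1) (idx k)
     - (if a * b > 0 then q * infsum (tailp k (a - 1) (b - 1) 1) (idx k) else 0)"
proof -
  let ?g = "\<lambda>a b L. fch k a b k L L - (if a * b > 0 then q * fch k (a - 1) (b - 1) k L L else 0)"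
  have sums: "?g a b \<longlonglongrightarrow> infsum (tailp k a b 1) (idx k) / qinf ^ 3
     - (if a * b > 0 then q * (infsum (tailp k (a - 1) (b - 1) 1) (idx k) / qinf ^ 3) else 0)"
  proof (cases "a * b > 0")
    case True
    show ?thesis unfolding if_P[OF True]
      by (intro tendsto_diff tendsto_mult_left fch_LIMSEQ_tailp[OF k])
  next
    case False
    show ?thesis unfolding if_not_P[OF False] diff_zero by (rule fch_LIMSEQ_tailp[OF k])
  qed
  have prod: "?g a b \<longlonglongrightarrow> chi_tilde (3 * k + 4) a b q / qinf ^ 3" if "a \<le> b" "b \<le> k" for a b
  proof -
    have "?g a b = (\<lambda>L. fch k a b k L L - (if a = 0 then 0 else q * fch k (a - 1) (b - 1) k L L))"
      using that by (auto simp: fun_eq_iff)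
    then show ?thesis using fch_LIMSEQ_product[OF that] by simp
  qed
  have "?g a b \<longlonglongrightarrow> chi_tilde (3 * k + 4) a b q / qinf ^ 3"
  proof (cases "a \<le> b")
    case True
    then show ?thesis using prod assms by blast
  next
    case False
    have "?g a b = ?g b a"
      using fch_swap[of a k b k] fch_swap[of "a - 1" k "b - 1" k] assms by (auto simp: fun_eq_iff mult.commute)
    then show ?thesis using prod[of b a] assms False by (simp add: chi_tilde_sym)
  qed
  from LIMSEQ_unique[OF this sums] show ?thesis
    using qinf_nonzero by (auto simp: field_simps split: if_splits)
qed

lemma chi_tilde_eq_sum_special:
  assumes k: "k \<ge> 1"
  shows "chi_tilde (3 * k + 4) k k q = infsum (tailp k k (k + 1) 1) (idx k)"
proof -
  have "(\<lambda>L. fch k k (k + 1) k L L) = (\<lambda>L. fch k k k k L L - (if k = 0 then 0 else q * fch k (k - 1) (k - 1) k L L))"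
    using fch_special[OF k] k by auto
  then have "(\<lambda>L. fch k k (k + 1) k L L) \<longlonglongrightarrow> chi_tilde (3 * k + 4) k k q / qinf ^ 3"
    using fch_LIMSEQ_product[of k k k] by simp
  from LIMSEQ_unique[OF this fch_LIMSEQ_tailp[OF k]] show ?thesis
    using qinf_nonzero by simp
qed

end

section \<open>The degenerate case q = 0\<close>

lemma summand_0:
  assumes k: "k \<ge> 1" and d: "\<And>i. i \<in> {1..k} \<Longrightarrow> d i \<ge> 0" and lm: "(l, m) \<in> idx k"
  shows "summand 0 k d l m = (if (l, m) = (restrict (\<lambda>_. 0) {1..k}, restrict (\<lambda>_. 0) {1..k}) then 1 else 0)"
proof (cases "(l, m) = (restrict (\<lambda>_. 0) {1..k}, restrict (\<lambda>_. 0) {1..k})")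
  case True
  have [simp]: "qpoch 0 0 n = 1" for n by (simp add: qpoch_def)
  have "lam_ext k l i = 0" "mu_ext k l m (i + 1) = 0" "m i = 0" "l i = 0" "lam_ext k l (i + 1) = 0" if "i \<in> {1..k}" for i
    using that True k by (auto simp: lam_ext_def mu_ext_def)
  then show ?thesis
    using True d by (auto simp: summand_def qbinom_def intro!: prod.neutral)
next
  case False
  have "\<exists>i\<in>{1..k}. l i \<noteq> 0 \<or> m i \<noteq> 0"
  proof (rule ccontr)
    assume n: "\<not> (\<exists>i\<in>{1..k}. l i \<noteq> 0 \<or> m i \<noteq> 0)"
    have ext: "l \<in> extensional {1..k}" "m \<in> extensional {1..k}"
      using lm by (auto simp: idx_def PiE_def)
    have "l = restrict (\<lambda>_. 0) {1..k}" "m = restrict (\<lambda>_. 0) {1..k}"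
      by (rule extensionalityI[OF ext(1) restrict_extensional], use n in simp)
         (rule extensionalityI[OF ext(2) restrict_extensional], use n in simp)
    then show False using False by simp
  qed
  then obtain i where i: "i \<in> {1..k}" "l i \<noteq> 0 \<or> m i \<noteq> 0" by blast
  \<comment> \<open>Positive definiteness of the quadratic form: a nonzero pair at any index
    produces a positive power of 0.\<close>
  have "2 * (int (l i) ^ 2 - int (l i) * int (m i) + int (m i) ^ 2) = int (l i) ^ 2 + int (m i) ^ 2 + (int (l i) - int (m i)) ^ 2"
    by (simp add: power2_eq_square algebra_simps)
  moreover have "int (l i) ^ 2 + int (m i) ^ 2 > 0"
    using i(2) by (auto simp: add_pos_nonneg add_nonneg_pos)
  ultimately have "int (l i) ^ 2 - int (l i) * int (m i) + int (m i) ^ 2 > 0"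
    by (smt (verit) zero_le_power2)
  then have "(0::complex) ^ nat (int (l i) ^ 2 - int (l i) * int (m i) + int (m i) ^ 2) = 0"
    by simp
  then show ?thesis
    unfolding summand_def using i(1) False by (auto intro!: prod_zero bexI[of _ i])
qed

lemma chi_tilde_0:
  assumes "K > 0"
  shows "chi_tilde K a b 0 = 1"
proof -
  have one: "qpoch_inf 0 p = 1" for p
    by (simp add: qpoch_inf_def)
  have z: "(0::complex) ^ K = 0" "(0::complex) ^ (n + 1) = 0" "(0::complex) ^ (n + 2) = 0" for n
    using assms by simp_all
  show ?thesis unfolding chi_tilde_def qtheta_def z div_0 one by simp
qed

theorem theorem7p2:
  fixes k a b :: nat and q :: complex
  assumes "k \<ge> 1" and "a \<le> k" and "b \<le> k" and "norm q < 1"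
  defines "K \<equiv> 3 * k + 4"
  defines "F1 \<equiv> (\<lambda>(l, m). q ^ ((\<Sum>i\<in>{a+1..k}. l i) + (\<Sum>i\<in>{b+1..k}. m i))
                   * summand q k (\<lambda>i. if i = b then 1 else 0) l m)"
  defines "F2 \<equiv> (\<lambda>(l, m). q ^ (1 + (\<Sum>i\<in>{a..k}. l i) + (\<Sum>i\<in>{b..k}. m i))
                   * summand q k (\<lambda>i. if int i = int b - 1 then 1 else 0) l m)"
  defines "F3 \<equiv> (\<lambda>(l, m). summand q k (\<lambda>_. 0) l m)"
  shows "F1 summable_on idx k
    \<and> (if a * b > 0
       then F2 summable_on idx k \<and> chi_tilde K a b q = infsum F1 (idx k) - infsum F2 (idx k)
       else chi_tilde K a b q = infsum F1 (idx k))
    \<and> F3 summable_on idx k \<and> chi_tilde K k k q = infsum F3 (idx k)"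
\<comment> \<open>Negative powers of \<open>q\<close> occur throughout the Bailey argument, so q = 0
  is settled by hand: only the zero tuple contributes.\<close>
proof (cases "q = 0")
  case True
  let ?z = "(restrict (\<lambda>_. 0) {1..k}, restrict (\<lambda>_. 0) {1..k}) :: (nat \<Rightarrow> nat) \<times> (nat \<Rightarrow> nat)"
  have z: "?z \<in> idx k" by (auto simp: idx_def)
  have sums: "(\<Sum>i\<in>{c..k}. restrict (\<lambda>_. 0 :: nat) {1..k} i) = 0" if "c \<ge> 1" for c
    using that by (intro sum.neutral) auto
  have point: "(F has_sum F ?z) (idx k)" if "\<And>p. p \<in> idx k \<Longrightarrow> p \<noteq> ?z \<Longrightarrow> F p = 0" for F :: "_ \<Rightarrow> complex"
    by (rule has_sum_finite_neutralI[of "{?z}"]) (use that z in auto)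
  have s0: "summand q k d l m = (if (l, m) = ?z then 1 else 0)" if "(l, m) \<in> idx k" "\<And>i. d i \<ge> 0" for d l m
    unfolding True by (rule summand_0) (use that assms in auto)
  have F1: "(F1 has_sum F1 ?z) (idx k)"
    by (rule point) (auto simp: F1_def s0 split: if_splits)
  have F3: "(F3 has_sum F3 ?z) (idx k)"
    by (rule point) (auto simp: F3_def s0 split: if_splits)
  have F2: "F2 = (\<lambda>_. 0)"
    by (auto simp: F2_def True)
  have "F1 ?z = 1" "F3 ?z = 1"
    unfolding F1_def F3_def prod.case using z by (auto simp: s0 sums)
  moreover have "chi_tilde K c d q = 1" for c d
    unfolding True by (rule chi_tilde_0) (simp add: K_def)
  ultimately show ?thesis
    using F1 F3 by (auto simp: F2 infsumI has_sum_imp_summable)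
next
  case False
  then interpret qser q
    by unfold_locales (use assms in auto)
  have F1: "F1 = tailp k a b 1"
  proof
    fix p :: "(nat \<Rightarrow> nat) \<times> (nat \<Rightarrow> nat)"
    obtain l m where p: "p = (l, m)" by force
    show "F1 p = tailp k a b 1 p"
      unfolding F1_def p prod.case by (rule summand_eq_tailp[OF assms(1)]) (simp add: dd_eq)
  qed
  have F2: "F2 = (\<lambda>p. q * tailp k (a - 1) (b - 1) 1 p)" if "a * b > 0"
  proof
    fix p :: "(nat \<Rightarrow> nat) \<times> (nat \<Rightarrow> nat)"
    obtain l m where p: "p = (l, m)" by force
    \<comment> \<open>Positivity of both \<open>a\<close> and \<open>b\<close> keeps the truncated
      subtraction exact; the extra 1 in the exponent of the correction is the factor
      \<open>q\<close> in front.\<close>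
    have ab: "a - 1 + 1 = a" "b - 1 + 1 = b" using that by auto
    have "q ^ ((\<Sum>i\<in>{a - 1 + 1..k}. l i) + (\<Sum>i\<in>{b - 1 + 1..k}. m i)) * summand q k (\<lambda>i. if int i = int b - 1 then 1 else 0) l m
        = tailp k (a - 1) (b - 1) 1 (l, m)"
      by (rule summand_eq_tailp[OF assms(1)]) (use that in \<open>auto simp: dd_eq\<close>)
    then show "F2 p = q * tailp k (a - 1) (b - 1) 1 p"
      unfolding F2_def p prod.case ab by (simp add: mult.assoc)
  qed
  \<comment> \<open>With a = k and b = k + 1 both linear exponents are empty and the delta sits
    outside 1..k.\<close>
  have F3: "F3 = tailp k k (k + 1) 1"
  proof
    fix p :: "(nat \<Rightarrow> nat) \<times> (nat \<Rightarrow> nat)"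
    obtain l m where p: "p = (l, m)" by force
    have "q ^ ((\<Sum>i\<in>{k + 1..k}. l i) + (\<Sum>i\<in>{k + 1 + 1..k}. m i)) * summand q k (\<lambda>_. 0) l m = tailp k k (k + 1) 1 (l, m)"
      by (rule summand_eq_tailp[OF assms(1)]) (auto simp: dd_eq)
    then show "F3 p = tailp k k (k + 1) 1 p"
      unfolding F3_def p by simp
  qed
  have sm: "tailp k c d 1 summable_on idx k" for c d
    unfolding idx_def by (rule tailp_summable)
  have eq: "chi_tilde K a b q = infsum F1 (idx k) - (if a * b > 0 then infsum F2 (idx k) else 0)"
    unfolding K_def chi_tilde_eq_sums[OF assms(1-3)] F1 using F2 by (auto simp: infsum_cmult_right')
  show ?thesis
  proof (intro conjI)
    show "F1 summable_on idx k" "F3 summable_on idx k"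
      unfolding F1 F3 by (rule sm)+
    show "chi_tilde K k k q = infsum F3 (idx k)"
      unfolding K_def F3 by (rule chi_tilde_eq_sum_special[OF assms(1)])
    show "if a * b > 0
       then F2 summable_on idx k \<and> chi_tilde K a b q = infsum F1 (idx k) - infsum F2 (idx k)
       else chi_tilde K a b q = infsum F1 (idx k)"
    proof (cases "a * b > 0")
      case True
      have "F2 summable_on idx k"
        unfolding F2[OF True] by (rule summable_on_cmult_right[OF sm])
      then show ?thesis using eq True by simp
    next
      case False
      show ?thesis using eq unfolding if_not_P[OF False] by simp
    qed
  qed
qed

end
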